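(* Let $F=\mathbb{R}$ and let $r\ge 3$, $s\ge 3$ be integers. Then, up to isomorphism of real Lie algebras, the Lie algebra $\mathfrak{H}_{r,s}$ is given as follows, where $k\ge 0$ is the integer with $r+s=8k+\alpha$, $0\le\alpha\le 7$. (1) $r+s=8k$: $\mathfrak{H}_{r,s}\cong\mathfrak{so}(2^{4k-1},2^{4k-1})$ if $s\equiv 0$ or $1 \pmod 4$; $\mathfrak{H}_{r,s}\cong\mathfrak{so}^{*}(2^{4k})$ if $s\equiv 2$ or $3\pmod 4$. (2) $r+s=8k+1$: $\mathfrak{H}_{r,s}\cong\mathfrak{su}(2^{4k-1},2^{4k-1})$ if $s\equiv 0$ or $2\pmod 4$; $\mathfrak{H}_{r,s}\cong\mathfrak{sl}(2^{4k},\mathbb{R})$ if $s\equiv 1\pmod 4$; $\mathfrak{H}_{r,s}\cong\mathfrak{su}^{*}(2^{4k})$ if $s\equiv 3\pmod 4$. (3) $r+s=8k+2$: $\mathfrak{H}_{r,s}\cong\mathfrak{sp}(2^{4k-1},2^{4k-1})$ if $s\equiv 0$ or $3\pmod 4$; $\mathfrak{H}_{r,s}\cong\mathfrak{sp}(2^{4k},\mathbb{R})$ if $s\equiv 1$ or $2\pmod 4$. (4) $r+s=8k+3$: $\mathfrak{H}_{r,s}\cong\mathfrak{sp}(2^{4k},\mathbb{C})_{\mathbb{R}}$ if $s$ is odd; $\mathfrak{H}_{r,s}\cong\mathfrak{sp}(2^{4k-1},2^{4k-1})\oplus\mathfrak{sp}(2^{4k-1},2^{4k-1})$ if $s\equiv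 0\pmod 4$; $\mathfrak{H}_{r,s}\cong\mathfrak{sp}(2^{4k},\mathbb{R})\oplus\mathfrak{sp}(2^{4k},\mathbb{R})$ if $s\equiv 2\pmod 4$. (5) $r+s=8k+4$: $\mathfrak{H}_{r,s}\cong\mathfrak{sp}(2^{4k},2^{4k})$ if $s\equiv 0$ or $1\pmod 4$; $\mathfrak{H}_{r,s}\cong\mathfrak{sp}(2^{4k+1},\mathbb{R})$ if $s\equiv 2$ or $3\pmod 4$. (6) $r+s=8k+5$: $\mathfrak{H}_{r,s}\cong\mathfrak{su}(2^{4k+1},2^{4k+1})$ if $s\equiv 0$ or $2\pmod 4$; $\mathfrak{H}_{r,s}\cong\mathfrak{su}^{*}(2^{4k+2})$ if $s\equiv 1\pmod 4$; $\mathfrak{H}_{r,s}\cong\mathfrak{sl}(2^{4k+2},\mathbb{R})$ if $s\equiv 3\pmod 4$. (7) $r+s=8k+6$: $\mathfrak{H}_{r,s}\cong\mathfrak{so}(2^{4k+2},2^{4k+2})$ if $s\equiv 0$ or $3\pmod 4$; $\mathfrak{H}_{r,s}\cong\mathfrak{so}^{*}(2^{4k+3})$ if $s\equiv 1$ or $2\pmod 4$. (8) $r+s=8k+7$: $\mathfrak{H}_{r,s}\cong\mathfrak{so}(2^{4k+3},\mathbb{C})_{\mathbb{R}}$ if $s$ is odd; $\mathfrak{H}_{r,s}\cong\mathfrak{so}(2^{4k+2},2^{4k+2})\oplus\mathfrak{so}(2^{4k+2},2^{4k+2})$ if $s\equiv 0\pmod 4$; $\mathfrak{H}_{r,s}\cong\mathfrak{so}^{*}(2^{4k+3})\oplus\mathfrak{so}^{*}(2^{4k+3})$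 if $s\equiv 2\pmod 4$.
   Context: Let $n=r+s$ and let $C\ell(r,s)$ be the Clifford algebra over $\mathbb{R}$ of $\mathbb{R}^n$ with canonical basis $e_1,\dots,e_n$ and symmetric bilinear form $Q$ with $Q(e_i,e_j)=0$ for $i\ne j$, $Q(e_i,e_i)=1$ for $1\le i\le r$, $Q(e_i,e_i)=-1$ for $r+1\le i\le r+s$; the sign convention is $v\cdot v=-Q(v,v)1$ for $v\in\mathbb{R}^n$. Let $c$ be the unique algebra anti-automorphism of $C\ell(r,s)$ with $c(v)=-v$ for $v\in\mathbb{R}^n$. The Clifford Lie algebra is $\mathfrak{G}_{r,s}=\{\varphi\in C\ell(r,s): c(\varphi)=-\varphi\}$ with bracket $[x,y]=xy-yx$. For a multi-index $I=(i_1<\dots<i_m)$ with entries in $\{1,\dots,n\}$, $m\geq 1$, put $e_I=e_{i_1}\cdots e_{i_m}$, $|I|=m$. Then $\mathfrak{G}_{r,s}$ is the span of the $e_I$ with $|I|\equiv 1$ or $2\pmod 4$. Let $\omega=e_1e_2\cdots e_n$. The center of $\mathfrak{G}_{r,s}$ is $\mathbb{R}\omega$ if $n\equiv 1\pmod 4$ and $\{0\}$ otherwise, and $\mathfrak{G}_{r,s}=\mathfrak{Z}(\mathfrak{G}_{r,s})\oplus\mathfrak{H}_{r,s}$, where $\mathfrak{H}_{r,s}$ is the semisimple ideal spanned by all $e_I\in\mathfrak{G}_{r,s}$, with $I=(1,\dots,n)$ excluded when $n\equiv 1\pmod 4$ (so $\mathfrak{H}_{r,s}=\mathfrak{G}_{r,s}$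 when $n\not\equiv 1\pmod 4$). Classical real Lie algebras, in the notation of Helgason: $\mathfrak{so}(p,q)$, $\mathfrak{su}(p,q)$ are the usual indefinite (special) orthogonal and unitary Lie algebras; $\mathfrak{so}^*(2m)$ is the real form of $\mathfrak{so}(2m,\mathbb{C})$ with maximal compact subalgebra $\mathfrak{u}(m)$ (type D III); $\mathfrak{su}^*(2m)\cong\mathfrak{sl}(m,\mathbb{H})$ is the real form of $\mathfrak{sl}(2m,\mathbb{C})$ with maximal compact subalgebra $\mathfrak{sp}(m)$ (type A II); $\mathfrak{sp}(m,\mathbb{R})$ and $\mathfrak{sp}(m,\mathbb{C})$ are the symplectic Lie algebras of $2m\times 2m$ matrices; $\mathfrak{sp}(p,q)$ is the real form of $\mathfrak{sp}(p+q,\mathbb{C})$ with maximal compact subalgebra $\mathfrak{sp}(p)\times\mathfrak{sp}(q)$ (type C II). The subscript $\mathbb{R}$ denotes a complex Lie algebra regarded as a real Lie algebra. *)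

theory Defs
  imports
    "HOL-Algebra.QuotRing"
    "Jordan_Normal_Form.Schur_Decomposition"
begin

hide_const (open) Multiset.mult

section \<open>Real Lie algebras\<close>

record 'a real_lie_alg = "'a partial_object" +
  lie_add :: "'a \<Rightarrow> 'a \<Rightarrow> 'a"
  lie_scale :: "real \<Rightarrow> 'a \<Rightarrow> 'a"
  lie_bracket :: "'a \<Rightarrow> 'a \<Rightarrow> 'a"

definition lie_isomorphic :: "'a real_lie_alg \<Rightarrow> 'b real_lie_alg \<Rightarrow> bool"  (infix "\<cong>\<^sub>L" 50)
  where "L \<cong>\<^sub>L M \<longleftrightarrow> (\<exists>f. bij_betw f (carrier L) (carrier M)
     \<and> (\<forall>x\<in>carrier L. \<forall>y\<in>carrier L. f (lie_add L x y) = lie_add M (f x) (f y))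
     \<and> (\<forall>a. \<forall>x\<in>carrier L. f (lie_scale L a x) = lie_scale M a (f x))
     \<and> (\<forall>x\<in>carrier L. \<forall>y\<in>carrier L. f (lie_bracket L x y) = lie_bracket M (f x) (f y)))"

definition lie_sum :: "'a real_lie_alg \<Rightarrow> 'b real_lie_alg \<Rightarrow> ('a \<times> 'b) real_lie_alg"
    (infixr "\<oplus>\<^sub>L" 65)
  where "L \<oplus>\<^sub>L M =
    \<lparr> carrier = carrier L \<times> carrier M,
      lie_add = (\<lambda>x y. (lie_add L (fst x) (fst y), lie_add M (snd x) (snd y))),
      lie_scale = (\<lambda>a x. (lie_scale L a (fst x), lie_scale M a (snd x))),
      lie_bracket = (\<lambda>x y. (lie_bracket L (fst x) (fst y), lie_bracket M (snd x) (snd y))) \<rparr>"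


section \<open>The classical real Lie algebras\<close>

text \<open>The scalars are always real, so that a complex matrix Lie algebra is automatically
  regarded as a real one.\<close>

definition matrix_lie :: "'a::real_algebra_1 mat set \<Rightarrow> 'a mat real_lie_alg"
  where "matrix_lie S =
    \<lparr> carrier = S,
      lie_add = (+),
      lie_scale = (\<lambda>a X. of_real a \<cdot>\<^sub>m X),
      lie_bracket = (\<lambda>X Y. X * Y - Y * X) \<rparr>"

definition mat_trace :: "'a::comm_monoid_add mat \<Rightarrow> 'a"
  where "mat_trace X = (\<Sum>i<dim_row X. X $$ (i, i))"

text \<open>The matrices $I_{p,q}$, $J_m$ and $K_{p,q}$ of Helgason's book.\<close>

definition I_mat :: "nat \<Rightarrow> nat \<Rightarrow> 'a::ring_1 mat"
  where "I_mat p q = four_block_mat (- 1\<^sub>m p) (0\<^sub>m p q) (0\<^sub>m q p) (1\<^sub>m q)"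

definition J_mat :: "nat \<Rightarrow> 'a::ring_1 mat"
  where "J_mat m = four_block_mat (0\<^sub>m m m) (1\<^sub>m m) (- 1\<^sub>m m) (0\<^sub>m m m)"

definition K_mat :: "nat \<Rightarrow> nat \<Rightarrow> 'a::ring_1 mat"
  where "K_mat p q =
    four_block_mat (I_mat p q) (0\<^sub>m (p + q) (p + q)) (0\<^sub>m (p + q) (p + q)) (I_mat p q)"

definition sl_real :: "nat \<Rightarrow> real mat real_lie_alg"
  where "sl_real N = matrix_lie {X \<in> carrier_mat N N. mat_trace X = 0}"

definition so_pq :: "nat \<Rightarrow> nat \<Rightarrow> real mat real_lie_alg"
  where "so_pq p q = matrix_lie {X \<in> carrier_mat (p + q) (p + q).
    transpose_mat X * I_mat p q + I_mat p q * X = 0\<^sub>m (p + q) (p + q)}"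

definition so_complex :: "nat \<Rightarrow> complex mat real_lie_alg"
  where "so_complex N = matrix_lie {X \<in> carrier_mat N N. transpose_mat X + X = 0\<^sub>m N N}"

definition su_pq :: "nat \<Rightarrow> nat \<Rightarrow> complex mat real_lie_alg"
  where "su_pq p q = matrix_lie {X \<in> carrier_mat (p + q) (p + q).
    mat_adjoint X * I_mat p q + I_mat p q * X = 0\<^sub>m (p + q) (p + q) \<and> mat_trace X = 0}"

definition sp_real :: "nat \<Rightarrow> real mat real_lie_alg"
  where "sp_real m = matrix_lie {X \<in> carrier_mat (2 * m) (2 * m).
    transpose_mat X * J_mat m + J_mat m * X = 0\<^sub>m (2 * m) (2 * m)}"

definition sp_complex :: "nat \<Rightarrow> complex mat real_lie_alg"
  where "sp_complex m = matrix_lie {X \<in> carrier_mat (2 * m) (2 * m).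
    transpose_mat X * J_mat m + J_mat m * X = 0\<^sub>m (2 * m) (2 * m)}"

definition sp_pq :: "nat \<Rightarrow> nat \<Rightarrow> complex mat real_lie_alg"
  where "sp_pq p q = matrix_lie {X \<in> carrier_mat (2 * (p + q)) (2 * (p + q)).
    transpose_mat X * J_mat (p + q) + J_mat (p + q) * X = 0\<^sub>m (2 * (p + q)) (2 * (p + q)) \<and>
    mat_adjoint X * K_mat p q + K_mat p q * X = 0\<^sub>m (2 * (p + q)) (2 * (p + q))}"

text \<open>As in the notations $so^*(2m)$ and $su^*(2m)$, the argument of the following two is the
  size of the matrices, and is meant to be even.  The first consists of the elements of
  $so(2m,C)$ that leave invariant the skew-Hermitian form with matrix $J_m$; the second of the
  traceless matrices commuting with the quaternionic structure $z \mapsto J_m \bar z$.\<close>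

definition so_star :: "nat \<Rightarrow> complex mat real_lie_alg"
  where "so_star N = matrix_lie {X \<in> carrier_mat N N.
    transpose_mat X + X = 0\<^sub>m N N \<and>
    mat_adjoint X * J_mat (N div 2) + J_mat (N div 2) * X = 0\<^sub>m N N}"

definition su_star :: "nat \<Rightarrow> complex mat real_lie_alg"
  where "su_star N = matrix_lie {X \<in> carrier_mat N N.
    X * J_mat (N div 2) = J_mat (N div 2) * map_mat cnj X \<and> mat_trace X = 0}"


section \<open>The Clifford algebra\<close>

text \<open>The tensor algebra of $R^n$: finitely supported real functions on the words in the
  letters $1,\dots,n$, where the word $[i_1,\dots,i_m]$ stands for
  $e_{i_1} \otimes \dots \otimes e_{i_m}$; the product extends concatenation of words.
  A vector of $R^n$ is given by its coordinates with indices $1,\dots,n$.\<close>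

definition tensor_alg :: "nat \<Rightarrow> (nat list \<Rightarrow> real) ring"
  where "tensor_alg n =
    \<lparr> carrier = {f. finite {w. f w \<noteq> 0} \<and> (\<forall>w. f w \<noteq> 0 \<longrightarrow> set w \<subseteq> {1..n})},
      mult = (\<lambda>f g w. \<Sum>i\<le>length w. f (take i w) * g (drop i w)),
      one = (\<lambda>w. if w = [] then 1 else 0),
      zero = (\<lambda>w. 0),
      add = (\<lambda>f g w. f w + g w) \<rparr>"

definition tensor_scalar :: "real \<Rightarrow> nat list \<Rightarrow> real"
  where "tensor_scalar a = (\<lambda>w. if w = [] then a else 0)"

definition tensor_vec :: "nat \<Rightarrow> (nat \<Rightarrow> real) \<Rightarrow> nat list \<Rightarrow> real"
  where "tensor_vec n v = (\<lambda>w. \<Sum>i = 1..n. if w = [i] then v i else 0)"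

definition quad_form :: "nat \<Rightarrow> nat \<Rightarrow> (nat \<Rightarrow> real) \<Rightarrow> real"
  where "quad_form r s v = (\<Sum>i = 1..r. (v i)\<^sup>2) - (\<Sum>i = r + 1..r + s. (v i)\<^sup>2)"

text \<open>The two-sided ideal generated by all $v \otimes v + Q(v,v) 1$, and the quotient by it.\<close>

definition clifford_ideal :: "nat \<Rightarrow> nat \<Rightarrow> (nat list \<Rightarrow> real) set"
  where "clifford_ideal r s = genideal (tensor_alg (r + s))
    (range (\<lambda>v. (tensor_vec (r + s) v \<otimes>\<^bsub>tensor_alg (r + s)\<^esub> tensor_vec (r + s) v)
       \<oplus>\<^bsub>tensor_alg (r + s)\<^esub> tensor_scalar (quad_form r s v)))"

definition clifford :: "nat \<Rightarrow> nat \<Rightarrow> (nat list \<Rightarrow> real) set ring"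
  where "clifford r s = tensor_alg (r + s) Quot clifford_ideal r s"

definition clifford_class :: "nat \<Rightarrow> nat \<Rightarrow> (nat list \<Rightarrow> real) \<Rightarrow> (nat list \<Rightarrow> real) set"
  where "clifford_class r s f = clifford_ideal r s +>\<^bsub>tensor_alg (r + s)\<^esub> f"

definition clifford_scale ::
    "nat \<Rightarrow> nat \<Rightarrow> real \<Rightarrow> (nat list \<Rightarrow> real) set \<Rightarrow> (nat list \<Rightarrow> real) set"
  where "clifford_scale r s a x = clifford_class r s (tensor_scalar a) \<otimes>\<^bsub>clifford r s\<^esub> x"

definition clifford_vec :: "nat \<Rightarrow> nat \<Rightarrow> (nat \<Rightarrow> real) \<Rightarrow> (nat list \<Rightarrow> real) set"
  where "clifford_vec r s v = clifford_class r s (tensor_vec (r + s) v)"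

definition clifford_gen :: "nat \<Rightarrow> nat \<Rightarrow> nat \<Rightarrow> (nat list \<Rightarrow> real) set"
  where "clifford_gen r s i = clifford_vec r s (\<lambda>j. if j = i then 1 else 0)"

text \<open>$e_I$ is the product of the $e_i$ with $i \in I$, taken in increasing order.\<close>

definition clifford_mono :: "nat \<Rightarrow> nat \<Rightarrow> nat set \<Rightarrow> (nat list \<Rightarrow> real) set"
  where "clifford_mono r s I =
    foldr (\<lambda>i x. clifford_gen r s i \<otimes>\<^bsub>clifford r s\<^esub> x) (sorted_list_of_set I) \<one>\<^bsub>clifford r s\<^esub>"

definition clifford_antiaut ::
    "nat \<Rightarrow> nat \<Rightarrow> ((nat list \<Rightarrow> real) set \<Rightarrow> (nat list \<Rightarrow> real) set) \<Rightarrow> bool"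
  where "clifford_antiaut r s c \<longleftrightarrow>
    bij_betw c (carrier (clifford r s)) (carrier (clifford r s)) \<and>
    c \<one>\<^bsub>clifford r s\<^esub> = \<one>\<^bsub>clifford r s\<^esub> \<and>
    (\<forall>a. \<forall>x\<in>carrier (clifford r s). c (clifford_scale r s a x) = clifford_scale r s a (c x)) \<and>
    (\<forall>x\<in>carrier (clifford r s). \<forall>y\<in>carrier (clifford r s).
       c (x \<oplus>\<^bsub>clifford r s\<^esub> y) = c x \<oplus>\<^bsub>clifford r s\<^esub> c y \<and>
       c (x \<otimes>\<^bsub>clifford r s\<^esub> y) = c y \<otimes>\<^bsub>clifford r s\<^esub> c x)"

text \<open>Extensionality only fixes the irrelevant values outside the carrier; existence and
  uniqueness are proved below.\<close>

definition clifford_conj ::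
    "nat \<Rightarrow> nat \<Rightarrow> (nat list \<Rightarrow> real) set \<Rightarrow> (nat list \<Rightarrow> real) set"
  where "clifford_conj r s = (THE c. c \<in> extensional (carrier (clifford r s)) \<and>
    clifford_antiaut r s c \<and>
    (\<forall>v. c (clifford_vec r s v) = \<ominus>\<^bsub>clifford r s\<^esub> clifford_vec r s v))"


section \<open>The Clifford Lie algebra and its semisimple ideal\<close>

definition clifford_lie_set :: "nat \<Rightarrow> nat \<Rightarrow> (nat list \<Rightarrow> real) set set"
  where "clifford_lie_set r s =
    {x \<in> carrier (clifford r s). clifford_conj r s x = \<ominus>\<^bsub>clifford r s\<^esub> x}"

definition H_index :: "nat \<Rightarrow> nat \<Rightarrow> nat set set"
  where "H_index r s = {I. I \<subseteq> {1..r + s} \<and> I \<noteq> {} \<and> clifford_mono r s I \<in> clifford_lie_set r s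
     \<and> \<not> ((r + s) mod 4 = 1 \<and> I = {1..r + s})}"

definition H_lie :: "nat \<Rightarrow> nat \<Rightarrow> (nat list \<Rightarrow> real) set real_lie_alg"
  where "H_lie r s =
    \<lparr> carrier = {finsum (clifford r s) (\<lambda>I. clifford_scale r s (a I) (clifford_mono r s I))
                   (H_index r s) | a. True},
      lie_add = add (clifford r s),
      lie_scale = clifford_scale r s,
      lie_bracket = (\<lambda>x y. (x \<otimes>\<^bsub>clifford r s\<^esub> y) \<ominus>\<^bsub>clifford r s\<^esub> (y \<otimes>\<^bsub>clifford r s\<^esub> x)) \<rparr>"


section \<open>Existence and uniqueness of the anti-automorphism\<close>

lemma tensor_mult_eq:
  "(f \<otimes>\<^bsub>tensor_alg n\<^esub> g) w = (\<Sum>i\<le>length w. f (take i w) * g (drop i w))"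
  by (simp add: tensor_alg_def)

lemma tensor_carrierD:
  assumes "f \<in> carrier (tensor_alg n)"
  shows "finite {w. f w \<noteq> 0}" and "f w \<noteq> 0 \<Longrightarrow> set w \<subseteq> {1..n}"
  using assms by (auto simp: tensor_alg_def)

lemma tensor_carrierI:
  assumes "finite {w. f w \<noteq> 0}" and "\<And>w. f w \<noteq> 0 \<Longrightarrow> set w \<subseteq> {1..n}"
  shows "f \<in> carrier (tensor_alg n)"
  using assms by (auto simp: tensor_alg_def)

lemma tensor_add_closed:
  assumes "f \<in> carrier (tensor_alg n)" and "g \<in> carrier (tensor_alg n)"
  shows "(\<lambda>w. f w + g w) \<in> carrier (tensor_alg n)"
proof (rule tensor_carrierI)
  show "finite {w. f w + g w \<noteq> 0}"
    by (rule finite_subset[of _ "{w. f w \<noteq> 0} \<union> {w. g w \<noteq> 0}"])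
      (use assms[THEN tensor_carrierD(1)] in auto)
  show "set w \<subseteq> {1..n}" if "f w + g w \<noteq> 0" for w
    using that assms[THEN tensor_carrierD(2), of w] by (cases "f w = 0") auto
qed

lemma tensor_mult_closed:
  assumes "f \<in> carrier (tensor_alg n)" and "g \<in> carrier (tensor_alg n)"
  shows "f \<otimes>\<^bsub>tensor_alg n\<^esub> g \<in> carrier (tensor_alg n)"
proof (rule tensor_carrierI)
  have *: "\<exists>u v. w = u @ v \<and> f u \<noteq> 0 \<and> g v \<noteq> 0" if "(f \<otimes>\<^bsub>tensor_alg n\<^esub> g) w \<noteq> 0" for w
  proof -
    obtain i where "f (take i w) * g (drop i w) \<noteq> 0"
      using \<open>(f \<otimes>\<^bsub>tensor_alg n\<^esub> g) w \<noteq> 0\<close> unfolding tensor_mult_eq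
      by (meson sum.not_neutral_contains_not_neutral)
    then show ?thesis
      by (intro exI[of _ "take i w"] exI[of _ "drop i w"]) auto
  qed
  show "finite {w. (f \<otimes>\<^bsub>tensor_alg n\<^esub> g) w \<noteq> 0}"
  proof (rule finite_subset)
    show "{w. (f \<otimes>\<^bsub>tensor_alg n\<^esub> g) w \<noteq> 0}
        \<subseteq> (\<lambda>(u, v). u @ v) ` ({w. f w \<noteq> 0} \<times> {w. g w \<noteq> 0})"
      using * by fastforce
  qed (use assms[THEN tensor_carrierD(1)] in auto)
  show "set w \<subseteq> {1..n}" if "(f \<otimes>\<^bsub>tensor_alg n\<^esub> g) w \<noteq> 0" for w
    using *[OF that] tensor_carrierD(2)[OF assms(1)] tensor_carrierD(2)[OF assms(2)]
    by (metis Un_least set_append)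
qed

lemma tensor_mult_assoc:
  "(f \<otimes>\<^bsub>tensor_alg n\<^esub> g) \<otimes>\<^bsub>tensor_alg n\<^esub> h = f \<otimes>\<^bsub>tensor_alg n\<^esub> (g \<otimes>\<^bsub>tensor_alg n\<^esub> h)"
proof
  fix w :: "nat list"
  let ?N = "length w"
  have "((f \<otimes>\<^bsub>tensor_alg n\<^esub> g) \<otimes>\<^bsub>tensor_alg n\<^esub> h) w =
      (\<Sum>m\<le>?N. \<Sum>i\<le>m. f (take i w) * g (drop i (take m w)) * h (drop m w))"
    unfolding tensor_mult_eq
    by (intro sum.cong) (auto simp: sum_distrib_right min_def intro!: sum.cong)
  also have "\<dots> = (\<Sum>(m, i)\<in>(SIGMA m:{..?N}. {..m}).
      f (take i w) * g (drop i (take m w)) * h (drop m w))"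
    by (subst sum.Sigma) auto
  also have "\<dots> = (\<Sum>(i, j)\<in>(SIGMA i:{..?N}. {..?N - i}).
      f (take i w) * (g (take j (drop i w)) * h (drop j (drop i w))))"
    by (rule sum.reindex_bij_witness[where j = "\<lambda>(m, i). (i, m - i)" and i = "\<lambda>(i, j). (i + j, i)"])
      (auto simp: drop_take mult.assoc)
  also have "\<dots> = (\<Sum>i\<le>?N. \<Sum>j\<le>?N - i. f (take i w) * (g (take j (drop i w)) * h (drop j (drop i w))))"
    by (subst sum.Sigma) auto
  also have "\<dots> = (f \<otimes>\<^bsub>tensor_alg n\<^esub> (g \<otimes>\<^bsub>tensor_alg n\<^esub> h)) w"
    unfolding tensor_mult_eq by (simp add: sum_distrib_left)
  finally show "((f \<otimes>\<^bsub>tensor_alg n\<^esub> g) \<otimes>\<^bsub>tensor_alg n\<^esub> h) w = (f \<otimes>\<^bsub>tensor_alg n\<^esub> (g \<otimes>\<^bsub>tensor_alg n\<^esub> h)) w" .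
qed

lemma tensor_scalar_mult: "(tensor_scalar a \<otimes>\<^bsub>tensor_alg n\<^esub> f) w = a * f w"
proof -
  have "(tensor_scalar a \<otimes>\<^bsub>tensor_alg n\<^esub> f) w
      = (\<Sum>i\<le>length w. if i = 0 then a * f w else 0)"
    unfolding tensor_mult_eq by (intro sum.cong) (auto simp: tensor_scalar_def)
  then show ?thesis by simp
qed

lemma tensor_mult_scalar: "(f \<otimes>\<^bsub>tensor_alg n\<^esub> tensor_scalar a) w = a * f w"
proof -
  have "(f \<otimes>\<^bsub>tensor_alg n\<^esub> tensor_scalar a) w
      = (\<Sum>i\<le>length w. if i = length w then a * f w else 0)"
    unfolding tensor_mult_eq by (intro sum.cong) (auto simp: tensor_scalar_def)
  then show ?thesis by simp
qed

lemma tensor_one_eq: "\<one>\<^bsub>tensor_alg n\<^esub> = tensor_scalar 1"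
  by (simp add: tensor_alg_def tensor_scalar_def)

lemma tensor_scalar_carrier: "tensor_scalar a \<in> carrier (tensor_alg n)"
  by (rule tensor_carrierI) (auto simp: tensor_scalar_def split: if_splits)

lemma tensor_vec_nz:
  assumes "tensor_vec n v w \<noteq> 0" shows "\<exists>i\<in>{1..n}. w = [i]"
proof (rule ccontr)
  assume *: "\<not> (\<exists>i\<in>{1..n}. w = [i])"
  have "tensor_vec n v w = 0"
    unfolding tensor_vec_def by (rule sum.neutral) (use * in auto)
  with assms show False by contradiction
qed

lemma tensor_vec_carrier: "tensor_vec n v \<in> carrier (tensor_alg n)"
proof (rule tensor_carrierI)
  have "{w. tensor_vec n v w \<noteq> 0} \<subseteq> (\<lambda>i. [i]) ` {1..n}"
    using tensor_vec_nz by blast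
  then show "finite {w. tensor_vec n v w \<noteq> 0}"
    by (rule finite_subset) simp
  show "set w \<subseteq> {1..n}" if "tensor_vec n v w \<noteq> 0" for w
    using tensor_vec_nz[OF that] by auto
qed

lemma tensor_alg_ring: "ring (tensor_alg n)"
proof (rule ringI)
  let ?T = "tensor_alg n"
  have add: "x \<oplus>\<^bsub>?T\<^esub> y = (\<lambda>w. x w + y w)" for x y
    by (simp add: tensor_alg_def)
  have zero: "\<zero>\<^bsub>?T\<^esub> = (\<lambda>w. 0)"
    by (simp add: tensor_alg_def)
  show "abelian_group ?T"
  proof (rule abelian_groupI)
    show "\<exists>y\<in>carrier ?T. y \<oplus>\<^bsub>?T\<^esub> x = \<zero>\<^bsub>?T\<^esub>" if "x \<in> carrier ?T" for x
    proof
      show "(\<lambda>w. - x w) \<in> carrier ?T"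
        by (rule tensor_carrierI) (use tensor_carrierD[OF that] in auto)
    qed (simp add: add zero)
  qed (simp_all add: add zero tensor_add_closed, simp_all add: tensor_alg_def add_ac)
  show "monoid ?T"
    by (rule monoidI)
      (auto simp: tensor_mult_closed tensor_mult_assoc tensor_one_eq tensor_scalar_carrier
        tensor_scalar_mult tensor_mult_scalar fun_eq_iff)
  show "(x \<oplus>\<^bsub>?T\<^esub> y) \<otimes>\<^bsub>?T\<^esub> z = x \<otimes>\<^bsub>?T\<^esub> z \<oplus>\<^bsub>?T\<^esub> y \<otimes>\<^bsub>?T\<^esub> z" for x y z
    by (simp add: fun_eq_iff add tensor_mult_eq ring_distribs sum.distrib)
  show "z \<otimes>\<^bsub>?T\<^esub> (x \<oplus>\<^bsub>?T\<^esub> y) = z \<otimes>\<^bsub>?T\<^esub> x \<oplus>\<^bsub>?T\<^esub> z \<otimes>\<^bsub>?T\<^esub> y" for x y z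
    by (simp add: fun_eq_iff add tensor_mult_eq ring_distribs sum.distrib)
qed

lemma tensor_add_eq: "f \<oplus>\<^bsub>tensor_alg n\<^esub> g = (\<lambda>w. f w + g w)"
  by (simp add: tensor_alg_def)

lemma tensor_uminus_eq:
  assumes "f \<in> carrier (tensor_alg n)"
  shows "\<ominus>\<^bsub>tensor_alg n\<^esub> f = (\<lambda>w. - f w)"
proof -
  interpret ring "tensor_alg n" by (rule tensor_alg_ring)
  have "(\<lambda>w. - f w) \<in> carrier (tensor_alg n)"
    by (rule tensor_carrierI) (use tensor_carrierD[OF assms] in auto)
  moreover have "(\<lambda>w. - f w) \<oplus>\<^bsub>tensor_alg n\<^esub> f = \<zero>\<^bsub>tensor_alg n\<^esub>"
    by (simp add: tensor_alg_def)
  ultimately show ?thesis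
    using assms minus_equality by blast
qed

lemma clifford_ideal_ideal: "ideal (clifford_ideal r s) (tensor_alg (r + s))"
proof -
  interpret ring "tensor_alg (r + s)" by (rule tensor_alg_ring)
  show ?thesis
    unfolding clifford_ideal_def
    by (rule genideal_ideal) (auto intro!: tensor_vec_carrier tensor_scalar_carrier)
qed

lemma clifford_ring: "ring (clifford r s)"
  unfolding clifford_def by (rule ideal.quotient_is_ring[OF clifford_ideal_ideal])

lemma clifford_carrier: "carrier (clifford r s) = clifford_class r s ` carrier (tensor_alg (r + s))"
  by (auto simp: clifford_def clifford_class_def FactRing_def A_RCOSETS_def RCOSETS_def a_r_coset_def)

lemma clifford_class_hom: "clifford_class r s \<in> Ring.ring_hom (tensor_alg (r + s)) (clifford r s)"
  using ideal.rcos_ring_hom[OF clifford_ideal_ideal[of r s]]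
  by (simp add: clifford_def clifford_class_def[abs_def])

lemma clifford_class_eq_iff:
  assumes "f \<in> carrier (tensor_alg (r + s))" and "g \<in> carrier (tensor_alg (r + s))"
  shows "clifford_class r s f = clifford_class r s g \<longleftrightarrow>
    f \<ominus>\<^bsub>tensor_alg (r + s)\<^esub> g \<in> clifford_ideal r s"
proof -
  interpret ideal "clifford_ideal r s" "tensor_alg (r + s)" by (rule clifford_ideal_ideal)
  show ?thesis
    by (simp add: clifford_class_def quotient_eq_iff_same_a_r_cos[OF ideal_axioms assms])
qed

lemma clifford_vec_square:
  "clifford_vec r s v \<otimes>\<^bsub>clifford r s\<^esub> clifford_vec r s v =
   clifford_scale r s (- quad_form r s v) \<one>\<^bsub>clifford r s\<^esub>"
proof -
  interpret T: ring "tensor_alg (r + s)" by (rule tensor_alg_ring)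
  interpret h: ring_hom_ring "tensor_alg (r + s)" "clifford r s" "clifford_class r s"
    by (rule ring_hom_ringI2[OF tensor_alg_ring clifford_ring clifford_class_hom])
  let ?v = "tensor_vec (r + s) v" and ?q = "quad_form r s v"
  have neg: "tensor_scalar (- ?q) = \<ominus>\<^bsub>tensor_alg (r + s)\<^esub> tensor_scalar ?q"
    by (simp add: tensor_uminus_eq tensor_scalar_carrier) (auto simp: tensor_scalar_def)
  have "clifford_class r s (?v \<otimes>\<^bsub>tensor_alg (r + s)\<^esub> ?v) = clifford_class r s (tensor_scalar (- ?q))"
  proof (subst clifford_class_eq_iff)
    have "?v \<otimes>\<^bsub>tensor_alg (r + s)\<^esub> ?v \<oplus>\<^bsub>tensor_alg (r + s)\<^esub> tensor_scalar ?q \<in> clifford_ideal r s"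
      unfolding clifford_ideal_def
      by (rule subsetD[OF T.genideal_self]) (auto intro!: tensor_vec_carrier tensor_scalar_carrier)
    then show "?v \<otimes>\<^bsub>tensor_alg (r + s)\<^esub> ?v \<ominus>\<^bsub>tensor_alg (r + s)\<^esub> tensor_scalar (- ?q) \<in> clifford_ideal r s"
      by (simp add: neg a_minus_def tensor_scalar_carrier)
  qed (auto intro!: tensor_vec_carrier tensor_scalar_carrier)
  then show ?thesis
    by (simp add: clifford_vec_def clifford_scale_def tensor_vec_carrier tensor_scalar_carrier)
qed

definition tensor_conj :: "(nat list \<Rightarrow> real) \<Rightarrow> nat list \<Rightarrow> real"
  where "tensor_conj f = (\<lambda>w. (-1) ^ length w * f (rev w))"

lemma tensor_conj_conj [simp]: "tensor_conj (tensor_conj f) = f"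
  by (simp add: tensor_conj_def)

lemma tensor_conj_closed:
  assumes "f \<in> carrier (tensor_alg n)"
  shows "tensor_conj f \<in> carrier (tensor_alg n)"
proof (rule tensor_carrierI)
  have "{w. tensor_conj f w \<noteq> 0} = rev ` {w. f w \<noteq> 0}"
    by (auto simp: tensor_conj_def image_iff) (metis rev_rev_ident)
  then show "finite {w. tensor_conj f w \<noteq> 0}"
    using tensor_carrierD(1)[OF assms] by simp
  show "set w \<subseteq> {1..n}" if "tensor_conj f w \<noteq> 0" for w
    using that tensor_carrierD(2)[OF assms, of "rev w"] by (auto simp: tensor_conj_def)
qed

lemma tensor_conj_mult:
  "tensor_conj (f \<otimes>\<^bsub>tensor_alg n\<^esub> g) = tensor_conj g \<otimes>\<^bsub>tensor_alg n\<^esub> tensor_conj f"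
proof
  fix w :: "nat list"
  have "tensor_conj (f \<otimes>\<^bsub>tensor_alg n\<^esub> g) w
      = (\<Sum>i\<le>length w. (-1) ^ length w * (f (take i (rev w)) * g (drop i (rev w))))"
    by (simp add: tensor_conj_def tensor_mult_eq sum_distrib_left)
  also have "\<dots> = (\<Sum>i\<le>length w. tensor_conj g (take i w) * tensor_conj f (drop i w))"
  proof (rule sum.reindex_bij_witness[where i = "\<lambda>i. length w - i" and j = "\<lambda>i. length w - i"])
    fix i assume i: "i \<in> {..length w}"
    have "(-1::real) ^ length w = (-1) ^ (length w - i) * (-1) ^ i"
      using i by (simp flip: power_add)
    then show "tensor_conj g (take (length w - i) w) * tensor_conj f (drop (length w - i) w)
        = (-1) ^ length w * (f (take i (rev w)) * g (drop i (rev w)))"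
      using i by (cases "i = 0") (auto simp: tensor_conj_def take_rev drop_rev min_def)
  qed auto
  also have "\<dots> = (tensor_conj g \<otimes>\<^bsub>tensor_alg n\<^esub> tensor_conj f) w"
    by (simp add: tensor_mult_eq)
  finally show "tensor_conj (f \<otimes>\<^bsub>tensor_alg n\<^esub> g) w
      = (tensor_conj g \<otimes>\<^bsub>tensor_alg n\<^esub> tensor_conj f) w" .
qed

lemma tensor_conj_add:
  "tensor_conj (f \<oplus>\<^bsub>tensor_alg n\<^esub> g) = tensor_conj f \<oplus>\<^bsub>tensor_alg n\<^esub> tensor_conj g"
  by (simp add: tensor_conj_def tensor_add_eq ring_distribs fun_eq_iff)

lemma tensor_conj_uminus:
  assumes "f \<in> carrier (tensor_alg n)"
  shows "tensor_conj (\<ominus>\<^bsub>tensor_alg n\<^esub> f) = \<ominus>\<^bsub>tensor_alg n\<^esub> tensor_conj f"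
  using assms by (simp add: tensor_uminus_eq tensor_conj_closed) (simp add: tensor_conj_def)

lemma tensor_conj_scalar: "tensor_conj (tensor_scalar a) = tensor_scalar a"
  by (auto simp: tensor_conj_def tensor_scalar_def)

lemma tensor_conj_vec: "tensor_conj (tensor_vec n v) = \<ominus>\<^bsub>tensor_alg n\<^esub> tensor_vec n v"
proof -
  have "tensor_conj (tensor_vec n v) w = - tensor_vec n v w" for w
  proof -
    have "tensor_conj (tensor_vec n v) w
        = (\<Sum>i = 1..n. (-1) ^ length w * (if w = [i] then v i else 0))"
      by (simp add: tensor_conj_def tensor_vec_def sum_distrib_left rev_swap)
    also have "\<dots> = (\<Sum>i = 1..n. - (if w = [i] then v i else 0))"
      by (intro sum.cong) auto
    finally show ?thesis by (simp add: tensor_vec_def sum_negf)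
  qed
  then show ?thesis
    by (simp add: tensor_uminus_eq tensor_vec_carrier fun_eq_iff)
qed

lemma tensor_conj_ideal:
  assumes "f \<in> clifford_ideal r s"
  shows "tensor_conj f \<in> clifford_ideal r s"
proof -
  let ?T = "tensor_alg (r + s)"
  interpret T: ring ?T by (rule tensor_alg_ring)
  interpret I: ideal "clifford_ideal r s" ?T by (rule clifford_ideal_ideal)
  define J where "J = {f \<in> carrier ?T. tensor_conj f \<in> clifford_ideal r s}"
  have "ideal J ?T"
  proof (rule idealI)
    show "subgroup J (add_monoid ?T)"
    proof (rule T.add.subgroupI)
      show "J \<subseteq> carrier ?T"
        by (auto simp: J_def)
      have "tensor_conj \<zero>\<^bsub>?T\<^esub> = \<zero>\<^bsub>?T\<^esub>"
        by (simp add: tensor_conj_def tensor_alg_def)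
      then have "\<zero>\<^bsub>?T\<^esub> \<in> J"
        by (simp add: J_def I.zero_closed)
      then show "J \<noteq> {}" by blast
      show "\<ominus>\<^bsub>?T\<^esub> a \<in> J" if "a \<in> J" for a
        using that
        by (simp add: J_def tensor_conj_uminus I.a_inv_closed)
      show "a \<oplus>\<^bsub>?T\<^esub> b \<in> J" if "a \<in> J" "b \<in> J" for a b
        using that by (auto simp: J_def tensor_conj_add I.a_closed)
    qed
  qed (auto simp: J_def tensor_conj_mult tensor_conj_closed I.I_l_closed I.I_r_closed
      intro: tensor_alg_ring)
  moreover have "range (\<lambda>v. (tensor_vec (r + s) v \<otimes>\<^bsub>?T\<^esub> tensor_vec (r + s) v)
       \<oplus>\<^bsub>?T\<^esub> tensor_scalar (quad_form r s v)) \<subseteq> J"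
  proof safe
    fix v
    let ?v = "tensor_vec (r + s) v" and ?q = "tensor_scalar (quad_form r s v)"
    have "tensor_conj (?v \<otimes>\<^bsub>?T\<^esub> ?v \<oplus>\<^bsub>?T\<^esub> ?q) = ?v \<otimes>\<^bsub>?T\<^esub> ?v \<oplus>\<^bsub>?T\<^esub> ?q"
      by (simp add: tensor_conj_add tensor_conj_mult tensor_conj_vec tensor_conj_scalar
          T.l_minus T.r_minus tensor_vec_carrier)
    moreover have "?v \<otimes>\<^bsub>?T\<^esub> ?v \<oplus>\<^bsub>?T\<^esub> ?q \<in> clifford_ideal r s"
      unfolding clifford_ideal_def
      by (rule subsetD[OF T.genideal_self]) (auto intro!: tensor_vec_carrier tensor_scalar_carrier)
    ultimately show "?v \<otimes>\<^bsub>?T\<^esub> ?v \<oplus>\<^bsub>?T\<^esub> ?q \<in> J"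
      by (simp add: J_def tensor_vec_carrier tensor_scalar_carrier)
  qed
  ultimately have "clifford_ideal r s \<subseteq> J"
    unfolding clifford_ideal_def by (rule T.genideal_minimal)
  with assms show ?thesis by (auto simp: J_def)
qed

lemma tensor_induct [consumes 1, case_names scalar add mult]:
  assumes f: "f \<in> carrier (tensor_alg n)"
    and scalar: "\<And>a. P (tensor_scalar a)"
    and add: "\<And>f g. f \<in> carrier (tensor_alg n) \<Longrightarrow> g \<in> carrier (tensor_alg n) \<Longrightarrow> P f \<Longrightarrow> P g
      \<Longrightarrow> P (f \<oplus>\<^bsub>tensor_alg n\<^esub> g)"
    and mult: "\<And>v g. g \<in> carrier (tensor_alg n) \<Longrightarrow> P g \<Longrightarrow> P (tensor_vec n v \<otimes>\<^bsub>tensor_alg n\<^esub> g)"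
  shows "P f"
proof -
  define W :: "nat list \<Rightarrow> real \<Rightarrow> nat list \<Rightarrow> real"
    where "W u a = (\<lambda>w. if w = u then a else 0)" for u a
  have W_carrier: "W u a \<in> carrier (tensor_alg n)" if "set u \<subseteq> {1..n}" for u a
    by (rule tensor_carrierI) (use that in \<open>auto simp: W_def split: if_splits\<close>)
  have W: "P (W u a)" if "set u \<subseteq> {1..n}" for u a
    using that
  proof (induction u)
    case Nil
    have "W [] a = tensor_scalar a" by (auto simp: W_def tensor_scalar_def)
    then show ?case using scalar by simp
  next
    case (Cons i u)
    have vec: "tensor_vec n (\<lambda>j. if j = i then 1 else 0) w = (if w = [i] then 1 else 0)" for w
    proof -
      have "tensor_vec n (\<lambda>j. if j = i then 1 else 0) w
          = (\<Sum>j = 1..n. if j = i then (if w = [i] then 1 else 0) else 0)"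
        unfolding tensor_vec_def by (intro sum.cong) auto
      then show ?thesis using Cons.prems by simp
    qed
    have "(tensor_vec n (\<lambda>j. if j = i then 1 else 0) \<otimes>\<^bsub>tensor_alg n\<^esub> W u a) w = W (i # u) a w" for w
    proof -
      have "(tensor_vec n (\<lambda>j. if j = i then 1 else 0) \<otimes>\<^bsub>tensor_alg n\<^esub> W u a) w
          = (\<Sum>j\<le>length w. if j = 1 then W (i # u) a w else 0)"
        unfolding tensor_mult_eq vec
      proof (intro sum.cong refl)
        fix j assume "j \<in> {..length w}"
        then show "(if take j w = [i] then 1 else 0) * W u a (drop j w)
            = (if j = 1 then W (i # u) a w else 0)"
          by (cases w; cases j) (auto simp: W_def)
      qed
      also have "\<dots> = W (i # u) a w"
        by (cases w) (auto simp: W_def Suc_le_eq)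
      finally show ?thesis .
    qed
    then have "W (i # u) a = tensor_vec n (\<lambda>j. if j = i then 1 else 0) \<otimes>\<^bsub>tensor_alg n\<^esub> W u a"
      by (intro ext) simp
    then show ?case
      using mult W_carrier Cons by simp
  qed
  have "P f" if "finite S" "f \<in> carrier (tensor_alg n)" "{w. f w \<noteq> 0} \<subseteq> S" for S f
    using that
  proof (induction S arbitrary: f rule: finite_induct)
    case empty
    then have "f = tensor_scalar 0" by (auto simp: tensor_scalar_def fun_eq_iff)
    then show ?case using scalar by simp
  next
    case (insert u S)
    show ?case
    proof (cases "f u = 0")
      case True
      then show ?thesis using insert by (intro insert.IH) auto
    next
      case False
      then have u: "set u \<subseteq> {1..n}" using insert.prems tensor_carrierD(2) by blast
      define g where "g = f(u := 0)"
      have g: "g \<in> carrier (tensor_alg n)"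
      proof (rule tensor_carrierI)
        show "finite {w. g w \<noteq> 0}"
          by (rule finite_subset[OF _ tensor_carrierD(1)[OF insert.prems(1)]]) (auto simp: g_def)
        show "set w \<subseteq> {1..n}" if "g w \<noteq> 0" for w
          using that tensor_carrierD(2)[OF insert.prems(1), of w]
          by (auto simp: g_def split: if_splits)
      qed
      have "{w. g w \<noteq> 0} \<subseteq> S" using insert.prems(2) by (auto simp: g_def)
      then have "P g" by (rule insert.IH[OF g])
      then have "P (W u (f u) \<oplus>\<^bsub>tensor_alg n\<^esub> g)"
        using add W W_carrier u g by simp
      also have "W u (f u) \<oplus>\<^bsub>tensor_alg n\<^esub> g = f"
        by (auto simp: tensor_add_eq W_def g_def)
      finally show ?thesis .
    qed
  qed
  then show ?thesis using f tensor_carrierD(1) by blast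
qed

theorem clifford_conj_ex1:
  "\<exists>!c. c \<in> extensional (carrier (clifford r s)) \<and> clifford_antiaut r s c \<and>
    (\<forall>v. c (clifford_vec r s v) = \<ominus>\<^bsub>clifford r s\<^esub> clifford_vec r s v)"
proof (rule ex_ex1I)
  let ?T = "tensor_alg (r + s)" and ?C = "clifford r s" and ?cl = "clifford_class r s"
  interpret T: ring ?T by (rule tensor_alg_ring)
  interpret C: ring ?C by (rule clifford_ring)
  interpret h: ring_hom_ring ?T ?C ?cl
    by (rule ring_hom_ringI2[OF tensor_alg_ring clifford_ring clifford_class_hom])
  note carr = tensor_conj_closed tensor_vec_carrier tensor_scalar_carrier
  have scale: "clifford_scale r s a (?cl f) = ?cl (tensor_scalar a \<otimes>\<^bsub>?T\<^esub> f)"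
    if "f \<in> carrier ?T" for a f
    using that by (simp add: clifford_scale_def carr)
  define c where "c = restrict (\<lambda>x. ?cl (tensor_conj (SOME f. f \<in> carrier ?T \<and> ?cl f = x))) (carrier ?C)"
  have c: "c (?cl f) = ?cl (tensor_conj f)" if f: "f \<in> carrier ?T" for f
  proof -
    define g where "g = (SOME g. g \<in> carrier ?T \<and> ?cl g = ?cl f)"
    have "g \<in> carrier ?T \<and> ?cl g = ?cl f"
      unfolding g_def using f by (intro someI[of "\<lambda>g. g \<in> carrier ?T \<and> ?cl g = ?cl f" f]) simp
    then have g: "g \<in> carrier ?T" and "g \<ominus>\<^bsub>?T\<^esub> f \<in> clifford_ideal r s"
      using f clifford_class_eq_iff by auto
    then have "tensor_conj (g \<ominus>\<^bsub>?T\<^esub> f) \<in> clifford_ideal r s"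
      by (intro tensor_conj_ideal)
    then have "tensor_conj g \<ominus>\<^bsub>?T\<^esub> tensor_conj f \<in> clifford_ideal r s"
      using f by (simp add: a_minus_def tensor_conj_add tensor_conj_uminus)
    then have "?cl (tensor_conj g) = ?cl (tensor_conj f)"
      using f g clifford_class_eq_iff carr by blast
    then show ?thesis
      using f by (simp add: c_def g_def)
  qed
  have "clifford_antiaut r s c"
    unfolding clifford_antiaut_def
  proof (intro conjI allI ballI)
    show "bij_betw c (carrier ?C) (carrier ?C)"
      by (rule bij_betw_byWitness[where f' = c]) (auto simp: clifford_carrier c carr)
    show "c \<one>\<^bsub>?C\<^esub> = \<one>\<^bsub>?C\<^esub>"
      using c[of "\<one>\<^bsub>?T\<^esub>"] by (simp add: tensor_conj_scalar flip: h.hom_one) (simp add: tensor_one_eq tensor_conj_scalar)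
    show "c (clifford_scale r s a x) = clifford_scale r s a (c x)" if x: "x \<in> carrier ?C" for a x
    proof -
      obtain f where f: "f \<in> carrier ?T" "x = ?cl f" using x by (auto simp: clifford_carrier)
      have "tensor_conj f \<otimes>\<^bsub>?T\<^esub> tensor_scalar a = tensor_scalar a \<otimes>\<^bsub>?T\<^esub> tensor_conj f"
        by (simp add: fun_eq_iff tensor_scalar_mult tensor_mult_scalar)
      then show ?thesis
        using f by (simp add: scale c carr tensor_conj_mult tensor_conj_scalar del: h.hom_mult)
    qed
    show "c (x \<oplus>\<^bsub>?C\<^esub> y) = c x \<oplus>\<^bsub>?C\<^esub> c y" if "x \<in> carrier ?C" "y \<in> carrier ?C" for x y
      using that by (auto simp: clifford_carrier c carr tensor_conj_add simp flip: h.hom_add)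
    show "c (x \<otimes>\<^bsub>?C\<^esub> y) = c y \<otimes>\<^bsub>?C\<^esub> c x" if "x \<in> carrier ?C" "y \<in> carrier ?C" for x y
      using that by (auto simp: clifford_carrier c carr tensor_conj_mult simp flip: h.hom_mult)
  qed
  moreover have "c (clifford_vec r s v) = \<ominus>\<^bsub>?C\<^esub> clifford_vec r s v" for v
    by (simp add: clifford_vec_def c carr tensor_conj_vec)
  moreover have "c \<in> extensional (carrier ?C)"
    by (simp add: c_def)
  ultimately show "\<exists>c. c \<in> extensional (carrier ?C) \<and> clifford_antiaut r s c \<and>
      (\<forall>v. c (clifford_vec r s v) = \<ominus>\<^bsub>?C\<^esub> clifford_vec r s v)" by blast
  fix c d
  assume c: "c \<in> extensional (carrier ?C) \<and> clifford_antiaut r s c \<and>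
      (\<forall>v. c (clifford_vec r s v) = \<ominus>\<^bsub>?C\<^esub> clifford_vec r s v)"
    and d: "d \<in> extensional (carrier ?C) \<and> clifford_antiaut r s d \<and>
      (\<forall>v. d (clifford_vec r s v) = \<ominus>\<^bsub>?C\<^esub> clifford_vec r s v)"
  have cl_scalar: "?cl (tensor_scalar a) = clifford_scale r s a \<one>\<^bsub>?C\<^esub>" for a
    by (simp add: clifford_scale_def carr)
  have "c (?cl f) = d (?cl f)" if "f \<in> carrier ?T" for f
    using that
  proof (induction rule: tensor_induct)
    case (scalar a)
    then show ?case using c d by (simp add: cl_scalar clifford_antiaut_def)
  next
    case (add f g)
    then show ?case using c d by (simp add: clifford_antiaut_def)
  next
    case (mult v g)
    have "clifford_vec r s v \<in> carrier ?C" by (simp add: clifford_vec_def carr)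
    with mult c d show ?case by (simp add: clifford_antiaut_def carr flip: clifford_vec_def)
  qed
  then show "c = d"
    using c d by (intro extensionalityI[of _ "carrier ?C"]) (auto simp: clifford_carrier)
qed

lemmas clifford_conj_props = theI'[OF clifford_conj_ex1, folded clifford_conj_def]

end

theory Submission
  imports Defs "HOL-Library.Z2" "HOL-Library.Product_Plus" "HOL-Number_Theory.Cong"
begin

text \<open>
  The idea is to realise the Clifford generators by Pauli matrices, i.e. by tensor products of the
  real $2 \times 2$ matrices $1$, $X$, $Z$ and $Y = ZX$, multiplied by $i$ where necessary. The
  words $v$ in these letters form a vector space over the field with two elements. The matrices
  $P_v$ multiply like words up to signs, any two of them commute or anticommute according to a
  symplectic form, and transposition multiplies $P_v$ by a sign which is a quadratic function of
  $v$. The $P_v$, or the $P_v$ and $i P_v$, are a basis over the reals of all real, or complex,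
  matrices of size $2^m$.

  Each target Lie algebra of size $2^m$ is defined by conditions in terms of transposition,
  adjoint, complex conjugation, trace, and the matrices $I_{p,p}$, $J_m$ and $K_{p,p}$. The latter
  are Pauli matrices up to sign, so all these conditions are diagonal in the Pauli basis. Hence
  the Lie algebra is the span of those $i^{\varepsilon} P_v$ for which a quadratic form in $v$
  takes the value 1, or with $v \neq 0$ in the case of $sl$ and $su^*$ (and $\varepsilon$ is
  determined by $v$, or free); see
  \<open>so_pq_pauli\<close> to \<open>su_star_pauli\<close>.

  On the Clifford side, $e_I$ belongs to the Lie algebra if and only if $|I| \equiv 1$ or $2$
  modulo 4 (\<open>H_index_eq\<close>), which means that $|I| + |I|(|I|-1)/2$ is odd. Now let $n$
  pairwise anticommuting words be given on which a quadratic form is constantly 1. The value of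
  the form on the sum of the words over $I$ is $|I| + |I|(|I|-1)/2$ modulo 2
  (\<open>qf_sum\<close>). So the subsets with $e_I$ in the Lie algebra correspond exactly to the
  words on which the form is 1. For $n = 2m$ the words are a basis of the space of all words, and
  the homomorphism given by the universal property of the Clifford algebra restricts to an
  isomorphism of the Lie algebras (\<open>clifford_lie_iso\<close>, \<open>graded_lie_iso\<close>,
  \<open>even_iso\<close>). For $n = 2m + 1$ the words add up to 0, so that every word is the sum
  over two complementary subsets. Either exactly one of them satisfies the condition on its size
  (\<open>nonzero_iso\<close>), or an additional bit distinguishes them: the power of $i$
  (\<open>central_iso\<close>), or the sign in which two representations differ
  (\<open>double_iso\<close>).

  It remains to find anticommuting words with the right squares, namely $r$ with square $-1$ and
  $s$ with square $1$ (\<open>frame\<close>). Symplectic reflections that preserve the form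
  defining the target change the numbers $(r, s)$ to $(r \pm 4, s \mp 4)$ and $(s - 1, r + 1)$, so
  only $s$ modulo 4 matters and its classes are paired (\<open>frame_classes\<close>). Four more
  tensor factors allow for eight more generators (\<open>frame_step\<close>), which is the
  periodicity modulo 8. What is left are a few words of length at most 5, written down explicitly.
\<close>

hide_const (open) Multiset.mult

section \<open>Algebras over the reals\<close>

locale real_alg = ring R for R (structure) +
  fixes sc :: "real \<Rightarrow> 'a \<Rightarrow> 'a"
  assumes sc_closed [simp, intro]: "x \<in> carrier R \<Longrightarrow> sc a x \<in> carrier R"
    and sc_add: "x \<in> carrier R \<Longrightarrow> sc (a + b) x = sc a x \<oplus> sc b x"
    and sc_add_right: "x \<in> carrier R \<Longrightarrow> y \<in> carrier R \<Longrightarrow> sc a (x \<oplus> y) = sc a x \<oplus> sc a y"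
    and sc_sc [simp]: "x \<in> carrier R \<Longrightarrow> sc a (sc b x) = sc (a * b) x"
    and sc_one [simp]: "x \<in> carrier R \<Longrightarrow> sc 1 x = x"
    and sc_mult_left: "x \<in> carrier R \<Longrightarrow> y \<in> carrier R \<Longrightarrow> sc a x \<otimes> y = sc a (x \<otimes> y)"
    and sc_mult_right: "x \<in> carrier R \<Longrightarrow> y \<in> carrier R \<Longrightarrow> x \<otimes> sc a y = sc a (x \<otimes> y)"
begin

lemma sc_zero_left [simp]: "x \<in> carrier R \<Longrightarrow> sc 0 x = \<zero>"
proof -
  assume x: "x \<in> carrier R"
  have "sc 0 x \<oplus> sc 0 x = sc 0 x" using sc_add[OF x, of 0 0] by simp
  then show ?thesis using x by (intro add.r_cancel_one[THEN iffD1]) auto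
qed

lemma sc_zero_right [simp]: "sc a \<zero> = \<zero>"
proof -
  have "sc a \<zero> \<oplus> sc a \<zero> = sc a \<zero>" using sc_add_right[of \<zero> \<zero> a] by simp
  then show ?thesis by (intro add.r_cancel_one[THEN iffD1]) auto
qed

lemma sc_minus_left: "x \<in> carrier R \<Longrightarrow> sc (- a) x = \<ominus> sc a x"
  using sc_add[of x "- a" a] by (simp add: minus_equality)

lemma sc_minus_right: "x \<in> carrier R \<Longrightarrow> sc a (\<ominus> x) = \<ominus> sc a x"
  using sc_add_right[of "\<ominus> x" x a] by (intro minus_equality[symmetric]) (auto simp: l_neg)

lemma sc_finsum:
  "f \<in> A \<rightarrow> carrier R \<Longrightarrow> sc a (finsum R f A) = finsum R (\<lambda>i. sc a (f i)) A"
proof (induction A rule: infinite_finite_induct)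
  case (insert x F)
  then show ?case by (simp add: sc_add_right Pi_iff)
qed auto

lemma sc_eq_zero_iff: "x \<in> carrier R \<Longrightarrow> sc a x = \<zero> \<longleftrightarrow> a = 0 \<or> x = \<zero>"
proof
  assume x: "x \<in> carrier R" and "sc a x = \<zero>"
  then have "sc (inverse a) (sc a x) = \<zero>" by simp
  then show "a = 0 \<or> x = \<zero>" using x by (cases "a = 0") auto
qed auto

definition lin :: "'v set \<Rightarrow> ('v \<Rightarrow> 'a) \<Rightarrow> ('v \<Rightarrow> real) \<Rightarrow> 'a"
  where "lin V b c = finsum R (\<lambda>v. sc (c v) (b v)) V"

lemma lin_closed [simp]: "b \<in> V \<rightarrow> carrier R \<Longrightarrow> lin V b c \<in> carrier R"
  unfolding lin_def by (rule finsum_closed) auto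

lemma lin_add:
  assumes "b \<in> V \<rightarrow> carrier R"
  shows "lin V b (\<lambda>v. c v + d v) = lin V b c \<oplus> lin V b d"
proof -
  have "lin V b (\<lambda>v. c v + d v) = finsum R (\<lambda>v. sc (c v) (b v) \<oplus> sc (d v) (b v)) V"
    unfolding lin_def using assms by (intro finsum_cong') (auto simp: sc_add Pi_iff)
  also have "\<dots> = lin V b c \<oplus> lin V b d"
    unfolding lin_def using assms by (intro finsum_addf) auto
  finally show ?thesis .
qed

lemma lin_scale:
  assumes "b \<in> V \<rightarrow> carrier R"
  shows "lin V b (\<lambda>v. a * c v) = sc a (lin V b c)"
proof -
  have "lin V b (\<lambda>v. a * c v) = finsum R (\<lambda>v. sc a (sc (c v) (b v))) V"
    unfolding lin_def using assms by (intro finsum_cong') (auto simp: Pi_iff)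
  then show ?thesis
    unfolding lin_def using assms by (subst sc_finsum) auto
qed

lemma lin_cong:
  assumes "b \<in> V \<rightarrow> carrier R" and "\<And>v. v \<in> V \<Longrightarrow> c v = d v" and "\<And>v. v \<in> V \<Longrightarrow> b v = b' v"
  shows "lin V b c = lin V b' d"
  unfolding lin_def using assms by (intro finsum_cong') (auto simp: Pi_iff)

lemma lin_mono_neutral:
  assumes "finite V" and "S \<subseteq> V" and "b \<in> V \<rightarrow> carrier R" and "\<And>v. v \<in> V - S \<Longrightarrow> c v = 0"
  shows "lin V b c = lin S b c"
  unfolding lin_def using assms
  by (intro add.finprod_mono_neutral_cong_left[symmetric]) (auto simp: Pi_iff)

lemma lin_reindex:
  assumes "inj_on u A" and "b \<in> u ` A \<rightarrow> carrier R"
  shows "lin (u ` A) b c = lin A (b \<circ> u) (c \<circ> u)"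
  unfolding lin_def using assms by (subst add.finprod_reindex) (auto simp: Pi_iff)

definition indep :: "'v set \<Rightarrow> ('v \<Rightarrow> 'a) \<Rightarrow> bool"
  where "indep V b \<longleftrightarrow> finite V \<and> b \<in> V \<rightarrow> carrier R \<and> (\<forall>c. lin V b c = \<zero> \<longrightarrow> (\<forall>v\<in>V. c v = 0))"

lemma lin_eqD:
  assumes "indep V b" and "lin V b c = lin V b d" and "v \<in> V"
  shows "c v = d v"
proof -
  have b: "b \<in> V \<rightarrow> carrier R" using assms(1) by (simp add: indep_def)
  have "lin V b (\<lambda>v. c v + (-1) * d v) = \<zero>"
    using b by (simp only: lin_add lin_scale assms(2)) (simp add: sc_minus_left r_neg)
  then show ?thesis
    using assms(1,3) unfolding indep_def by (metis add.commute add_diff_cancel_left' diff_0_right mult_minus1 uminus_add_conv_diff diff_eq_diff_eq eq_iff_diff_eq_0)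
qed

lemma indep_subset:
  assumes "indep V b" and "S \<subseteq> V"
  shows "indep S b"
  unfolding indep_def
proof (intro conjI allI impI ballI)
  show "finite S" "b \<in> S \<rightarrow> carrier R"
    using assms by (auto simp: indep_def finite_subset)
  fix c v assume c: "lin S b c = \<zero>" and v: "v \<in> S"
  have "lin V b (\<lambda>v. if v \<in> S then c v else 0) = lin S b (\<lambda>v. if v \<in> S then c v else 0)"
    by (rule lin_mono_neutral) (use assms in \<open>auto simp: indep_def\<close>)
  also have "\<dots> = lin S b c"
    by (rule lin_cong) (use assms in \<open>auto simp: indep_def\<close>)
  finally show "c v = 0"
    using assms c v unfolding indep_def by (metis (mono_tags, lifting) subsetD)
qed

text \<open>The recursion is that of the monomials $e_I$, so that a homomorphism sending the
  generators to the $E_i$ sends $e_I$ to the ordered product over $I$.\<close>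

definition oprod :: "(nat \<Rightarrow> 'a) \<Rightarrow> nat list \<Rightarrow> 'a"
  where "oprod E xs = foldr (\<lambda>i x. E i \<otimes> x) xs \<one>"

lemma oprod_simps [simp]: "oprod E [] = \<one>" "oprod E (i # xs) = E i \<otimes> oprod E xs"
  by (simp_all add: oprod_def)

lemma oprod_closed:
  "E \<in> A \<rightarrow> carrier R \<Longrightarrow> set xs \<subseteq> A \<Longrightarrow> oprod E xs \<in> carrier R"
  by (induction xs) auto

lemma oprod_append:
  "E \<in> A \<rightarrow> carrier R \<Longrightarrow> set xs \<subseteq> A \<Longrightarrow> set ys \<subseteq> A \<Longrightarrow> oprod E (xs @ ys) = oprod E xs \<otimes> oprod E ys"
proof (induction xs)
  case Nil
  then show ?case by (simp add: oprod_closed)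
next
  case (Cons x xs)
  then have "E x \<in> carrier R" "oprod E xs \<in> carrier R" "oprod E ys \<in> carrier R"
    by (auto intro!: oprod_closed[of E A])
  with Cons show ?case by (simp add: m_assoc)
qed

definition clifford_rel :: "nat \<Rightarrow> nat \<Rightarrow> (nat \<Rightarrow> 'a) \<Rightarrow> bool"
  where "clifford_rel r s E \<longleftrightarrow> E \<in> {1..r + s} \<rightarrow> carrier R \<and>
    (\<forall>i\<in>{1..r + s}. E i \<otimes> E i = sc (if i \<le> r then -1 else 1) \<one>) \<and>
    (\<forall>i\<in>{1..r + s}. \<forall>j\<in>{1..r + s}. i \<noteq> j \<longrightarrow> E i \<otimes> E j = \<ominus> (E j \<otimes> E i))"

lemma clifford_relD:
  assumes "clifford_rel r s E"
  shows "E \<in> {1..r + s} \<rightarrow> carrier R"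
    and "i \<in> {1..r + s} \<Longrightarrow> E i \<otimes> E i = sc (if i \<le> r then -1 else 1) \<one>"
    and "i \<in> {1..r + s} \<Longrightarrow> j \<in> {1..r + s} \<Longrightarrow> i \<noteq> j \<Longrightarrow> E i \<otimes> E j = \<ominus> (E j \<otimes> E i)"
  using assms unfolding clifford_rel_def by (blast, blast, blast)

text \<open>The cross terms cancel in pairs by anticommutation. This is the identity $v \cdot v =
  -Q(v,v)$ in the target algebra, by which a Clifford system makes the evaluation of tensors vanish
  on the Clifford ideal.\<close>

lemma clifford_rel_lin_square:
  assumes E: "clifford_rel r s E" and A: "A \<subseteq> {1..r + s}"
  shows "lin A E v \<otimes> lin A E v = sc (\<Sum>i\<in>A. (v i)\<^sup>2 * (if i \<le> r then -1 else 1)) \<one>"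
proof -
  have "finite A" using A finite_subset by blast
  then show ?thesis using A
  proof (induction A rule: finite_induct)
    case empty
    then show ?case by (simp add: lin_def)
  next
    case (insert k A)
    let ?x = "lin A E v" and ?y = "sc (v k) (E k)"
    have EA: "E \<in> A \<rightarrow> carrier R" and Ek: "E k \<in> carrier R"
      using insert.prems clifford_relD(1)[OF E] by auto
    have x: "?x \<in> carrier R" and y: "?y \<in> carrier R"
      using EA Ek by auto
    have lin: "lin (insert k A) E v = ?y \<oplus> ?x"
      using insert EA Ek unfolding lin_def by (subst finsum_insert) auto
    have "?y \<otimes> ?x = finsum R (\<lambda>i. ?y \<otimes> sc (v i) (E i)) A"
      unfolding lin_def using EA y insert(1) by (intro finsum_rdistr) auto
    also have "\<dots> = finsum R (\<lambda>i. sc (-1) (sc (v i) (E i) \<otimes> ?y)) A"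
    proof (intro finsum_cong' refl)
      show "(\<lambda>i. sc (-1) (sc (v i) (E i) \<otimes> ?y)) \<in> A \<rightarrow> carrier R"
        using EA y by auto
      fix i assume i: "i \<in> A"
      then have "k \<in> {1..r + s}" "i \<in> {1..r + s}" "k \<noteq> i"
        using insert(2,4) by auto
      then have "E k \<otimes> E i = \<ominus> (E i \<otimes> E k)" "E i \<in> carrier R"
        using clifford_relD(3)[OF E, of k i] EA i by blast+
      then show "?y \<otimes> sc (v i) (E i) = sc (-1) (sc (v i) (E i) \<otimes> ?y)"
        using Ek by (simp add: sc_mult_left sc_mult_right sc_minus_right sc_minus_left mult.commute)
    qed
    also have "\<dots> = sc (-1) (?x \<otimes> ?y)"
      unfolding lin_def using EA y insert(1)
      by (subst finsum_ldistr, simp, simp, simp add: Pi_iff) (rule sc_finsum[symmetric], simp add: Pi_iff)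
    finally have yx: "?y \<otimes> ?x = \<ominus> (?x \<otimes> ?y)"
      using x y by (simp add: sc_minus_left)
    have "E k \<otimes> E k = sc (if k \<le> r then -1 else 1) \<one>"
      using clifford_relD(2)[OF E, of k] insert.prems by auto
    then have "?y \<otimes> ?y = sc ((v k)\<^sup>2 * (if k \<le> r then -1 else 1)) \<one>"
      using Ek by (simp add: sc_mult_left sc_mult_right power2_eq_square mult.assoc)
    moreover have "?x \<otimes> ?x = sc (\<Sum>i\<in>A. (v i)\<^sup>2 * (if i \<le> r then -1 else 1)) \<one>"
      using insert by simp
    moreover have "(?y \<oplus> ?x) \<otimes> (?y \<oplus> ?x) = (?y \<otimes> ?y \<oplus> ?x \<otimes> ?x) \<oplus> (?x \<otimes> ?y \<oplus> ?y \<otimes> ?x)"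
      using x y by (simp add: l_distr r_distr a_ac)
    ultimately have "(?y \<oplus> ?x) \<otimes> (?y \<oplus> ?x) = sc ((v k)\<^sup>2 * (if k \<le> r then -1 else 1)) \<one>
        \<oplus> sc (\<Sum>i\<in>A. (v i)\<^sup>2 * (if i \<le> r then -1 else 1)) \<one>"
      using x y by (simp add: yx r_neg)
    then show ?case
      using insert(1,2) by (simp add: lin sc_add)
  qed
qed

end

section \<open>Evaluation of tensors\<close>

definition tensor_word :: "nat list \<Rightarrow> real \<Rightarrow> nat list \<Rightarrow> real"
  where "tensor_word u a = (\<lambda>w. if w = u then a else 0)"

lemma tensor_word_carrier: "set u \<subseteq> {1..n} \<Longrightarrow> tensor_word u a \<in> carrier (tensor_alg n)"
  by (rule tensor_carrierI) (auto simp: tensor_word_def split: if_splits)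

lemma tensor_word_mult:
  "tensor_word u a \<otimes>\<^bsub>tensor_alg n\<^esub> tensor_word v b = tensor_word (u @ v) (a * b)"
proof
  fix w
  have "(tensor_word u a \<otimes>\<^bsub>tensor_alg n\<^esub> tensor_word v b) w
      = (\<Sum>i\<le>length w. if i = length u then tensor_word (u @ v) (a * b) w else 0)"
    unfolding tensor_mult_eq
  proof (intro sum.cong refl)
    fix i assume i: "i \<in> {..length w}"
    have "take i w = u \<and> drop i w = v \<longleftrightarrow> i = length u \<and> w = u @ v"
    proof
      assume "take i w = u \<and> drop i w = v"
      then show "i = length u \<and> w = u @ v"
        using i append_take_drop_id[of i w] length_take[of i w] by (metis atMost_iff min.absorb2)
    qed simp
    then show "tensor_word u a (take i w) * tensor_word v b (drop i w)
        = (if i = length u then tensor_word (u @ v) (a * b) w else 0)"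
      unfolding tensor_word_def by (smt (verit) mult_eq_0_iff)
  qed
  also have "\<dots> = tensor_word (u @ v) (a * b) w"
    by (auto simp: tensor_word_def)
  finally show "(tensor_word u a \<otimes>\<^bsub>tensor_alg n\<^esub> tensor_word v b) w = tensor_word (u @ v) (a * b) w" .
qed

text \<open>Tensors are finitely supported, so additive statements reduce to multiples of single
  words.\<close>

lemma tensor_word_induct [consumes 1, case_names word add]:
  assumes f: "f \<in> carrier (tensor_alg n)"
    and word: "\<And>u a. set u \<subseteq> {1..n} \<Longrightarrow> P (tensor_word u a)"
    and add: "\<And>f g. f \<in> carrier (tensor_alg n) \<Longrightarrow> g \<in> carrier (tensor_alg n) \<Longrightarrow> P f \<Longrightarrow> P g \<Longrightarrow>
      P (f \<oplus>\<^bsub>tensor_alg n\<^esub> g)"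
  shows "P f"
proof -
  have "P f" if "finite S" "f \<in> carrier (tensor_alg n)" "{w. f w \<noteq> 0} \<subseteq> S" for S f
    using that
  proof (induction S arbitrary: f rule: finite_induct)
    case empty
    then have "f = tensor_word [] 0" by (auto simp: tensor_word_def fun_eq_iff)
    then show ?case using word by simp
  next
    case (insert u S)
    show ?case
    proof (cases "f u = 0")
      case True
      then show ?thesis using insert by (intro insert.IH) auto
    next
      case False
      then have u: "set u \<subseteq> {1..n}" using insert.prems tensor_carrierD(2) by blast
      have g: "f(u := 0) \<in> carrier (tensor_alg n)"
      proof (rule tensor_carrierI)
        show "finite {w. (f(u := 0)) w \<noteq> 0}"
          by (rule finite_subset[OF _ tensor_carrierD(1)[OF insert.prems(1)]]) auto
        show "set w \<subseteq> {1..n}" if "(f(u := 0)) w \<noteq> 0" for w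
          by (rule tensor_carrierD(2)[OF insert.prems(1)]) (use that in \<open>auto split: if_splits\<close>)
      qed
      have "P (f(u := 0))" by (rule insert.IH[OF g]) (use insert.prems(2) in auto)
      then have "P (tensor_word u (f u) \<oplus>\<^bsub>tensor_alg n\<^esub> f(u := 0))"
        using add word tensor_word_carrier u g by simp
      also have "tensor_word u (f u) \<oplus>\<^bsub>tensor_alg n\<^esub> f(u := 0) = f"
        by (auto simp: tensor_add_eq tensor_word_def)
      finally show ?thesis .
    qed
  qed
  then show ?thesis using f tensor_carrierD(1) by blast
qed

context real_alg
begin

text \<open>The algebra homomorphism from the tensor algebra determined by the images $E_i$ of the
  letters: a tensor is evaluated as a linear combination of ordered products over its finite
  support.\<close>

definition tensor_eval :: "(nat \<Rightarrow> 'a) \<Rightarrow> (nat list \<Rightarrow> real) \<Rightarrow> 'a"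
  where "tensor_eval E f = lin {w. f w \<noteq> 0} (oprod E) f"

context
  fixes E :: "nat \<Rightarrow> 'a" and n :: nat
  assumes E: "E \<in> {1..n} \<rightarrow> carrier R"
begin

lemma oprod_words: "D \<subseteq> {w. set w \<subseteq> {1..n}} \<Longrightarrow> oprod E \<in> D \<rightarrow> carrier R"
  by (blast intro: oprod_closed[OF E])

lemma tensor_eval_superset:
  assumes "finite D" and "{w. f w \<noteq> 0} \<subseteq> D" and "D \<subseteq> {w. set w \<subseteq> {1..n}}"
  shows "tensor_eval E f = lin D (oprod E) f"
  unfolding tensor_eval_def
  by (rule lin_mono_neutral[symmetric]) (use assms oprod_words in auto)

lemma tensor_eval_closed: "f \<in> carrier (tensor_alg n) \<Longrightarrow> tensor_eval E f \<in> carrier R"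
  unfolding tensor_eval_def using tensor_carrierD(2) by (intro lin_closed oprod_words) blast

lemma tensor_eval_add:
  assumes f: "f \<in> carrier (tensor_alg n)" and g: "g \<in> carrier (tensor_alg n)"
  shows "tensor_eval E (f \<oplus>\<^bsub>tensor_alg n\<^esub> g) = tensor_eval E f \<oplus> tensor_eval E g"
proof -
  let ?D = "{w. f w \<noteq> 0} \<union> {w. g w \<noteq> 0}"
  have D: "finite ?D" "?D \<subseteq> {w. set w \<subseteq> {1..n}}"
    using tensor_carrierD[OF f] tensor_carrierD[OF g] by auto
  have "tensor_eval E (\<lambda>w. f w + g w) = lin ?D (oprod E) (\<lambda>w. f w + g w)"
    by (rule tensor_eval_superset) (use D in auto)
  also have "\<dots> = lin ?D (oprod E) f \<oplus> lin ?D (oprod E) g"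
    by (rule lin_add[OF oprod_words]) (use D in auto)
  finally show ?thesis
    using tensor_eval_superset[OF D(1) _ D(2), of f] tensor_eval_superset[OF D(1) _ D(2), of g]
    by (simp add: tensor_add_eq)
qed

lemma tensor_eval_word:
  assumes "set u \<subseteq> {1..n}"
  shows "tensor_eval E (tensor_word u a) = sc a (oprod E u)"
proof -
  have "oprod E u \<in> carrier R" using assms by (rule oprod_closed[OF E])
  moreover have "tensor_eval E (tensor_word u a) = lin {u} (oprod E) (tensor_word u a)"
    by (rule tensor_eval_superset) (use assms in \<open>auto simp: tensor_word_def split: if_splits\<close>)
  ultimately show ?thesis
    by (simp add: lin_def tensor_word_def)
qed

lemma tensor_eval_mult:
  assumes f: "f \<in> carrier (tensor_alg n)" and g: "g \<in> carrier (tensor_alg n)"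
  shows "tensor_eval E (f \<otimes>\<^bsub>tensor_alg n\<^esub> g) = tensor_eval E f \<otimes> tensor_eval E g"
proof -
  interpret T: ring "tensor_alg n" by (rule tensor_alg_ring)
  show ?thesis
    using f
  proof (induction rule: tensor_word_induct)
    case (word u a)
    note u = word
    show ?case using g
    proof (induction rule: tensor_word_induct)
      case (word v b)
      have "oprod E u \<in> carrier R" "oprod E v \<in> carrier R" 
        using oprod_closed[OF E u] oprod_closed[OF E word] .
      moreover have "oprod E (u @ v) = oprod E u \<otimes> oprod E v"
        by (rule oprod_append[OF E]) (use u word in auto)
      ultimately show ?case using u word
        by (simp add: tensor_word_mult tensor_eval_word sc_mult_left sc_mult_right mult.commute)
    next
      case (add f g)
      note W = tensor_word_carrier[OF u, of a]
      show ?case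
        unfolding T.r_distr[OF add(1,2) W] tensor_eval_add[OF add(1,2)]
          tensor_eval_add[OF tensor_mult_closed[OF W add(1)] tensor_mult_closed[OF W add(2)]] add(3,4)
        by (rule r_distr[symmetric]) (intro tensor_eval_closed add(1,2) W)+
    qed
  next
    case (add f f')
    show ?case
      unfolding T.l_distr[OF add(1,2) g] tensor_eval_add[OF add(1,2)]
        tensor_eval_add[OF tensor_mult_closed[OF add(1) g] tensor_mult_closed[OF add(2) g]] add(3,4)
      by (rule l_distr[symmetric]) (intro tensor_eval_closed add(1,2) g)+
  qed
qed

lemma tensor_eval_scalar: "tensor_eval E (tensor_scalar a) = sc a \<one>"
  using tensor_eval_word[of "[]" a] by (simp add: tensor_word_def tensor_scalar_def)

lemma tensor_eval_hom: "tensor_eval E \<in> Ring.ring_hom (tensor_alg n) R"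
proof (rule ring_hom_memI)
  show "tensor_eval E \<one>\<^bsub>tensor_alg n\<^esub> = \<one>"
    unfolding tensor_one_eq tensor_eval_scalar by simp
qed (simp_all only: tensor_eval_closed tensor_eval_mult tensor_eval_add)

lemma tensor_eval_vec: "tensor_eval E (tensor_vec n v) = lin {1..n} E v"
proof -
  let ?D = "(\<lambda>i. [i]) ` {1..n}"
  have D: "?D \<subseteq> {w. set w \<subseteq> {1..n}}" by auto
  have one: "oprod E [i] = E i" if "i \<in> {1..n}" for i
    using funcset_mem[OF E that] by simp
  have "{w. tensor_vec n v w \<noteq> 0} \<subseteq> ?D" using tensor_vec_nz by blast
  then have "tensor_eval E (tensor_vec n v) = lin ?D (oprod E) (tensor_vec n v)"
    using D by (intro tensor_eval_superset) simp_all
  also have "\<dots> = lin {1..n} (oprod E \<circ> (\<lambda>i. [i])) (tensor_vec n v \<circ> (\<lambda>i. [i]))"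
    by (rule lin_reindex[OF _ oprod_words[OF D]]) (simp add: inj_on_def)
  also have "\<dots> = lin {1..n} E v"
  proof (rule lin_cong)
    show "oprod E \<circ> (\<lambda>i. [i]) \<in> {1..n} \<rightarrow> carrier R"
      using E one by (simp add: Pi_iff del: oprod_simps)
    show "(oprod E \<circ> (\<lambda>i. [i])) i = E i" if "i \<in> {1..n}" for i
      using one[OF that] by (simp del: oprod_simps)
    show "(tensor_vec n v \<circ> (\<lambda>i. [i])) i = v i" if "i \<in> {1..n}" for i
      using that by (simp add: tensor_vec_def)
  qed
  finally show ?thesis .
qed

end

text \<open>The kernel of the evaluation is an ideal, and it contains the generators $v \otimes v +
  Q(v,v) 1$ because of \<open>clifford_rel_lin_square\<close>.\<close>

lemma tensor_eval_clifford_ideal: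
  assumes E: "clifford_rel r s E" and f: "f \<in> clifford_ideal r s"
  shows "tensor_eval E f = \<zero>"
proof -
  let ?T = "tensor_alg (r + s)"
  note EC = clifford_relD(1)[OF E]
  interpret T: ring ?T by (rule tensor_alg_ring)
  interpret h: ring_hom_ring ?T R "tensor_eval E"
    by (rule ring_hom_ringI2[OF tensor_alg_ring ring_axioms tensor_eval_hom[OF EC]])
  have "clifford_ideal r s \<subseteq> a_kernel ?T R (tensor_eval E)"
    unfolding clifford_ideal_def
  proof (rule T.genideal_minimal[OF h.kernel_is_ideal], safe)
    fix v
    let ?v = "tensor_vec (r + s) v" and ?q = "tensor_scalar (quad_form r s v)"
    let ?h = "\<lambda>i. (v i)\<^sup>2 * (if i \<le> r then -1 else 1)"
    have "sum ?h {1..r + s} = sum ?h {1..r} + sum ?h {r + 1..r + s}"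
      by (rule sum.ub_add_nat) simp
    moreover have "sum ?h {1..r} = - (\<Sum>i = 1..r. (v i)\<^sup>2)"
      unfolding sum_negf[symmetric] by (rule sum.cong) auto
    moreover have "sum ?h {r + 1..r + s} = (\<Sum>i = r + 1..r + s. (v i)\<^sup>2)"
      by (rule sum.cong) auto
    ultimately have q: "sum ?h {1..r + s} = - quad_form r s v"
      unfolding quad_form_def by simp
    have "tensor_eval E (?v \<otimes>\<^bsub>?T\<^esub> ?v) = lin {1..r + s} E v \<otimes> lin {1..r + s} E v"
      unfolding tensor_eval_mult[OF EC tensor_vec_carrier tensor_vec_carrier] tensor_eval_vec[OF EC] ..
    also have "\<dots> = sc (- quad_form r s v) \<one>"
      unfolding clifford_rel_lin_square[OF E subset_refl] q ..
    finally have vv: "tensor_eval E (?v \<otimes>\<^bsub>?T\<^esub> ?v) = sc (- quad_form r s v) \<one>" .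
    have "tensor_eval E (?v \<otimes>\<^bsub>?T\<^esub> ?v \<oplus>\<^bsub>?T\<^esub> ?q) = sc (- quad_form r s v) \<one> \<oplus> sc (quad_form r s v) \<one>"
      unfolding tensor_eval_add[OF EC tensor_mult_closed[OF tensor_vec_carrier tensor_vec_carrier] tensor_scalar_carrier]
        vv tensor_eval_scalar[OF EC] ..
    also have "\<dots> = \<zero>"
      by (simp flip: sc_add)
    finally show "?v \<otimes>\<^bsub>?T\<^esub> ?v \<oplus>\<^bsub>?T\<^esub> ?q \<in> a_kernel ?T R (tensor_eval E)"
      unfolding a_kernel_def'
      by (intro CollectI conjI T.add.m_closed[simplified] tensor_mult_closed tensor_vec_carrier tensor_scalar_carrier)
  qed
  then show ?thesis using f unfolding a_kernel_def' by blast
qed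

end

lemma tensor_smult_carrier:
  assumes "f \<in> carrier (tensor_alg n)"
  shows "(\<lambda>w. a * f w) \<in> carrier (tensor_alg n)"
proof (rule tensor_carrierI)
  show "finite {w. a * f w \<noteq> 0}"
    by (rule finite_subset[OF _ tensor_carrierD(1)[OF assms]]) auto
  fix w assume "a * f w \<noteq> 0"
  then have "f w \<noteq> 0" by auto
  then show "set w \<subseteq> {1..n}" by (rule tensor_carrierD(2)[OF assms])
qed

text \<open>The scalar action on the quotient is defined by multiplication with the class of a
  scalar tensor; on representatives it is pointwise scaling, which gives the axioms of an
  algebra.\<close>

lemma clifford_scale_class:
  assumes "f \<in> carrier (tensor_alg (r + s))"
  shows "clifford_scale r s a (clifford_class r s f) = clifford_class r s (\<lambda>w. a * f w)"
proof -
  interpret h: ring_hom_ring "tensor_alg (r + s)" "clifford r s" "clifford_class r s"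
    by (rule ring_hom_ringI2[OF tensor_alg_ring clifford_ring clifford_class_hom])
  have "tensor_scalar a \<otimes>\<^bsub>tensor_alg (r + s)\<^esub> f = (\<lambda>w. a * f w)"
    by (simp add: fun_eq_iff tensor_scalar_mult)
  then show ?thesis
    using assms by (simp add: clifford_scale_def tensor_scalar_carrier flip: h.hom_mult)
qed

lemma clifford_real_alg: "real_alg (clifford r s) (clifford_scale r s)"
proof -
  let ?T = "tensor_alg (r + s)"
  interpret C: ring "clifford r s" by (rule clifford_ring)
  interpret h: ring_hom_ring ?T "clifford r s" "clifford_class r s"
    by (rule ring_hom_ringI2[OF tensor_alg_ring clifford_ring clifford_class_hom])
  show ?thesis
  proof (intro real_alg.intro real_alg_axioms.intro clifford_ring)
    fix x y a b
    assume "x \<in> carrier (clifford r s)"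
    then obtain f where f: "f \<in> carrier ?T" "x = clifford_class r s f" by (auto simp: clifford_carrier)
    show "clifford_scale r s a x \<in> carrier (clifford r s)"
      using f by (simp add: clifford_scale_class tensor_smult_carrier)
    show "clifford_scale r s (a + b) x
        = clifford_scale r s a x \<oplus>\<^bsub>clifford r s\<^esub> clifford_scale r s b x"
      using f by (simp add: clifford_scale_class tensor_smult_carrier tensor_add_eq ring_distribs flip: h.hom_add)
    show "clifford_scale r s a (clifford_scale r s b x) = clifford_scale r s (a * b) x"
      using f by (simp add: clifford_scale_class tensor_smult_carrier mult.assoc)
    show "clifford_scale r s 1 x = x"
      using f by (simp add: clifford_scale_class)
    assume "y \<in> carrier (clifford r s)"
    then obtain g where g: "g \<in> carrier ?T" "y = clifford_class r s g" by (auto simp: clifford_carrier)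
    show "clifford_scale r s a (x \<oplus>\<^bsub>clifford r s\<^esub> y)
        = clifford_scale r s a x \<oplus>\<^bsub>clifford r s\<^esub> clifford_scale r s a y"
      using f g tensor_add_closed[OF f(1) g(1)]
      by (simp add: clifford_scale_class tensor_smult_carrier tensor_add_eq ring_distribs flip: h.hom_add)
    have "(\<lambda>w. a * f w) \<otimes>\<^bsub>?T\<^esub> g = (\<lambda>w. a * (f \<otimes>\<^bsub>?T\<^esub> g) w)" "f \<otimes>\<^bsub>?T\<^esub> (\<lambda>w. a * g w) = (\<lambda>w. a * (f \<otimes>\<^bsub>?T\<^esub> g) w)"
      by (simp_all add: fun_eq_iff tensor_mult_eq sum_distrib_left mult.assoc mult.left_commute)
    then show "clifford_scale r s a x \<otimes>\<^bsub>clifford r s\<^esub> y = clifford_scale r s a (x \<otimes>\<^bsub>clifford r s\<^esub> y)"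
      "x \<otimes>\<^bsub>clifford r s\<^esub> clifford_scale r s a y = clifford_scale r s a (x \<otimes>\<^bsub>clifford r s\<^esub> y)"
      using f g tensor_mult_closed[OF f(1) g(1)]
      by (simp_all add: clifford_scale_class tensor_smult_carrier flip: h.hom_mult)
  qed
qed

section \<open>Monomials of the Clifford algebra\<close>

text \<open>Reversing a product of $m$ anticommuting factors costs the sign $(-1)^{m(m-1)/2}$, and
  negating every factor costs $(-1)^m$; together the exponent is $m(m+1)/2$. This is where the
  residues 1 and 2 modulo 4 come from.\<close>

lemma odd_Suc_choose_two: "odd (Suc m choose 2) \<longleftrightarrow> m mod 4 \<in> {1, 2}"
proof (induction m rule: nat_less_induct)
  case (1 m)
  show ?case
  proof (cases "m < 4")
    case True
    then have "m = 0 \<or> m = 1 \<or> m = 2 \<or> m = 3" by linarith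
    then show ?thesis by (auto simp: choose_two)
  next
    case False
    then obtain k where m: "m = k + 4" by (metis add.commute le_Suc_ex not_less)
    have "Suc m choose 2 = (Suc k choose 2) + (4 * k + 10)"
      by (simp add: m numeral_eq_Suc)
    then show ?thesis using 1[rule_format, of k] by (simp add: m)
  qed
qed

context real_alg
begin

lemma minus_eq_zero_iff: "x \<in> carrier R \<Longrightarrow> y \<in> carrier R \<Longrightarrow> x \<ominus> y = \<zero> \<longleftrightarrow> x = y"
  unfolding a_minus_def using minus_equality[of x "\<ominus> y"] by (auto simp: r_neg)

lemma indep_reindex:
  assumes "indep (u ` A) b" and "inj_on u A"
  shows "indep A (b \<circ> u)"
  unfolding indep_def
proof (intro conjI allI impI ballI)
  have b: "b \<in> u ` A \<rightarrow> carrier R" using assms(1) by (simp add: indep_def)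
  show "finite A" using assms by (auto simp: indep_def dest: finite_imageD)
  show "b \<circ> u \<in> A \<rightarrow> carrier R" using b by auto
  fix c x assume c: "lin A (b \<circ> u) c = \<zero>" and x: "x \<in> A"
  have "lin (u ` A) b (c \<circ> the_inv_into A u) = lin A (b \<circ> u) (c \<circ> the_inv_into A u \<circ> u)"
    by (rule lin_reindex[OF assms(2) b])
  also have "\<dots> = lin A (b \<circ> u) c"
    using b by (intro lin_cong) (auto simp: the_inv_into_f_f[OF assms(2)])
  finally have "lin (u ` A) b (c \<circ> the_inv_into A u) = \<zero>"
    using c by simp
  from assms(1)[unfolded indep_def, THEN conjunct2, THEN conjunct2, rule_format, OF this imageI[OF x]]
  have "(c \<circ> the_inv_into A u) (u x) = 0" .
  then show "c x = 0"
    by (simp add: the_inv_into_f_f[OF assms(2) x])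
qed

text \<open>Each $E_i$ is invertible, its square being $\pm 1$; hence no product of them
  vanishes.\<close>

lemma oprod_nonzero:
  assumes E: "clifford_rel r s E" and "set xs \<subseteq> {1..r + s}" and one: "\<one> \<noteq> \<zero>"
  shows "oprod E xs \<noteq> \<zero>"
  using assms(2)
proof (induction xs)
  case Nil
  then show ?case using one by simp
next
  case (Cons i xs)
  have i: "i \<in> {1..r + s}" and xs: "set xs \<subseteq> {1..r + s}" using Cons.prems by auto
  have M: "oprod E xs \<in> carrier R" by (rule oprod_closed[OF clifford_relD(1)[OF E] xs])
  have Ei: "E i \<in> carrier R" by (rule funcset_mem[OF clifford_relD(1)[OF E] i])
  show ?case
  proof
    assume "oprod E (i # xs) = \<zero>"
    then have "(E i \<otimes> E i) \<otimes> oprod E xs = \<zero>"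
      using M Ei by (simp add: m_assoc)
    then have "sc (if i \<le> r then -1 else 1) (oprod E xs) = \<zero>"
      unfolding clifford_relD(2)[OF E i] using M by (simp add: sc_mult_left)
    then show False
      using M Cons.IH[OF xs] by (simp add: sc_eq_zero_iff split: if_splits)
  qed
qed

lemma oprod_anticommute:
  assumes E: "clifford_rel r s E" and "set xs \<subseteq> {1..r + s}" and i: "i \<in> {1..r + s}" and "i \<notin> set xs"
  shows "oprod E xs \<otimes> E i = sc ((-1) ^ length xs) (E i \<otimes> oprod E xs)"
  using assms(2,4)
proof (induction xs)
  case Nil
  then show ?case using funcset_mem[OF clifford_relD(1)[OF E] i] by simp
next
  case (Cons j xs)
  have j: "j \<in> {1..r + s}" and xs: "set xs \<subseteq> {1..r + s}" and ij: "j \<noteq> i" and i': "i \<notin> set xs"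
    using Cons.prems by auto
  have M: "oprod E xs \<in> carrier R" by (rule oprod_closed[OF clifford_relD(1)[OF E] xs])
  have Ei: "E i \<in> carrier R" and Ej: "E j \<in> carrier R"
    using funcset_mem[OF clifford_relD(1)[OF E]] i j by blast+
  have ji: "E j \<otimes> E i = sc (-1) (E i \<otimes> E j)"
    unfolding clifford_relD(3)[OF E j i ij] using Ei Ej by (simp add: sc_minus_left)
  have "oprod E (j # xs) \<otimes> E i = E j \<otimes> (oprod E xs \<otimes> E i)"
    using M Ei Ej by (simp add: m_assoc)
  also have "\<dots> = sc ((-1) ^ length xs) (E j \<otimes> E i \<otimes> oprod E xs)"
    using M Ei Ej by (simp add: Cons.IH[OF xs i'] sc_mult_right m_assoc)
  also have "\<dots> = sc ((-1) ^ length (j # xs)) (E i \<otimes> oprod E (j # xs))"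
    unfolding ji using M Ei Ej by (simp add: sc_mult_left m_assoc)
  finally show ?case .
qed

text \<open>The universal property: by \<open>tensor_eval_clifford_ideal\<close> the evaluation does
  not depend on the representative of a class, so it descends to the quotient.\<close>

lemma clifford_universal:
  assumes E: "clifford_rel r s E"
  obtains \<phi> where "\<phi> \<in> Ring.ring_hom (clifford r s) R"
    and "\<And>a x. x \<in> carrier (clifford r s) \<Longrightarrow> \<phi> (clifford_scale r s a x) = sc a (\<phi> x)"
    and "\<And>i. i \<in> {1..r + s} \<Longrightarrow> \<phi> (clifford_gen r s i) = E i"
proof -
  let ?T = "tensor_alg (r + s)" and ?C = "clifford r s" and ?cl = "clifford_class r s"
  note EC = clifford_relD(1)[OF E]
  interpret T: ring ?T by (rule tensor_alg_ring)
  interpret h: ring_hom_ring ?T R "tensor_eval E"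
    by (rule ring_hom_ringI2[OF tensor_alg_ring ring_axioms tensor_eval_hom[OF EC]])
  note cl_hom = clifford_class_hom[of r s]
  \<comment> \<open>Any representative will do; the next fact says so.\<close>
  define \<phi> where "\<phi> x = tensor_eval E (SOME f. f \<in> carrier ?T \<and> ?cl f = x)" for x
  have \<phi>: "\<phi> (?cl f) = tensor_eval E f" if f: "f \<in> carrier ?T" for f
  proof -
    define g where "g = (SOME g. g \<in> carrier ?T \<and> ?cl g = ?cl f)"
    have "g \<in> carrier ?T \<and> ?cl g = ?cl f"
      unfolding g_def by (rule someI[of "\<lambda>g. g \<in> carrier ?T \<and> ?cl g = ?cl f" f]) (simp add: f)
    then have g: "g \<in> carrier ?T" and "g \<ominus>\<^bsub>?T\<^esub> f \<in> clifford_ideal r s"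
      using f clifford_class_eq_iff by auto
    then have "tensor_eval E (g \<ominus>\<^bsub>?T\<^esub> f) = \<zero>"
      by (intro tensor_eval_clifford_ideal[OF E])
    then have "tensor_eval E g \<ominus> tensor_eval E f = \<zero>"
      using f g by (simp add: a_minus_def)
    then have "tensor_eval E g = tensor_eval E f"
      using f g by (simp add: minus_eq_zero_iff)
    then show ?thesis unfolding \<phi>_def g_def .
  qed
  have "\<phi> \<in> Ring.ring_hom ?C R"
  proof (rule ring_hom_memI)
    fix x y assume "x \<in> carrier ?C" "y \<in> carrier ?C"
    then obtain f g where fg: "f \<in> carrier ?T" "x = ?cl f" "g \<in> carrier ?T" "y = ?cl g"
      by (auto simp: clifford_carrier)
    show "\<phi> x \<in> carrier R" using fg by (simp add: \<phi>)
    show "\<phi> (x \<otimes>\<^bsub>?C\<^esub> y) = \<phi> x \<otimes> \<phi> y" "\<phi> (x \<oplus>\<^bsub>?C\<^esub> y) = \<phi> x \<oplus> \<phi> y"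
      using fg by (simp_all add: \<phi> flip: ring_hom_mult[OF cl_hom] ring_hom_add[OF cl_hom])
  next
    show "\<phi> \<one>\<^bsub>?C\<^esub> = \<one>"
      by (simp add: \<phi> flip: ring_hom_one[OF cl_hom])
  qed
  moreover have "\<phi> (clifford_scale r s a x) = sc a (\<phi> x)" if x: "x \<in> carrier ?C" for a x
  proof -
    obtain f where f: "f \<in> carrier ?T" "x = ?cl f" using x by (auto simp: clifford_carrier)
    have s: "tensor_scalar a \<otimes>\<^bsub>?T\<^esub> f \<in> carrier ?T"
      using f tensor_scalar_carrier by simp
    have "clifford_scale r s a x = ?cl (tensor_scalar a \<otimes>\<^bsub>?T\<^esub> f)"
      using f by (simp add: clifford_scale_def ring_hom_mult[OF cl_hom] tensor_scalar_carrier)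
    then have "\<phi> (clifford_scale r s a x) = tensor_eval E (tensor_scalar a \<otimes>\<^bsub>?T\<^esub> f)"
      using s by (simp add: \<phi>)
    also have "\<dots> = sc a \<one> \<otimes> tensor_eval E f"
      by (simp only: tensor_eval_mult[OF EC tensor_scalar_carrier f(1)] tensor_eval_scalar[OF EC])
    finally show ?thesis using f by (simp add: \<phi> sc_mult_left)
  qed
  moreover have "\<phi> (clifford_gen r s i) = E i" if i: "i \<in> {1..r + s}" for i
  proof -
    have Ei: "E j \<in> carrier R" if "j \<in> {1..r + s}" for j by (rule funcset_mem[OF EC that])
    have "\<phi> (clifford_gen r s i) = lin {1..r + s} E (\<lambda>j. if j = i then 1 else 0)"
      unfolding clifford_gen_def clifford_vec_def \<phi>[OF tensor_vec_carrier] tensor_eval_vec[OF EC] ..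
    also have "\<dots> = lin {i} E (\<lambda>j. if j = i then 1 else 0)"
      using i EC by (intro lin_mono_neutral) auto
    also have "\<dots> = E i" using Ei[OF i] by (simp add: lin_def)
    finally show ?thesis .
  qed
  ultimately show thesis using that by blast
qed

end

lemma clifford_vec_closed: "clifford_vec r s v \<in> carrier (clifford r s)"
  unfolding clifford_vec_def clifford_carrier using tensor_vec_carrier by blast

lemma clifford_vec_add:
  "clifford_vec r s (\<lambda>j. v j + w j) = clifford_vec r s v \<oplus>\<^bsub>clifford r s\<^esub> clifford_vec r s w"
proof -
  have "tensor_vec (r + s) (\<lambda>j. v j + w j)
      = tensor_vec (r + s) v \<oplus>\<^bsub>tensor_alg (r + s)\<^esub> tensor_vec (r + s) w"
    unfolding tensor_vec_def tensor_add_eq sum.distrib[symmetric] by (intro ext sum.cong) simp_all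
  then show ?thesis
    by (simp add: clifford_vec_def ring_hom_add[OF clifford_class_hom] tensor_vec_carrier)
qed

lemma quad_form_sq: "quad_form r s v = (\<Sum>i = 1..r + s. (v i)\<^sup>2 * (if i \<le> r then 1 else -1))"
proof -
  let ?h = "\<lambda>i. (v i)\<^sup>2 * (if i \<le> r then 1 else -1)"
  have "sum ?h {1..r + s} = sum ?h {1..r} + sum ?h {r + 1..r + s}"
    by (rule sum.ub_add_nat) simp
  moreover have "sum ?h {1..r} = (\<Sum>i = 1..r. (v i)\<^sup>2)"
    by (rule sum.cong) auto
  moreover have "sum ?h {r + 1..r + s} = - (\<Sum>i = r + 1..r + s. (v i)\<^sup>2)"
    unfolding sum_negf[symmetric] by (rule sum.cong) auto
  ultimately show ?thesis unfolding quad_form_def by simp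
qed

text \<open>Anticommutation is the polarised form of $v \cdot v = -Q(v,v)$, applied to $v = e_i +
  e_j$.\<close>

lemma clifford_gen_rel:
  "real_alg.clifford_rel (clifford r s) (clifford_scale r s) r s (clifford_gen r s)"
proof -
  interpret C: real_alg "clifford r s" "clifford_scale r s" by (rule clifford_real_alg)
  let ?\<delta> = "\<lambda>i j. if j = i then 1 else (0::real)"
  let ?q = "\<lambda>i. if i \<le> r then 1 else (-1::real)"
  have carr: "clifford_gen r s i \<in> carrier (clifford r s)" for i
    unfolding clifford_gen_def by (rule clifford_vec_closed)
  have q: "quad_form r s (?\<delta> i) = ?q i" if "i \<in> {1..r + s}" for i
  proof -
    have "quad_form r s (?\<delta> i) = (\<Sum>j = 1..r + s. if j = i then ?q i else 0)"
      unfolding quad_form_sq by (rule sum.cong) auto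
    then show ?thesis using that by simp
  qed
  have sq: "clifford_gen r s i \<otimes>\<^bsub>clifford r s\<^esub> clifford_gen r s i
      = clifford_scale r s (- ?q i) \<one>\<^bsub>clifford r s\<^esub>" if "i \<in> {1..r + s}" for i
    unfolding clifford_gen_def clifford_vec_square q[OF that] ..
  have anti: "clifford_gen r s i \<otimes>\<^bsub>clifford r s\<^esub> clifford_gen r s j
      = \<ominus>\<^bsub>clifford r s\<^esub> (clifford_gen r s j \<otimes>\<^bsub>clifford r s\<^esub> clifford_gen r s i)"
    if i: "i \<in> {1..r + s}" and j: "j \<in> {1..r + s}" and ij: "i \<noteq> j" for i j
  proof -
    let ?a = "clifford_gen r s i" and ?b = "clifford_gen r s j"
    have "quad_form r s (\<lambda>k. ?\<delta> i k + ?\<delta> j k)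
        = (\<Sum>k = 1..r + s. (if k = i then ?q i else 0) + (if k = j then ?q j else 0))"
      unfolding quad_form_sq by (rule sum.cong) (use ij in auto)
    also have "\<dots> = ?q i + ?q j" using i j by (simp add: sum.distrib)
    finally have "(?a \<oplus>\<^bsub>clifford r s\<^esub> ?b) \<otimes>\<^bsub>clifford r s\<^esub> (?a \<oplus>\<^bsub>clifford r s\<^esub> ?b)
        = clifford_scale r s (- (?q i + ?q j)) \<one>\<^bsub>clifford r s\<^esub>"
      unfolding clifford_gen_def clifford_vec_add[symmetric] clifford_vec_square by (simp only:)
    also have "\<dots> = clifford_scale r s (- ?q i + - ?q j) \<one>\<^bsub>clifford r s\<^esub>" by (simp only: minus_add_distrib)
    also have "\<dots> = ?a \<otimes>\<^bsub>clifford r s\<^esub> ?a \<oplus>\<^bsub>clifford r s\<^esub> ?b \<otimes>\<^bsub>clifford r s\<^esub> ?b"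
      unfolding sq[OF i] sq[OF j] by (rule C.sc_add) simp
    also have "(?a \<oplus>\<^bsub>clifford r s\<^esub> ?b) \<otimes>\<^bsub>clifford r s\<^esub> (?a \<oplus>\<^bsub>clifford r s\<^esub> ?b)
        = (?a \<otimes>\<^bsub>clifford r s\<^esub> ?b \<oplus>\<^bsub>clifford r s\<^esub> ?b \<otimes>\<^bsub>clifford r s\<^esub> ?a) \<oplus>\<^bsub>clifford r s\<^esub>
          (?a \<otimes>\<^bsub>clifford r s\<^esub> ?a \<oplus>\<^bsub>clifford r s\<^esub> ?b \<otimes>\<^bsub>clifford r s\<^esub> ?b)"
      using carr by (simp add: C.l_distr C.r_distr C.a_ac)
    finally have "?a \<otimes>\<^bsub>clifford r s\<^esub> ?b \<oplus>\<^bsub>clifford r s\<^esub> ?b \<otimes>\<^bsub>clifford r s\<^esub> ?a = \<zero>\<^bsub>clifford r s\<^esub>"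
      using carr by (intro C.add.r_cancel_one[THEN iffD1]) auto
    then show ?thesis using carr by (intro C.minus_equality[symmetric]) auto
  qed
  show ?thesis
    unfolding C.clifford_rel_def
  proof (intro conjI ballI impI)
    show "clifford_gen r s i \<otimes>\<^bsub>clifford r s\<^esub> clifford_gen r s i
        = clifford_scale r s (if i \<le> r then - 1 else 1) \<one>\<^bsub>clifford r s\<^esub>" if "i \<in> {1..r + s}" for i
      unfolding sq[OF that] by simp
    show "clifford_gen r s \<in> {1..r + s} \<rightarrow> carrier (clifford r s)"
      using carr by blast
  qed (rule anti)
qed

lemma clifford_conj_oprod:
  assumes "distinct xs" and "set xs \<subseteq> {1..r + s}"
  shows "clifford_conj r s (real_alg.oprod (clifford r s) (clifford_gen r s) xs)
    = clifford_scale r s ((-1) ^ (Suc (length xs) choose 2)) (real_alg.oprod (clifford r s) (clifford_gen r s) xs)"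
  using assms
proof (induction xs)
  interpret C: real_alg "clifford r s" "clifford_scale r s" by (rule clifford_real_alg)
  note c = clifford_conj_props[of r s, THEN conjunct2, THEN conjunct1, unfolded clifford_antiaut_def]
  let ?e = "clifford_gen r s"
  {
    case Nil
    then show ?case using c by (simp add: numeral_2_eq_2)
  next
    case (Cons i xs)
    have i: "i \<in> {1..r + s}" and xs: "set xs \<subseteq> {1..r + s}" and ixs: "i \<notin> set xs"
      using Cons.prems by auto
    have M: "C.oprod ?e xs \<in> carrier (clifford r s)"
      by (rule C.oprod_closed[OF C.clifford_relD(1)[OF clifford_gen_rel] xs])
    have e: "?e i \<in> carrier (clifford r s)"
      unfolding clifford_gen_def by (rule clifford_vec_closed)
    have ce: "clifford_conj r s (?e i) = clifford_scale r s (-1) (?e i)"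
      using clifford_conj_props[of r s, THEN conjunct2, THEN conjunct2, rule_format] e by (simp add: clifford_gen_def C.sc_minus_left)
    have "clifford_conj r s (C.oprod ?e (i # xs))
        = clifford_conj r s (C.oprod ?e xs) \<otimes>\<^bsub>clifford r s\<^esub> clifford_conj r s (?e i)"
      using c e M by simp
    also have "\<dots> = clifford_scale r s (- ((-1) ^ (Suc (length xs) choose 2)))
        (C.oprod ?e xs \<otimes>\<^bsub>clifford r s\<^esub> ?e i)"
      using Cons e M xs by (simp add: ce C.sc_mult_left C.sc_mult_right)
    also have "\<dots> = clifford_scale r s ((-1) ^ (Suc (length (i # xs)) choose 2)) (C.oprod ?e (i # xs))"
      unfolding C.oprod_anticommute[OF clifford_gen_rel xs i ixs] using e M
      by (simp add: numeral_2_eq_2 power_add mult.commute)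
    finally show ?case .
  }
qed

lemma clifford_mono_oprod:
  "clifford_mono r s I = real_alg.oprod (clifford r s) (clifford_gen r s) (sorted_list_of_set I)"
  unfolding clifford_mono_def real_alg.oprod_def[OF clifford_real_alg] ..

context real_alg
begin

text \<open>The anti-automorphism acts on $e_I$ by a sign. The sign decides membership in the
  Clifford Lie algebra only because $e_I \neq 0$, which follows from the existence of one Clifford
  system in a nonzero algebra.\<close>

lemma H_index_eq:
  assumes E: "clifford_rel r s E" and one: "\<one> \<noteq> \<zero>"
  shows "H_index r s = {I. I \<subseteq> {1..r + s} \<and> card I mod 4 \<in> {1, 2} \<and>
    \<not> ((r + s) mod 4 = 1 \<and> I = {1..r + s})}"
proof -
  interpret C: real_alg "clifford r s" "clifford_scale r s" by (rule clifford_real_alg)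
  obtain \<phi> where \<phi>: "\<phi> \<in> Ring.ring_hom (clifford r s) R" using clifford_universal[OF E] .
  have C_one: "\<one>\<^bsub>clifford r s\<^esub> \<noteq> \<zero>\<^bsub>clifford r s\<^esub>"
  proof
    assume "\<one>\<^bsub>clifford r s\<^esub> = \<zero>\<^bsub>clifford r s\<^esub>"
    then have "\<phi> \<zero>\<^bsub>clifford r s\<^esub> = \<one>" using ring_hom_one[OF \<phi>] by simp
    moreover have "\<phi> \<zero>\<^bsub>clifford r s\<^esub> = \<zero>"
      by (rule ring_hom_zero[OF \<phi> C.ring_axioms ring_axioms])
    ultimately show False using one by simp
  qed
  have lie: "clifford_mono r s I \<in> clifford_lie_set r s \<longleftrightarrow> card I mod 4 \<in> {1, 2}"
    if I: "I \<subseteq> {1..r + s}" for I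
  proof -
    have fin: "finite I" using I finite_subset by blast
    let ?xs = "sorted_list_of_set I" and ?n = "Suc (card I) choose 2"
    let ?M = "C.oprod (clifford_gen r s) ?xs"
    have xs: "set ?xs \<subseteq> {1..r + s}" using I fin by simp
    have M: "?M \<in> carrier (clifford r s)" "?M \<noteq> \<zero>\<^bsub>clifford r s\<^esub>"
      using C.oprod_closed[OF C.clifford_relD(1)[OF clifford_gen_rel] xs]
        C.oprod_nonzero[OF clifford_gen_rel xs C_one] by blast+
    have "clifford_mono r s I \<in> clifford_lie_set r s \<longleftrightarrow>
        clifford_scale r s ((-1) ^ ?n) ?M = clifford_scale r s (-1) ?M"
      using clifford_conj_oprod[of ?xs r s] fin xs M
      by (simp add: clifford_lie_set_def clifford_mono_oprod C.sc_minus_left)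
    also have "\<dots> \<longleftrightarrow> clifford_scale r s ((-1) ^ ?n + 1) ?M = \<zero>\<^bsub>clifford r s\<^esub>"
    proof -
      have "clifford_scale r s ((-1) ^ ?n + 1) ?M
          = clifford_scale r s ((-1) ^ ?n) ?M \<ominus>\<^bsub>clifford r s\<^esub> clifford_scale r s (-1) ?M"
        using M by (simp add: a_minus_def C.sc_add C.sc_minus_left)
      then show ?thesis using M by (simp add: C.minus_eq_zero_iff)
    qed
    also have "\<dots> \<longleftrightarrow> (-1) ^ ?n + 1 = (0::real)"
      using M by (simp add: C.sc_eq_zero_iff)
    also have "\<dots> \<longleftrightarrow> odd ?n"
      by (cases "even ?n") auto
    finally show ?thesis unfolding odd_Suc_choose_two .
  qed
  show ?thesis
    unfolding H_index_def using lie by auto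
qed

text \<open>The map is the homomorphism given by the universal property. It is not injective on the
  whole Clifford algebra in general; on the span of the relevant $e_I$ it is, because it sends them,
  up to sign, bijectively to the linearly independent family $b$.\<close>

lemma clifford_lie_iso:
  fixes L :: "'a real_lie_alg" and u :: "nat set \<Rightarrow> 'v"
  assumes E: "clifford_rel r s E" and one: "\<one> \<noteq> \<zero>"
    and S: "indep S b" and u: "bij_betw u (H_index r s) S"
    and Eb: "\<And>I. I \<in> H_index r s \<Longrightarrow> \<exists>a. a * a = 1 \<and> oprod E (sorted_list_of_set I) = sc a (b (u I))"
    and L: "carrier L = range (lin S b)"
      "\<And>x y. x \<in> carrier R \<Longrightarrow> y \<in> carrier R \<Longrightarrow> lie_add L x y = x \<oplus> y"
      "\<And>a x. x \<in> carrier R \<Longrightarrow> lie_scale L a x = sc a x"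
      "\<And>x y. x \<in> carrier R \<Longrightarrow> y \<in> carrier R \<Longrightarrow> lie_bracket L x y = x \<otimes> y \<ominus> y \<otimes> x"
  shows "H_lie r s \<cong>\<^sub>L L"
proof -
  interpret C: real_alg "clifford r s" "clifford_scale r s" by (rule clifford_real_alg)
  obtain \<phi> where \<phi>: "\<phi> \<in> Ring.ring_hom (clifford r s) R"
    and \<phi>_sc: "\<And>a x. x \<in> carrier (clifford r s) \<Longrightarrow> \<phi> (clifford_scale r s a x) = sc a (\<phi> x)"
    and \<phi>_gen: "\<And>i. i \<in> {1..r + s} \<Longrightarrow> \<phi> (clifford_gen r s i) = E i"
    using clifford_universal[OF E] by blast
  interpret h: ring_hom_ring "clifford r s" R \<phi>
    by (rule ring_hom_ringI2[OF C.ring_axioms ring_axioms \<phi>])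
  let ?H = "H_index r s" and ?m = "clifford_mono r s"
  have fin: "finite ?H" using bij_betw_finite[OF u] S by (simp add: indep_def)
  have sub: "I \<subseteq> {1..r + s}" if "I \<in> ?H" for I using that by (simp add: H_index_def)
  have gen: "clifford_gen r s \<in> {1..r + s} \<rightarrow> carrier (clifford r s)"
    by (rule C.clifford_relD(1)[OF clifford_gen_rel])
  have \<phi>_oprod: "\<phi> (C.oprod (clifford_gen r s) xs) = oprod E xs" if "set xs \<subseteq> {1..r + s}" for xs
    using that
  proof (induction xs)
    case Nil
    then show ?case by simp
  next
    case (Cons i xs)
    then have "i \<in> {1..r + s}" "set xs \<subseteq> {1..r + s}" by auto
    then show ?case
      using C.oprod_closed[OF gen, of xs] funcset_mem[OF gen, of i] Cons.IH \<phi>_gen[of i] by simp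
  qed
  have mC: "?m I \<in> carrier (clifford r s)" if "I \<in> ?H" for I
    unfolding clifford_mono_oprod
    by (rule C.oprod_closed[OF gen]) (use sub[OF that] finite_subset[OF sub[OF that]] in simp)
  obtain \<sigma> where \<sigma>: "\<And>I. I \<in> ?H \<Longrightarrow> \<sigma> I * \<sigma> I = 1 \<and> oprod E (sorted_list_of_set I) = sc (\<sigma> I) (b (u I))"
    using Eb by metis
  have bS: "b \<in> S \<rightarrow> carrier R" using S by (simp add: indep_def)
  have bu: "b \<circ> u \<in> ?H \<rightarrow> carrier R" using bS u by (auto simp: bij_betw_def)
  have \<phi>m: "\<phi> (?m I) = sc (\<sigma> I) (b (u I))" if "I \<in> ?H" for I
    unfolding clifford_mono_oprod
    by (subst \<phi>_oprod) (use sub[OF that] finite_subset[OF sub[OF that]] \<sigma>[OF that] in simp_all)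
  have hom_finsum: "\<phi> (finsum (clifford r s) f A) = finsum R (\<phi> \<circ> f) A"
    if "finite A" "f \<in> A \<rightarrow> carrier (clifford r s)" for f :: "nat set \<Rightarrow> _" and A
    using that
  proof (induction A)
    case (insert x A)
    then have "f x \<in> carrier (clifford r s)" "f \<in> A \<rightarrow> carrier (clifford r s)" by auto
    with insert show ?case
      by (simp add: C.finsum_insert finsum_insert Pi_iff)
  qed simp
  have \<phi>_lin: "\<phi> (C.lin ?H ?m a) = lin ?H (b \<circ> u) (\<lambda>I. \<sigma> I * a I)" for a
  proof -
    have "\<phi> (C.lin ?H ?m a) = finsum R (\<phi> \<circ> (\<lambda>I. clifford_scale r s (a I) (?m I))) ?H"
      unfolding C.lin_def by (rule hom_finsum[OF fin]) (use mC in auto)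
    also have "\<dots> = lin ?H (b \<circ> u) (\<lambda>I. \<sigma> I * a I)"
      unfolding lin_def
    proof (rule finsum_cong')
      show "(\<lambda>I. sc (\<sigma> I * a I) ((b \<circ> u) I)) \<in> ?H \<rightarrow> carrier R" using bu by (auto intro!: sc_closed)
      show "(\<phi> \<circ> (\<lambda>I. clifford_scale r s (a I) (?m I))) I = sc (\<sigma> I * a I) ((b \<circ> u) I)"
        if "I \<in> ?H" for I
        using that funcset_mem[OF bu that] by (simp add: \<phi>_sc[OF mC] \<phi>m mult.commute)
    qed simp
    finally show ?thesis .
  qed
  have lin_S: "lin S b c = lin ?H (b \<circ> u) (c \<circ> u)" for c
    using lin_reindex[of u ?H b c] u bS by (simp add: bij_betw_def)
  have ind: "indep ?H (b \<circ> u)"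
    using indep_reindex[of u ?H b] u S by (simp add: bij_betw_def)
  have carrH: "carrier (H_lie r s) = range (C.lin ?H ?m)"
    by (auto simp: H_lie_def C.lin_def)
  have CH: "x \<in> carrier (clifford r s)" if "x \<in> carrier (H_lie r s)" for x
  proof -
    have "?m \<in> ?H \<rightarrow> carrier (clifford r s)" using mC by blast
    from C.lin_closed[OF this] that show ?thesis unfolding carrH by blast
  qed
  have "inj_on \<phi> (carrier (H_lie r s))"
  proof (rule inj_onI)
    fix x y assume "x \<in> carrier (H_lie r s)" "y \<in> carrier (H_lie r s)" and eq: "\<phi> x = \<phi> y"
    then obtain a a' where x: "x = C.lin ?H ?m a" and y: "y = C.lin ?H ?m a'"
      unfolding carrH by blast
    have "a I = a' I" if I: "I \<in> ?H" for I
    proof -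
      have "\<sigma> I * a I = \<sigma> I * a' I"
        using lin_eqD[OF ind _ I, of "\<lambda>I. \<sigma> I * a I" "\<lambda>I. \<sigma> I * a' I"] eq
        unfolding x y \<phi>_lin by blast
      then show ?thesis using \<sigma>[OF I] by auto
    qed
    then show "x = y" unfolding x y by (intro C.lin_cong) (use mC in auto)
  qed
  moreover have "\<phi> ` carrier (H_lie r s) = carrier L"
  proof
    show "\<phi> ` carrier (H_lie r s) \<subseteq> carrier L"
    proof safe
      fix x assume "x \<in> carrier (H_lie r s)"
      then obtain a where x: "x = C.lin ?H ?m a" unfolding carrH by blast
      define c where "c = (\<lambda>I. \<sigma> I * a I) \<circ> the_inv_into ?H u"
      have "lin S b c = lin ?H (b \<circ> u) (\<lambda>I. \<sigma> I * a I)"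
        unfolding lin_S
        by (rule lin_cong[OF bu]) (use u in \<open>auto simp: c_def bij_betw_def the_inv_into_f_f\<close>)
      then show "\<phi> x \<in> carrier L" unfolding x \<phi>_lin L(1) by (metis rangeI)
    qed
    show "carrier L \<subseteq> \<phi> ` carrier (H_lie r s)"
    proof
      fix y assume "y \<in> carrier L"
      then obtain c where y: "y = lin S b c" unfolding L(1) by blast
      have "\<phi> (C.lin ?H ?m (\<lambda>I. \<sigma> I * c (u I))) = y"
        unfolding \<phi>_lin y lin_S
      proof (rule lin_cong[OF bu])
        show "\<sigma> I * (\<sigma> I * c (u I)) = (c \<circ> u) I" if "I \<in> ?H" for I
          using \<sigma>[OF that] by (simp flip: mult.assoc)
      qed simp
      then show "y \<in> \<phi> ` carrier (H_lie r s)" unfolding carrH by blast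
    qed
  qed
  ultimately have "bij_betw \<phi> (carrier (H_lie r s)) (carrier L)"
    by (simp add: bij_betw_def)
  then show ?thesis
    unfolding lie_isomorphic_def
  proof (intro exI[of _ \<phi>] conjI ballI allI)
    fix x y a assume x: "x \<in> carrier (H_lie r s)"
    show "\<phi> (lie_scale (H_lie r s) a x) = lie_scale L a (\<phi> x)"
      using CH[OF x] by (simp add: H_lie_def L(3) \<phi>_sc)
    assume y: "y \<in> carrier (H_lie r s)"
    show "\<phi> (lie_add (H_lie r s) x y) = lie_add L (\<phi> x) (\<phi> y)"
      using CH[OF x] CH[OF y] by (simp add: H_lie_def L(2))
    show "\<phi> (lie_bracket (H_lie r s) x y) = lie_bracket L (\<phi> x) (\<phi> y)"
      using CH[OF x] CH[OF y] by (simp add: H_lie_def L(4) a_minus_def)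
  qed
qed

end

section \<open>Pauli words\<close>

declare add_bit_eq_xor [simp del] mult_bit_eq_and [simp del]

lemma bit_add_self [simp]: "(x::bit) + x = 0"
  using bit_2_eq_0 by (simp flip: mult_2)

lemma bit_one_add [simp]: "(1::bit) + (1 + x) = x" "x + 1 = 1 \<longleftrightarrow> x = (0::bit)" "x + 1 = 0 \<longleftrightarrow> x = (1::bit)"
  "1 + x = 1 \<longleftrightarrow> x = (0::bit)" "1 + x = 0 \<longleftrightarrow> x = (1::bit)"
  by (cases x; simp add: add_bit_eq_xor)+

lemma bit_add_self_left [simp]: "(x::bit) + (x + y) = y"
  by (simp flip: add.assoc)

lemma of_nat_bit: "(of_nat n :: bit) = (if odd n then 1 else 0)"
  by (induction n) simp_all

lemma if_bit_eq_one [simp]: "(if x = 1 then 1 else 0) = (x::bit)"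
  by (cases x) simp_all

text \<open>A word $v$ labels a tensor product of $2 \times 2$ matrices: the $j$th factor is $1$,
  $X$, $Z$ or $ZX$ according to the two bits at position $j$. Words add like vectors over the field
  with two elements. Infinite sequences are used so that one type serves all lengths; the words of
  length $m$ are those supported in the first $m$ positions.\<close>

datatype pauli = Pauli (xpart: "nat \<Rightarrow> bit") (zpart: "nat \<Rightarrow> bit")

instantiation pauli :: comm_monoid_add
begin

definition "0 = Pauli (\<lambda>_. 0) (\<lambda>_. 0)"
definition "u + v = Pauli (\<lambda>j. xpart u j + xpart v j) (\<lambda>j. zpart u j + zpart v j)"

instance
  by standard (simp_all add: zero_pauli_def plus_pauli_def ac_simps)

end

lemma pauli_eq_iff: "u = v \<longleftrightarrow> (\<forall>j. xpart u j = xpart v j \<and> zpart u j = zpart v j)"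
  by (cases u; cases v) (auto simp: fun_eq_iff)

lemma part_add [simp]: "xpart (u + v) j = xpart u j + xpart v j" "zpart (u + v) j = zpart u j + zpart v j"
  and part_zero [simp]: "xpart 0 j = 0" "zpart 0 j = 0"
  by (simp_all add: plus_pauli_def zero_pauli_def)

lemma pauli_add_self [simp]: "(u::pauli) + u = 0"
  by (simp add: pauli_eq_iff)

lemma pauli_add_self_left [simp]: "(u::pauli) + (u + v) = v"
  by (simp add: pauli_eq_iff)

text \<open>Signs of Pauli matrices as bits. For the matrices $P_v$ of the words, $P_u P_v$ is
  $P_{u+v}$ with sign exponent \<open>gam m u v\<close>; commuting $P_u$ past $P_v$ costs \<open>bet
  m u v\<close>, the symplectic form; and $i^{\varepsilon} P_v$ with $\varepsilon$ equal to
  \<open>bet m v A\<close> has a square with sign exponent \<open>qf m A v\<close>.\<close>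

definition gam :: "nat \<Rightarrow> pauli \<Rightarrow> pauli \<Rightarrow> bit"
  where "gam m u v = (\<Sum>j<m. xpart u j * zpart v j)"

definition bet :: "nat \<Rightarrow> pauli \<Rightarrow> pauli \<Rightarrow> bit"
  where "bet m u v = gam m u v + gam m v u"

definition qf :: "nat \<Rightarrow> pauli \<Rightarrow> pauli \<Rightarrow> bit"
  where "qf m A v = gam m v v + bet m v A"

lemma gam_add_left: "gam m (u + v) w = gam m u w + gam m v w"
  and gam_add_right: "gam m w (u + v) = gam m w u + gam m w v"
  by (simp_all add: gam_def sum.distrib ring_distribs)

lemma gam_zero [simp]: "gam m 0 v = 0" "gam m v 0 = 0"
  by (simp_all add: gam_def)

lemma bet_add_left: "bet m (u + v) w = bet m u w + bet m v w"
  and bet_add_right: "bet m w (u + v) = bet m w u + bet m w v"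
  by (simp_all add: bet_def gam_add_left gam_add_right ac_simps)

lemma bet_commute: "bet m u v = bet m v u"
  by (simp add: bet_def add.commute)

lemma bet_self [simp]: "bet m u u = 0"
  by (simp add: bet_def)

lemma bet_zero [simp]: "bet m 0 v = 0" "bet m v 0 = 0"
  by (simp_all add: bet_def)

lemma qf_zero [simp]: "qf m A 0 = 0"
  by (simp add: qf_def)

lemma qf_add: "qf m A (u + v) = qf m A u + qf m A v + bet m u v"
  by (simp add: qf_def bet_def gam_add_left gam_add_right ac_simps)

lemma bet_sum_right: "bet m v (sum f I) = (\<Sum>i\<in>I. bet m v (f i))"
  by (induction I rule: infinite_finite_induct) (simp_all add: bet_add_right)

text \<open>Iterating \<open>qf_add\<close>: each pair of summands contributes 1. If every summand
  has value 1 then the sum over $I$ has value $|I| + |I|(|I|-1)/2$, the exponent that singles out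
  the Lie algebra.\<close>

lemma qf_sum:
  assumes "finite I" and "\<And>i j. i \<in> I \<Longrightarrow> j \<in> I \<Longrightarrow> i \<noteq> j \<Longrightarrow> bet m (f i) (f j) = 1"
  shows "qf m A (sum f I) = (\<Sum>i\<in>I. qf m A (f i)) + of_nat (card I choose 2)"
  using assms
proof (induction I)
  case empty
  then show ?case by (simp add: numeral_2_eq_2)
next
  case (insert i I)
  have "bet m (f i) (sum f I) = (\<Sum>j\<in>I. 1)"
    unfolding bet_sum_right by (rule sum.cong) (use insert in auto)
  moreover have "qf m A (sum f I) = (\<Sum>i\<in>I. qf m A (f i)) + of_nat (card I choose 2)"
    using insert by simp
  ultimately show ?case
    using insert(1,2) by (simp add: qf_add numeral_2_eq_2 ac_simps)
qed

definition words :: "nat \<Rightarrow> pauli set"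
  where "words m = {v. \<forall>j\<ge>m. xpart v j = 0 \<and> zpart v j = 0}"

lemma words_zero [simp]: "0 \<in> words m"
  by (simp add: words_def)

lemma words_add [simp]: "u \<in> words m \<Longrightarrow> v \<in> words m \<Longrightarrow> u + v \<in> words m"
  by (simp add: words_def)

lemma words_sum: "(\<And>i. i \<in> I \<Longrightarrow> f i \<in> words m) \<Longrightarrow> sum f I \<in> words m"
  by (induction I rule: infinite_finite_induct) simp_all

lemma words_mono: "m \<le> n \<Longrightarrow> words m \<subseteq> words n"
  by (auto simp: words_def)

lemma card_words: "finite (words m) \<and> card (words m) = 4 ^ m"
proof -
  let ?P = "Pow {..<m} \<times> Pow {..<m}"
  let ?f = "\<lambda>v. ({j. xpart v j = 1}, {j. zpart v j = 1})"
  let ?g = "\<lambda>(S, T). Pauli (\<lambda>j. if j \<in> S then 1 else 0) (\<lambda>j. if j \<in> T then 1 else 0)"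
  have "bij_betw ?f (words m) ?P"
  proof (rule bij_betw_byWitness[where f' = ?g])
    show "\<forall>v\<in>words m. ?g (?f v) = v" by (simp add: pauli_eq_iff)
    show "\<forall>p\<in>?P. ?f (?g p) = p" by auto
    show "?f ` words m \<subseteq> ?P" by (auto simp: words_def) (metis bit.distinct(1) not_less)+
    show "?g ` ?P \<subseteq> words m" by (auto simp: words_def)
  qed
  moreover have "card ?P = 4 ^ m"
    by (simp add: card_cartesian_product card_Pow flip: power_mult_distrib)
  ultimately show ?thesis
    using bij_betw_finite[of ?f "words m" ?P] bij_betw_same_card[of ?f "words m" ?P] by simp
qed

section \<open>Anticommuting words with prescribed signs\<close>

definition anticommuting :: "nat \<Rightarrow> pauli set \<Rightarrow> bool"
  where "anticommuting m W \<longleftrightarrow> finite W \<and> W \<subseteq> words m \<and> (\<forall>u\<in>W. \<forall>v\<in>W. u \<noteq> v \<longrightarrow> bet m u v = 1)"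

text \<open>What is required of the images of the generators. The form with parameter $A$ is the
  sign of the squares, hence must take the value 1 on $r$ words and 0 on $s$ words; the form with
  parameter $B$ cuts out the target Lie algebra, hence must be 1 on all of them.\<close>

definition frame_set :: "pauli \<Rightarrow> pauli \<Rightarrow> nat \<Rightarrow> nat \<Rightarrow> nat \<Rightarrow> pauli set \<Rightarrow> bool"
  where "frame_set A B m r s W \<longleftrightarrow> anticommuting m W \<and> (\<forall>u\<in>W. qf m B u = 1) \<and>
    card {u \<in> W. qf m A u = 1} = r \<and> card {u \<in> W. qf m A u = 0} = s"

definition frame :: "pauli \<Rightarrow> pauli \<Rightarrow> nat \<Rightarrow> nat \<Rightarrow> nat \<Rightarrow> bool"
  where "frame A B m r s \<longleftrightarrow> (\<exists>W. frame_set A B m r s W)"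

text \<open>The symplectic reflection along $p$. It preserves every quadratic form with value 1 at
  $p$, while a form with value 0 at $p$ changes exactly on the words that do not commute with $p$.
  Applied to a frame it therefore alters only the numbers $r$ and $s$.\<close>

definition transvection :: "nat \<Rightarrow> pauli \<Rightarrow> pauli \<Rightarrow> pauli"
  where "transvection m p v = (if bet m v p = 1 then v + p else v)"

lemma transvection_transvection: "transvection m p (transvection m p v) = v"
  by (simp add: transvection_def bet_add_left add.assoc)

lemma bet_transvection: "bet m (transvection m p u) (transvection m p v) = bet m u v"
  using bet_commute[of m p v] by (simp add: transvection_def bet_add_left bet_add_right)

lemma qf_transvection: "qf m A p = 0 \<Longrightarrow> qf m A (transvection m p v) = qf m A v + bet m v p"
  by (simp add: transvection_def qf_add)

lemma qf_transvection_inv: "qf m B p = 1 \<Longrightarrow> qf m B (transvection m p v) = qf m B v"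
  by (simp add: transvection_def qf_add add.assoc)

lemma frame_set_transvection:
  assumes W: "frame_set A B m r s W" and p: "p \<in> words m" "qf m B p = 1" "qf m A p = 0"
  shows "frame_set A B m (card {u \<in> W. qf m A u + bet m u p = 1}) (card {u \<in> W. qf m A u + bet m u p = 0})
    (transvection m p ` W)"
proof -
  let ?T = "transvection m p"
  have inj: "inj ?T" by (metis injI transvection_transvection)
  have "card {u \<in> ?T ` W. qf m A u = c} = card {u \<in> W. qf m A u + bet m u p = c}" for c
  proof -
    have "{u \<in> ?T ` W. qf m A u = c} = ?T ` {u \<in> W. qf m A u + bet m u p = c}"
      using qf_transvection[OF p(3)] by auto
    then show ?thesis by (simp add: card_image[OF inj_on_subset[OF inj]])
  qed
  moreover have "anticommuting m (?T ` W)"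
    unfolding anticommuting_def
  proof (intro conjI ballI impI)
    show "finite (?T ` W)" using W by (simp add: frame_set_def anticommuting_def)
    show "?T ` W \<subseteq> words m"
      using W p(1) by (auto simp: frame_set_def anticommuting_def transvection_def)
    fix u v assume "u \<in> ?T ` W" "v \<in> ?T ` W" and uv: "u \<noteq> v"
    then obtain x y where xy: "x \<in> W" "u = ?T x" "y \<in> W" "v = ?T y" by blast
    with uv have "x \<noteq> y" by blast
    with xy W show "bet m u v = 1"
      by (simp add: bet_transvection frame_set_def anticommuting_def)
  qed
  moreover have "\<forall>u\<in>?T ` W. qf m B u = 1"
    using W qf_transvection_inv[OF p(2)] by (auto simp: frame_set_def)
  ultimately show ?thesis by (simp add: frame_set_def)
qed

text \<open>Reflection along a member $p$ with $A$-value 0: all other members anticommute with $p$,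
  so their $A$-values are flipped, while $p$ stays.\<close>

lemma frame_flip:
  assumes "frame A B m r (Suc s)"
  shows "frame A B m s (Suc r)"
proof -
  obtain W where W: "frame_set A B m r (Suc s) W" using assms by (auto simp: frame_def)
  then have fin: "finite W" by (simp add: frame_set_def anticommuting_def)
  let ?N = "{u \<in> W. qf m A u = 1}" and ?P = "{u \<in> W. qf m A u = 0}"
  have c: "card ?N = r" "card ?P = Suc s" using W by (auto simp: frame_set_def)
  then obtain p where p: "p \<in> W" "qf m A p = 0" by (metis (mono_tags, lifting) card_eq_0_iff equals0I mem_Collect_eq nat.distinct(1))
  have bet: "bet m u p = (if u = p then 0 else 1)" if "u \<in> W" for u
    using W that p by (auto simp: frame_set_def anticommuting_def)
  have "{u \<in> W. qf m A u + bet m u p = 1} = ?P - {p}"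
    using bet p by (auto split: if_splits)
  then have "card {u \<in> W. qf m A u + bet m u p = 1} = s"
    using c p fin by (simp add: card_Diff_singleton)
  moreover have "{u \<in> W. qf m A u + bet m u p = 0} = insert p ?N"
    using bet p by (auto split: if_splits)
  then have "card {u \<in> W. qf m A u + bet m u p = 0} = Suc r"
    using c p fin by simp
  moreover have pw: "p \<in> words m" "qf m B p = 1"
    using W p by (auto simp: frame_set_def anticommuting_def)
  ultimately show ?thesis
    using frame_set_transvection[OF W pw p(2)] unfolding frame_def by auto
qed

text \<open>Reflection along the sum of six members: it anticommutes with these six (each sees the
  five others) and commutes with all other members. As $6 \cdot 5 / 2$ is odd, its $B$-value is 1,
  and its $A$-value is 0 if an odd number of the six have $A$-value 1. So the $A$-values of exactly
  these six are flipped.\<close>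

lemma frame_six:
  assumes W: "frame_set A B m r s W" and N: "N \<subseteq> W" "card N = 6"
    and a: "odd (card {u \<in> N. qf m A u = 1})"
  shows "frame A B m (card {u \<in> W - N. qf m A u = 1} + card {u \<in> N. qf m A u = 0})
    (card {u \<in> W - N. qf m A u = 0} + card {u \<in> N. qf m A u = 1})"
proof -
  have fin: "finite W" using W by (simp add: frame_set_def anticommuting_def)
  have finN: "finite N" using N(1) fin finite_subset by blast
  let ?p = "sum (\<lambda>u. u) N"
  have an: "bet m u v = 1" if "u \<in> W" "v \<in> W" "u \<noteq> v" for u v
    using W that by (auto simp: frame_set_def anticommuting_def)
  have q: "qf m X ?p = (\<Sum>u\<in>N. qf m X u) + 1" for X
  proof -
    have "qf m X ?p = (\<Sum>u\<in>N. qf m X u) + of_nat (card N choose 2)"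
      by (rule qf_sum[OF finN]) (use an N in auto)
    \<comment> \<open>Six members form 15 pairs, an odd number.\<close>
    also have "of_nat (card N choose 2) = (1::bit)"
      by (simp add: N choose_two)
    finally show ?thesis .
  qed
  have "(\<Sum>u\<in>N. qf m B u) = (\<Sum>u\<in>N. 1)"
    by (rule sum.cong) (use W N in \<open>auto simp: frame_set_def\<close>)
  then have B: "qf m B ?p = 1" by (simp add: q N)
  have "(\<Sum>u\<in>N. qf m A u) = (\<Sum>u\<in>{u \<in> N. qf m A u = 1}. 1)"
    by (rule sum.mono_neutral_cong_right) (use finN in auto)
  then have A: "qf m A ?p = 0" using a by (simp add: q of_nat_bit)
  have p: "?p \<in> words m"
    by (rule words_sum) (use W N in \<open>auto simp: frame_set_def anticommuting_def\<close>)
  have bet: "bet m u ?p = (if u \<in> N then 1 else 0)" if u: "u \<in> W" for u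
  proof -
    have "bet m u ?p = (\<Sum>v\<in>N. bet m u v)" by (rule bet_sum_right)
    also have "\<dots> = (\<Sum>v\<in>N - {u}. 1)"
      by (rule sum.mono_neutral_cong_right) (use finN an[OF u] N in auto)
    finally show ?thesis using N finN by (simp add: card_Diff_singleton_if)
  qed
  have "card {u \<in> W. qf m A u + bet m u ?p = c}
      = card {u \<in> W - N. qf m A u = c} + card {u \<in> N. qf m A u = 1 + c}" for c
  proof -
    have "{u \<in> W. qf m A u + bet m u ?p = c} = {u \<in> W - N. qf m A u = c} \<union> {u \<in> N. qf m A u = 1 + c}"
      using bet N by (auto simp: add.commute split: if_splits)
    then show ?thesis
      using fin finN by (simp only:) (rule card_Un_disjoint, auto)
  qed
  from this[of 0] this[of 1] show ?thesis
    using frame_set_transvection[OF W p B A] unfolding frame_def by auto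
qed

text \<open>Flipping one value 1 and five values 0, or conversely, by
  \<open>frame_six\<close>.\<close>

lemma frame_shift:
  assumes "frame A B m r s"
  shows "1 \<le> r \<Longrightarrow> 5 \<le> s \<Longrightarrow> frame A B m (r + 4) (s - 4)"
    and "5 \<le> r \<Longrightarrow> 1 \<le> s \<Longrightarrow> frame A B m (r - 4) (s + 4)"
proof -
  obtain W where W: "frame_set A B m r s W" using assms by (auto simp: frame_def)
  then have fin: "finite W" by (simp add: frame_set_def anticommuting_def)
  let ?N = "{u \<in> W. qf m A u = 1}" and ?P = "{u \<in> W. qf m A u = 0}"
  have c: "card ?N = r" "card ?P = s" using W by (auto simp: frame_set_def)
  have step: "frame A B m (r - a + (6 - a)) (s - (6 - a) + a)" if a: "a \<le> r" "6 - a \<le> s" "odd a" "a \<le> 6" for a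
  proof -
    obtain X where X: "X \<subseteq> ?N" "card X = a" using obtain_subset_with_card_n[of a ?N] a c by auto
    obtain Y where Y: "Y \<subseteq> ?P" "card Y = 6 - a" using obtain_subset_with_card_n[of "6 - a" ?P] a c by auto
    have "X \<inter> Y \<subseteq> ?N \<inter> ?P" using X Y by blast
    also have "?N \<inter> ?P = {}" by auto
    finally have f: "finite X" "finite Y" "X \<inter> Y = {}"
      using X Y fin finite_subset[of X W] finite_subset[of Y W] by auto
    have six: "card (X \<union> Y) = 6" using card_Un_disjoint[OF f] X Y a by simp
    have sub: "X \<union> Y \<subseteq> W" using X Y by blast
    have e: "{u \<in> X \<union> Y. qf m A u = 1} = X" "{u \<in> X \<union> Y. qf m A u = 0} = Y"
      "{u \<in> W - (X \<union> Y). qf m A u = 1} = ?N - X" "{u \<in> W - (X \<union> Y). qf m A u = 0} = ?P - Y"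
      using X Y by auto
    have d: "card (?N - X) = r - a" "card (?P - Y) = s - (6 - a)"
      using X Y f c by (auto simp: card_Diff_subset)
    show ?thesis
      using frame_six[OF W sub six] a(3) unfolding e d X(2) Y(2) by blast
  qed
  {
    assume "1 \<le> r" "5 \<le> s"
    moreover from this have "r - 1 + (6 - 1) = r + 4" "s - (6 - 1) + 1 = s - 4" by arith+
    ultimately show "frame A B m (r + 4) (s - 4)" using step[of 1] by (simp add: add.commute)
  next
    assume "5 \<le> r" "1 \<le> s"
    moreover from this have "r - 5 + (6 - 5) = r - 4" "s - (6 - 5) + 5 = s + 4" by arith+
    ultimately show "frame A B m (r - 4) (s + 4)" using step[of 5] by (simp add: add.commute)
  }
qed

lemma frame_shift_iterated:
  "frame A B m r (s + 4 * k) \<Longrightarrow> 1 \<le> r \<Longrightarrow> 1 \<le> s \<Longrightarrow> frame A B m (r + 4 * k) s"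
  "frame A B m (r + 4 * k) s \<Longrightarrow> 1 \<le> r \<Longrightarrow> 1 \<le> s \<Longrightarrow> frame A B m r (s + 4 * k)"
proof (induction k arbitrary: r s)
  case (Suc k)
  {
    case 1
    then have "frame A B m (r + 4) (s + 4 * k)"
      using frame_shift(1)[of A B m r "s + 4 * Suc k"] by simp
    then show ?case using Suc(1)[of "r + 4" s] 1 by (simp add: ac_simps)
  next
    case 2
    then have "frame A B m (r + 4 * k) (s + 4)"
      using frame_shift(2)[of A B m "r + 4 * Suc k" s] by simp
    then show ?case using Suc(2)[of r "s + 4"] 2 by (simp add: ac_simps)
  }
qed auto

lemma frame_mod4:
  assumes F: "frame A B m r\<^sub>0 s\<^sub>0" and pos: "1 \<le> r\<^sub>0" "1 \<le> s\<^sub>0" "1 \<le> r" "1 \<le> s"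
    and sum: "r + s = r\<^sub>0 + s\<^sub>0" and mod: "s mod 4 = s\<^sub>0 mod 4"
  shows "frame A B m r s"
proof (cases "s \<le> s\<^sub>0")
  case True
  then obtain k where "s\<^sub>0 = s + 4 * k" using mod by (metis mod_eq_nat1E)
  with frame_shift_iterated(1)[of A B m r\<^sub>0 s k] F pos sum show ?thesis by (simp add: add.commute)
next
  case False
  then obtain k where k: "s = s\<^sub>0 + 4 * k" using mod by (metis mod_eq_nat1E nat_le_linear)
  then have "r\<^sub>0 = r + 4 * k" using sum by simp
  with k frame_shift_iterated(2)[of A B m r k s\<^sub>0] F pos show ?thesis by simp
qed

text \<open>For a fixed number of members, only $s$ modulo 4 matters, and \<open>frame_flip\<close>
  exchanges two of its classes. This is the reason why the two residues of $s$ listed for one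
  classical Lie algebra occur together.\<close>

lemma frame_classes:
  assumes F: "frame A B m r\<^sub>0 s\<^sub>0" and pos: "1 \<le> r\<^sub>0" "1 \<le> s\<^sub>0" "1 \<le> r" "1 \<le> s"
    and sum: "r + s = r\<^sub>0 + s\<^sub>0" and six: "6 \<le> r + s"
    and mod: "s mod 4 = s\<^sub>0 mod 4 \<or> (s + s\<^sub>0) mod 4 = (r + s + 1) mod 4"
  shows "frame A B m r s"
  using mod
proof
  assume "s mod 4 = s\<^sub>0 mod 4"
  then show ?thesis using frame_mod4[OF F pos sum] by simp
next
  assume *: "(s + s\<^sub>0) mod 4 = (r + s + 1) mod 4"
  \<comment> \<open>The representative of the class lies between 2 and 5, so that the flip leaves both numbers positive.\<close>
  define s\<^sub>1 where "s\<^sub>1 = (s\<^sub>0 + 2) mod 4 + 2"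
  have s1: "2 \<le> s\<^sub>1" "s\<^sub>1 \<le> 5" "s\<^sub>1 mod 4 = s\<^sub>0 mod 4"
  proof -
    show "2 \<le> s\<^sub>1" "s\<^sub>1 \<le> 5" by (auto simp: s\<^sub>1_def)
    have "s\<^sub>1 mod 4 = (s\<^sub>0 + 2 + 2) mod 4" unfolding s\<^sub>1_def by (rule mod_add_left_eq)
    then show "s\<^sub>1 mod 4 = s\<^sub>0 mod 4" by simp
  qed
  define r\<^sub>1 where "r\<^sub>1 = r + s - s\<^sub>1"
  have r1: "r\<^sub>1 + s\<^sub>1 = r + s" "1 \<le> r\<^sub>1" using s1 six by (auto simp: r\<^sub>1_def)
  have "frame A B m r\<^sub>1 (Suc (s\<^sub>1 - 1))"
    using frame_mod4[OF F pos(1,2), of r\<^sub>1 s\<^sub>1] s1 r1 sum by simp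
  then have flip: "frame A B m (s\<^sub>1 - 1) (Suc r\<^sub>1)" by (rule frame_flip)
  have "s mod 4 = Suc r\<^sub>1 mod 4"
  proof -
    have "(s\<^sub>1 + s) mod 4 = (s + s\<^sub>0) mod 4"
      using s1(3) by (metis add.commute mod_add_right_eq)
    also have "\<dots> = (s\<^sub>1 + Suc r\<^sub>1) mod 4"
      using * r1(1) by (simp add: ac_simps)
    finally show ?thesis unfolding cong_def[symmetric] cong_add_lcancel_nat .
  qed
  then show ?thesis
    using frame_mod4[OF flip, of r s] s1 r1 pos by simp
qed

section \<open>Words as lists of letters, and periodicity\<close>

text \<open>Explicit words are written as lists of letters, so that the conditions on a frame can be
  checked by evaluation.\<close>

definition of_letters :: "(bit \<times> bit) list \<Rightarrow> pauli"
  where "of_letters xs = Pauli (\<lambda>j. if j < length xs then fst (xs ! j) else 0) (\<lambda>j. if j < length xs then snd (xs ! j) else 0)"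

fun lgam :: "(bit \<times> bit) list \<Rightarrow> (bit \<times> bit) list \<Rightarrow> bit"
  where "lgam (a # xs) (b # ys) = fst a * snd b + lgam xs ys"
  | "lgam _ _ = 0"

lemma of_letters_words: "length xs \<le> m \<Longrightarrow> of_letters xs \<in> words m"
  by (auto simp: of_letters_def words_def)

lemma gam_of_letters:
  "length xs \<le> m \<Longrightarrow> length ys \<le> m \<Longrightarrow> gam m (of_letters xs) (of_letters ys) = lgam xs ys"
proof (induction xs ys arbitrary: m rule: lgam.induct)
  case (1 a xs b ys)
  then obtain m' where m: "m = Suc m'" by (cases m) auto
  have "gam m (of_letters (a # xs)) (of_letters (b # ys))
      = fst a * snd b + gam m' (of_letters xs) (of_letters ys)"
    unfolding m gam_def sum.lessThan_Suc_shift
    by (intro arg_cong2[of _ _ _ _ "(+)"] sum.cong) (auto simp: of_letters_def)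
  then show ?case using 1 m by simp
qed (auto simp: gam_def of_letters_def)

definition lbet where "lbet xs ys = lgam xs ys + lgam ys xs"
definition lqf where "lqf a xs = lgam xs xs + lbet xs a"

lemma lbet: "length xs \<le> m \<Longrightarrow> length ys \<le> m \<Longrightarrow> bet m (of_letters xs) (of_letters ys) = lbet xs ys"
  and lqf: "length xs \<le> m \<Longrightarrow> length a \<le> m \<Longrightarrow> qf m (of_letters a) (of_letters xs) = lqf a xs"
  by (simp_all add: lbet_def lqf_def bet_def qf_def gam_of_letters)

definition frame_list :: "(bit \<times> bit) list \<Rightarrow> (bit \<times> bit) list \<Rightarrow> nat \<Rightarrow> (bit \<times> bit) list list \<Rightarrow> bool"
  where "frame_list a b m ws \<longleftrightarrow> length a \<le> m \<and> length b \<le> m \<and>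
    sorted_wrt (\<lambda>u v. lbet u v = 1) ws \<and> (\<forall>w\<in>set ws. length w = m \<and> lqf b w = 1)"

lemma frame_list_frame_set:
  assumes "frame_list a b m ws"
  shows "frame_set (of_letters a) (of_letters b) m (length (filter (\<lambda>w. lqf a w = 1) ws))
    (length (filter (\<lambda>w. lqf a w = 0) ws)) (of_letters ` set ws)"
proof -
  have len: "length a \<le> m" "length b \<le> m" "\<And>w. w \<in> set ws \<Longrightarrow> length w = m"
    and b: "\<And>w. w \<in> set ws \<Longrightarrow> lqf b w = 1"
    and sorted: "sorted_wrt (\<lambda>u v. lbet u v = 1) ws"
    using assms by (auto simp: frame_list_def)
  have pw: "lbet (ws ! i) (ws ! j) = 1" if "i < length ws" "j < length ws" "i \<noteq> j" for i j
  proof -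
    have comm: "lbet (ws ! j) (ws ! i) = lbet (ws ! i) (ws ! j)" by (simp add: lbet_def add.commute)
    have "i < j \<or> j < i" using that by linarith
    then show ?thesis
      by (elim disjE) (use that comm sorted_wrt_nth_less[OF sorted, of i j] sorted_wrt_nth_less[OF sorted, of j i] in \<open>metis+\<close>)
  qed
  have dist: "distinct ws"
    unfolding distinct_conv_nth
  proof (intro allI impI)
    fix i j assume "i < length ws" "j < length ws" "i \<noteq> j"
    then have "lbet (ws ! i) (ws ! j) = 1" by (rule pw)
    then show "ws ! i \<noteq> ws ! j" by (auto simp: lbet_def)
  qed
  have inj: "inj_on of_letters (set ws)"
  proof (rule inj_onI)
    fix u v assume uv: "u \<in> set ws" "v \<in> set ws" and eq: "of_letters u = of_letters v"
    show "u = v"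
    proof (rule nth_equalityI)
      show "length u = length v" using len uv by simp
      show "u ! i = v ! i" if "i < length u" for i
        using eq[unfolded pauli_eq_iff, rule_format, of i] that len(3)[OF uv(1)] len(3)[OF uv(2)]
        by (simp add: of_letters_def prod_eq_iff)
    qed
  qed
  have "card {u \<in> of_letters ` set ws. qf m (of_letters a) u = c}
      = length (filter (\<lambda>w. lqf a w = c) ws)" for c
  proof -
    have "{u \<in> of_letters ` set ws. qf m (of_letters a) u = c} = of_letters ` set (filter (\<lambda>w. lqf a w = c) ws)"
      using len by (auto simp: lqf)
    also have "card \<dots> = card (set (filter (\<lambda>w. lqf a w = c) ws))"
      by (rule card_image) (rule inj_on_subset[OF inj], auto)
    finally show ?thesis using distinct_card[OF distinct_filter[OF dist]] by metis
  qed
  moreover have "bet m (of_letters u) (of_letters v) = 1"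
    if "u \<in> set ws" "v \<in> set ws" "of_letters u \<noteq> of_letters v" for u v
    using that len pw by (auto simp: lbet in_set_conv_nth)
  ultimately show ?thesis
    using len b of_letters_words by (auto simp: frame_set_def anticommuting_def lqf)
qed

text \<open>The letters $1$, $X$, $Z$ and $ZX$; the last one is called $Y$, being the Pauli matrix
  of that name up to the factor $i$.\<close>

abbreviation "LI \<equiv> (0, 0) :: bit \<times> bit"
abbreviation "LX \<equiv> (1, 0) :: bit \<times> bit"
abbreviation "LZ \<equiv> (0, 1) :: bit \<times> bit"
abbreviation "LY \<equiv> (1, 1) :: bit \<times> bit"

lemmas frame_list_simps = frame_list_def lqf_def lbet_def

definition shift :: "nat \<Rightarrow> pauli \<Rightarrow> pauli"
  where "shift m p = Pauli (\<lambda>j. if j < m then 0 else xpart p (j - m)) (\<lambda>j. if j < m then 0 else zpart p (j - m))"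

lemma sum_lessThan_add: "(\<Sum>j<m + k. f j) = (\<Sum>j<m. f j) + (\<Sum>j<k. f (m + j))"
  for f :: "nat \<Rightarrow> 'b::comm_monoid_add"
  by (induction k) (simp_all add: add.assoc)

lemma gam_shift:
  assumes "u \<in> words m" and "v \<in> words m"
  shows "gam (m + k) (u + shift m p) (v + shift m q) = gam m u v + gam k p q"
  unfolding gam_def sum_lessThan_add
  using assms by (intro arg_cong2[of _ _ _ _ "(+)"] sum.cong) (auto simp: words_def shift_def)

lemma bet_shift:
  assumes "u \<in> words m" and "v \<in> words m"
  shows "bet (m + k) (u + shift m p) (v + shift m q) = bet m u v + bet k p q"
  unfolding bet_def gam_shift[OF assms] gam_shift[OF assms(2,1)] by (simp add: ac_simps)

lemma qf_shift:
  assumes "u \<in> words m" and "A \<in> words m"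
  shows "qf (m + k) A (u + shift m p) = qf m A u + qf k 0 p"
proof -
  have "shift m 0 = 0" by (simp add: shift_def pauli_eq_iff)
  then have "bet (m + k) (u + shift m p) A = bet m u A"
    using bet_shift[OF assms, of k p 0] by simp
  then show ?thesis
    unfolding qf_def gam_shift[OF assms(1) assms(1)] by (simp add: ac_simps)
qed

text \<open>Eight anticommuting words whose matrices have square $-1$. That real matrices of size 16
  with this property exist, together with one more matrix anticommuting with all of them, is the
  source of the periodicity modulo 8.\<close>

definition tail_frame :: "(bit \<times> bit) list list"
  where "tail_frame = [[LI,LI,LI,LY], [LI,LI,LY,LX], [LI,LX,LY,LZ], [LI,LZ,LY,LZ],
    [LI,LY,LI,LZ], [LI,LY,LX,LX], [LX,LY,LZ,LX], [LZ,LY,LZ,LX]]"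

definition tail_sum :: "(bit \<times> bit) list"
  where "tail_sum = [LY, LY, LZ, LX]"

lemma tail_frame: "frame_list [] [] 4 tail_frame" "\<forall>w\<in>set tail_frame. lqf [] w = 1"
  "\<forall>w\<in>set tail_frame. lbet tail_sum w = 1" "lqf [] tail_sum = 0" "length tail_sum = 4" "length tail_frame = 8"
  by (simp_all add: frame_list_simps tail_frame_def tail_sum_def)

lemma frame_setD:
  assumes "frame_set A B m r s W"
  shows "finite W" and "u \<in> W \<Longrightarrow> u \<in> words m" and "u \<in> W \<Longrightarrow> v \<in> W \<Longrightarrow> u \<noteq> v \<Longrightarrow> bet m u v = 1"
    and "u \<in> W \<Longrightarrow> qf m B u = 1"
  using assms unfolding frame_set_def anticommuting_def by blast+

lemma frame_set_image:
  assumes W: "frame_set A B m r s W" and words: "\<And>u. u \<in> W \<Longrightarrow> f u \<in> words n"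
    and bet: "\<And>u v. u \<in> W \<Longrightarrow> v \<in> W \<Longrightarrow> bet n (f u) (f v) = bet m u v"
    and qA: "\<And>u. u \<in> W \<Longrightarrow> qf n A' (f u) = qf m A u" and qB: "\<And>u. u \<in> W \<Longrightarrow> qf n B' (f u) = qf m B u"
  shows "frame_set A' B' n r s (f ` W)"
proof -
  have inj: "inj_on f W"
  proof (rule inj_onI, rule ccontr)
    fix u v assume "u \<in> W" "v \<in> W" "f u = f v" "u \<noteq> v"
    then show False using bet[of u v] frame_setD(3)[OF W, of u v] by simp
  qed
  have card: "card {v \<in> f ` W. qf n A' v = c} = card {u \<in> W. qf m A u = c}" for c
  proof -
    have "{v \<in> f ` W. qf n A' v = c} = f ` {u \<in> W. qf m A u = c}"
      using qA by auto
    then show ?thesis by (simp add: card_image[OF inj_on_subset[OF inj]])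
  qed
  have anti: "anticommuting n (f ` W)"
    unfolding anticommuting_def
  proof (intro conjI ballI impI)
    show "finite (f ` W)" using frame_setD(1)[OF W] by simp
    show "f ` W \<subseteq> words n" using words by blast
    fix u v assume "u \<in> f ` W" "v \<in> f ` W" and uv: "u \<noteq> v"
    then obtain x y where xy: "x \<in> W" "u = f x" "y \<in> W" "v = f y" by blast
    with uv have "x \<noteq> y" by blast
    with xy show "bet n u v = 1" using frame_setD(3)[OF W] bet by simp
  qed
  have "\<forall>v\<in>f ` W. qf n B' v = 1" using qB frame_setD(4)[OF W] by simp
  with anti card show ?thesis using W unfolding frame_set_def by simp
qed

lemma frame_set_Un:
  assumes X: "frame_set A B m r s X" and Y: "frame_set A B m r' s' Y"
    and XY: "\<And>u v. u \<in> X \<Longrightarrow> v \<in> Y \<Longrightarrow> bet m u v = 1"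
  shows "frame_set A B m (r + r') (s + s') (X \<union> Y)"
proof -
  have disj: "X \<inter> Y = {}" using XY bet_self by (metis disjoint_iff zero_neq_one)
  have card: "card {u \<in> X \<union> Y. qf m A u = c} = card {u \<in> X. qf m A u = c} + card {u \<in> Y. qf m A u = c}" for c
  proof -
    have "{u \<in> X \<union> Y. qf m A u = c} = {u \<in> X. qf m A u = c} \<union> {u \<in> Y. qf m A u = c}" by blast
    then show ?thesis
      using disj frame_setD(1)[OF X] frame_setD(1)[OF Y] by (simp only:) (rule card_Un_disjoint, auto)
  qed
  have YX: "bet m v u = 1" if "u \<in> X" "v \<in> Y" for u v
    using XY[OF that] bet_commute[of m v u] by simp
  have "anticommuting m (X \<union> Y)"
    using frame_setD[OF X] frame_setD[OF Y] XY YX unfolding anticommuting_def by blast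
  moreover have "\<forall>u\<in>X \<union> Y. qf m B u = 1"
    using frame_setD(4)[OF X] frame_setD(4)[OF Y] by blast
  ultimately show ?thesis
    using X Y unfolding frame_set_def card by simp
qed

text \<open>Periodicity. The old members are prolonged by a word of value 0 that anticommutes with
  the eight words of \<open>tail_frame\<close>, and these are placed behind the unit word.
  Parameters $A$ and $B$ do not see the new positions, so both forms are 1 on the eight new members,
  which all count towards $r$.\<close>

lemma frame_step:
  assumes "frame A B m r s" and A: "A \<in> words m" and B: "B \<in> words m"
  shows "frame A B (m + 4) (r + 8) s"
proof -
  obtain W where W: "frame_set A B m r s W" using assms(1) by (auto simp: frame_def)
  note Ww = frame_setD(2)[OF W]
  define z where "z = of_letters tail_sum"
  define P where "P = of_letters ` set tail_frame"
  have nil: "of_letters [] = 0" by (simp add: of_letters_def pauli_eq_iff)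
  have P: "frame_set 0 0 4 8 0 P"
  proof -
    have "filter (\<lambda>w. lqf [] w = 1) tail_frame = tail_frame"
      using tail_frame(2) by (simp add: filter_id_conv)
    moreover have "filter (\<lambda>w. lqf [] w = 0) tail_frame = []"
      using tail_frame(2) by (simp add: filter_empty_conv)
    ultimately show ?thesis
      using frame_list_frame_set[OF tail_frame(1)] tail_frame(6) nil by (simp add: P_def)
  qed
  have len: "length w = 4" if "w \<in> set tail_frame" for w
    using tail_frame(1) that by (auto simp: frame_list_def)
  have z: "bet 4 z p = 1" if "p \<in> P" for p
    using that tail_frame(3,5) len by (auto simp: lbet P_def z_def)
  have zq: "qf 4 0 z = 0"
    using lqf[of tail_sum 4 "[]"] tail_frame(4,5) nil by (simp add: z_def)
  have Pq: "qf 4 0 p = 1" if "p \<in> P" for p by (rule frame_setD(4)[OF P that])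
  have w: "u + shift m p \<in> words (m + 4)" if "u \<in> words m" "p \<in> words 4" for u p
    using that by (auto simp: words_def shift_def)
  have z4: "z \<in> words 4" unfolding z_def by (rule of_letters_words) (simp add: tail_frame(5))
  have X: "frame_set A B (m + 4) r s ((\<lambda>u. u + shift m z) ` W)"
  proof (rule frame_set_image[OF W])
    fix u v assume u: "u \<in> W" and v: "v \<in> W"
    show "u + shift m z \<in> words (m + 4)" by (rule w[OF Ww[OF u] z4])
    show "qf (m + 4) A (u + shift m z) = qf m A u" "qf (m + 4) B (u + shift m z) = qf m B u"
      unfolding qf_shift[OF Ww[OF u] A] qf_shift[OF Ww[OF u] B] zq by simp_all
    show "bet (m + 4) (u + shift m z) (v + shift m z) = bet m u v"
      unfolding bet_shift[OF Ww[OF u] Ww[OF v]] by simp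
  qed
  have Y: "frame_set A B (m + 4) 8 0 ((\<lambda>p. 0 + shift m p) ` P)"
  proof (rule frame_set_image[OF P])
    fix p q assume p: "p \<in> P" and q: "q \<in> P"
    show "0 + shift m p \<in> words (m + 4)" by (rule w[OF words_zero frame_setD(2)[OF P p]])
    show "qf (m + 4) A (0 + shift m p) = qf 4 0 p" "qf (m + 4) B (0 + shift m p) = qf 4 0 p"
      unfolding qf_shift[OF words_zero A] qf_shift[OF words_zero B] by simp_all
    show "bet (m + 4) (0 + shift m p) (0 + shift m q) = bet 4 p q"
      unfolding bet_shift[OF words_zero words_zero] by simp
  qed
  have "frame_set A B (m + 4) (r + 8) (s + 0) ((\<lambda>u. u + shift m z) ` W \<union> (\<lambda>p. 0 + shift m p) ` P)"
  proof (rule frame_set_Un[OF X Y])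
    fix u v assume "u \<in> (\<lambda>u. u + shift m z) ` W" "v \<in> (\<lambda>p. 0 + shift m p) ` P"
    then obtain x p where x: "x \<in> W" "u = x + shift m z" and p: "p \<in> P" "v = 0 + shift m p" by blast
    show "bet (m + 4) u v = 1"
      unfolding x(2) p(2) bet_shift[OF Ww[OF x(1)] words_zero] z[OF p(1)] by simp
  qed
  then show ?thesis unfolding frame_def add_0_right by blast
qed

lemma frame_series:
  assumes base: "frame A B m\<^sub>0 r\<^sub>0 s\<^sub>0" and A: "A \<in> words m\<^sub>0" and B: "B \<in> words m\<^sub>0"
    and pos: "1 \<le> r\<^sub>0" "1 \<le> s\<^sub>0" "1 \<le> r" "1 \<le> s" and six: "6 \<le> r + s"
    and m0: "r\<^sub>0 + s\<^sub>0 = 2 * m\<^sub>0" and m: "m = m\<^sub>0 + 4 * k" and rs: "r + s = 2 * m"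
    and mod: "s mod 4 = s\<^sub>0 mod 4 \<or> (s + s\<^sub>0) mod 4 = (r + s + 1) mod 4"
  shows "frame A B m r s"
proof -
  have "frame A B (m\<^sub>0 + 4 * k) (r\<^sub>0 + 8 * k) s\<^sub>0"
  proof (induction k)
    case 0
    then show ?case using base by simp
  next
    case (Suc k)
    have "words m\<^sub>0 \<subseteq> words (m\<^sub>0 + 4 * k)" by (rule words_mono) simp
    then have "frame A B (m\<^sub>0 + 4 * k + 4) (r\<^sub>0 + 8 * k + 8) s\<^sub>0"
      using frame_step[OF Suc] A B by blast
    then show ?case by (simp add: algebra_simps)
  qed
  then show ?thesis
    using frame_classes[of A B m "r\<^sub>0 + 8 * k" s\<^sub>0 r s] pos six m0 m rs mod by simp
qed

section \<open>Index sets and sums of anticommuting words\<close>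

lemma split_enumeration:
  assumes "finite W" and r: "card {u \<in> W. Q u} = r" and s: "card {u \<in> W. \<not> Q u} = s"
  obtains w where "bij_betw w {1..r + s} W" and "\<And>i. i \<in> {1..r + s} \<Longrightarrow> Q (w i) \<longleftrightarrow> i \<le> r"
proof -
  obtain f where f: "bij_betw f {1..r} {u \<in> W. Q u}"
    using ex_bij_betw_nat_finite_1[of "{u \<in> W. Q u}"] assms by auto
  obtain g where g: "bij_betw g {1..s} {u \<in> W. \<not> Q u}"
    using ex_bij_betw_nat_finite_1[of "{u \<in> W. \<not> Q u}"] assms by auto
  define w where "w i = (if i \<le> r then f i else g (i - r))" for i
  have 1: "bij_betw w {1..r} {u \<in> W. Q u}"
    using f by (rule bij_betw_cong[THEN iffD1, rotated]) (simp add: w_def)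
  have "bij_betw (\<lambda>i. i - r) {r + 1..r + s} {1..s}"
    by (rule bij_betw_byWitness[where f' = "\<lambda>i. i + r"]) auto
  then have "bij_betw (g \<circ> (\<lambda>i. i - r)) {r + 1..r + s} {u \<in> W. \<not> Q u}"
    using g by (rule bij_betw_trans)
  then have 2: "bij_betw w {r + 1..r + s} {u \<in> W. \<not> Q u}"
    by (rule bij_betw_cong[THEN iffD1, rotated]) (simp add: w_def)
  have "bij_betw w ({1..r} \<union> {r + 1..r + s}) ({u \<in> W. Q u} \<union> {u \<in> W. \<not> Q u})"
    by (rule bij_betw_combine[OF 1 2]) auto
  moreover have "{1..r} \<union> {r + 1..r + s} = {1..r + s}" by auto
  moreover have "{u \<in> W. Q u} \<union> {u \<in> W. \<not> Q u} = W" by auto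
  ultimately have "bij_betw w {1..r + s} W" by simp
  moreover have "Q (w i) \<longleftrightarrow> i \<le> r" if "i \<in> {1..r + s}" for i
  proof (cases "i \<le> r")
    case True
    then have "w i \<in> {u \<in> W. Q u}" using bij_betwE[OF 1] that by auto
    then show ?thesis using True by simp
  next
    case False
    then have "w i \<in> {u \<in> W. \<not> Q u}" using bij_betwE[OF 2] that by auto
    then show ?thesis using False by simp
  qed
  ultimately show thesis using that by blast
qed

definition anticommuting_family :: "nat \<Rightarrow> nat \<Rightarrow> (nat \<Rightarrow> pauli) \<Rightarrow> bool"
  where "anticommuting_family n m v \<longleftrightarrow> (\<forall>i\<in>{1..n}. v i \<in> words m) \<and>
    (\<forall>i\<in>{1..n}. \<forall>j\<in>{1..n}. i \<noteq> j \<longrightarrow> bet m (v i) (v j) = 1)"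

lemma frame_family:
  assumes "frame A B m r s"
  obtains v where "anticommuting_family (r + s) m v"
    and "\<And>i. i \<in> {1..r + s} \<Longrightarrow> qf m A (v i) = (if i \<le> r then 1 else 0)"
    and "\<And>i. i \<in> {1..r + s} \<Longrightarrow> qf m B (v i) = 1"
proof -
  obtain W where W: "frame_set A B m r s W" using assms by (auto simp: frame_def)
  have "{u \<in> W. qf m A u \<noteq> 1} = {u \<in> W. qf m A u = 0}" by auto
  then obtain v where v: "bij_betw v {1..r + s} W" and q: "\<And>i. i \<in> {1..r + s} \<Longrightarrow> qf m A (v i) = 1 \<longleftrightarrow> i \<le> r"
    using split_enumeration[OF frame_setD(1)[OF W], of "\<lambda>u. qf m A u = 1" r s] W
    unfolding frame_set_def by metis
  have vW: "v i \<in> W" if "i \<in> {1..r + s}" for i using bij_betwE[OF v] that by blast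
  have "anticommuting_family (r + s) m v"
    unfolding anticommuting_family_def
  proof (intro conjI ballI impI)
    show "v i \<in> words m" if "i \<in> {1..r + s}" for i using frame_setD(2)[OF W vW[OF that]] .
    show "bet m (v i) (v j) = 1" if "i \<in> {1..r + s}" "j \<in> {1..r + s}" "i \<noteq> j" for i j
      using bij_betw_imp_inj_on[OF v] that by (intro frame_setD(3)[OF W vW vW]) (auto dest: inj_onD)
  qed
  moreover have "qf m A (v i) = (if i \<le> r then 1 else 0)" if "i \<in> {1..r + s}" for i
    using q[OF that] by (cases "i \<le> r") auto
  ultimately show thesis using that frame_setD(4)[OF W vW] by blast
qed

text \<open>The product of all generators: the sum $p$ of an even number of anticommuting words
  anticommutes with each of them, as it sees an odd number of others.\<close>

lemma frame_extend:
  assumes "frame A B m r s" and n: "r + s = 2 * m"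
  obtains W p where "frame_set A B m r s W" and "p \<in> words m" and "p \<notin> W"
    and "\<forall>u\<in>W. bet m u p = 1"
    and "qf m A p = of_nat (r + m)" and "qf m B p = of_nat m"
proof -
  obtain W where W: "frame_set A B m r s W" using assms by (auto simp: frame_def)
  note fin = frame_setD(1)[OF W]
  let ?p = "sum (\<lambda>u. u) W"
  have "W = {u \<in> W. qf m A u = 1} \<union> {u \<in> W. qf m A u = 0}" by auto
  then have "card W = card {u \<in> W. qf m A u = 1} + card {u \<in> W. qf m A u = 0}"
    using fin card_Un_disjoint[of "{u \<in> W. qf m A u = 1}" "{u \<in> W. qf m A u = 0}"] by fastforce
  then have cW: "card W = 2 * m" using W n by (simp add: frame_set_def)
  have bet: "bet m u ?p = 1" if u: "u \<in> W" for u
  proof -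
    have "bet m u ?p = (\<Sum>v\<in>W - {u}. 1)"
      unfolding bet_sum_right by (rule sum.mono_neutral_cong_right) (use fin frame_setD(3)[OF W u] in auto)
    also have "\<dots> = of_nat (2 * m - 1)" using u cW by (simp add: card_Diff_singleton)
    also have "odd (2 * m - 1)" using u cW fin by (cases m) auto
    then have "of_nat (2 * m - 1) = (1::bit)" by (simp add: of_nat_bit)
    finally show ?thesis .
  qed
  have q: "qf m X ?p = (\<Sum>u\<in>W. qf m X u) + of_nat m" for X
  proof -
    have "(2 * m choose 2) = m * (2 * m - 1)" by (simp add: choose_two)
    then have "of_nat (2 * m choose 2) = (of_nat m :: bit)" by (cases m) (auto simp: of_nat_bit binomial_eq_0)
    then show ?thesis using qf_sum[OF fin, of m "\<lambda>u. u" X] frame_setD(3)[OF W] cW by simp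
  qed
  have "(\<Sum>u\<in>W. qf m A u) = (\<Sum>u\<in>{u \<in> W. qf m A u = 1}. 1)"
    by (rule sum.mono_neutral_cong_right) (use fin in auto)
  then have A: "qf m A ?p = of_nat (r + m)" using q[of A] W by (simp add: frame_set_def)
  have "(\<Sum>u\<in>W. qf m B u) = (\<Sum>u\<in>W. 1)" by (rule sum.cong) (use frame_setD(4)[OF W] in auto)
  then have B: "qf m B ?p = of_nat m" using q[of B] cW by (simp add: of_nat_bit)
  have "?p \<notin> W" using bet bet_self by (metis zero_neq_one)
  moreover have "?p \<in> words m" by (rule words_sum) (rule frame_setD(2)[OF W])
  ultimately show thesis using that[OF W] bet A B by blast
qed

text \<open>An odd Clifford system arises from an even one by adjoining, at position $k$, the word
  of the product of all its members. The square of that product is determined by $r$ and $m$; the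
  bit $c$ records whether a factor $i$ has to be included to obtain the desired sign.\<close>

lemma frame_odd_family:
  assumes F: "frame A B m (r - 1) s \<or> frame A B m r (s - 1)"
    and n: "r + s = 2 * m + 1" and pos: "1 \<le> r" "1 \<le> s" and c: "of_nat (r + m) = c"
  obtains v k where "anticommuting_family (r + s) m v" and "k \<in> {1..r + s}"
    and "\<And>i. i \<in> {1..r + s} \<Longrightarrow> qf m A (v i) + (if i = k then c else 0) = (if i \<le> r then 1 else 0)"
    and "\<And>i. i \<in> {1..r + s} \<Longrightarrow> qf m B (v i) = (if i = k then of_nat m else 1)"
proof -
  obtain r' s' where F': "frame A B m r' s'" and rs: "r' + s' = 2 * m"
    and cases: "(r = r' + 1 \<and> s = s') \<or> (r = r' \<and> s = s' + 1)"
    using F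
  proof
    assume "frame A B m (r - 1) s"
    then show thesis using that[of "r - 1" s] n pos by simp
  next
    assume "frame A B m r (s - 1)"
    then show thesis using that[of r "s - 1"] n pos by simp
  qed
  obtain W p where W: "frame_set A B m r' s' W" and p: "p \<in> words m" "p \<notin> W"
    and bp: "\<forall>u\<in>W. bet m u p = 1" and Ap: "qf m A p = of_nat (r' + m)" and Bp: "qf m B p = of_nat m"
    by (rule frame_extend[OF F' rs])
  note fin = frame_setD(1)[OF W]
  define Q where "Q u \<longleftrightarrow> qf m A u + (if u = p then c else 0) = 1" for u
  have Qp: "Q p \<longleftrightarrow> r = r' + 1"
    using cases c Ap by (auto simp: Q_def of_nat_bit split: if_splits)
  have NW: "{u \<in> W. Q u} = {u \<in> W. qf m A u = 1}" "{u \<in> W. \<not> Q u} = {u \<in> W. qf m A u = 0}"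
    using p by (auto simp: Q_def)
  have "{u \<in> insert p W. Q u} = (if r = r' + 1 then insert p {u \<in> W. Q u} else {u \<in> W. Q u})"
    using Qp by auto
  then have cr: "card {u \<in> insert p W. Q u} = r"
    using cases p fin W unfolding NW frame_set_def by auto
  have "{u \<in> insert p W. \<not> Q u} = (if r = r' + 1 then {u \<in> W. \<not> Q u} else insert p {u \<in> W. \<not> Q u})"
    using Qp by auto
  then have cs: "card {u \<in> insert p W. \<not> Q u} = s"
    using cases p fin W unfolding NW frame_set_def by auto
  obtain v where v: "bij_betw v {1..r + s} (insert p W)"
    and Qv: "\<And>i. i \<in> {1..r + s} \<Longrightarrow> Q (v i) \<longleftrightarrow> i \<le> r"
    using split_enumeration[of "insert p W" Q r s] fin cr cs by auto
  obtain k where k: "k \<in> {1..r + s}" "v k = p"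
    using bij_betw_imp_surj_on[OF v] by (metis imageE insertI1)
  have inj: "v i = v j \<longleftrightarrow> i = j" if "i \<in> {1..r + s}" "j \<in> {1..r + s}" for i j
    using inj_on_eq_iff[OF bij_betw_imp_inj_on[OF v] that] .
  have vp: "v i = p \<longleftrightarrow> i = k" if "i \<in> {1..r + s}" for i
    using inj[OF that k(1)] k(2) by simp
  have vW: "v i \<in> W" if "i \<in> {1..r + s}" "i \<noteq> k" for i
    using bij_betwE[OF v] vp[OF that(1)] that by blast
  have "anticommuting_family (r + s) m v"
    unfolding anticommuting_family_def
  proof (intro conjI ballI impI)
    show "v i \<in> words m" if "i \<in> {1..r + s}" for i
      using k p vW[OF that] frame_setD(2)[OF W] by (cases "i = k") auto
    fix i j assume i: "i \<in> {1..r + s}" and j: "j \<in> {1..r + s}" and ij: "i \<noteq> j"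
    show "bet m (v i) (v j) = 1"
    proof (cases "i = k")
      case True
      then show ?thesis using bspec[OF bp vW[OF j]] ij k bet_commute[of m p "v j"] by simp
    next
      case False
      then show ?thesis
        using bspec[OF bp vW[OF i]] frame_setD(3)[OF W vW[OF i] vW[OF j]] ij k inj[OF i j] by (cases "j = k") auto
    qed
  qed
  moreover have "qf m A (v i) + (if i = k then c else 0) = (if i \<le> r then 1 else 0)"
    if "i \<in> {1..r + s}" for i
    using Qv[OF that] vp[OF that] by (cases "i \<le> r") (auto simp: Q_def)
  moreover have "qf m B (v i) = (if i = k then of_nat m else 1)" if "i \<in> {1..r + s}" for i
    using Bp k(2) frame_setD(4)[OF W vW[OF that]] by (cases "i = k") simp_all
  ultimately show thesis using that k(1) by blast
qed

lemma anticommuting_familyD: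
  assumes "anticommuting_family n m v"
  shows "i \<in> {1..n} \<Longrightarrow> v i \<in> words m"
    and "i \<in> {1..n} \<Longrightarrow> j \<in> {1..n} \<Longrightarrow> i \<noteq> j \<Longrightarrow> bet m (v i) (v j) = 1"
  using assms unfolding anticommuting_family_def by blast+

lemma family_qf_sum:
  assumes v: "anticommuting_family n m v" and I: "I \<subseteq> {1..n}"
  shows "qf m X (sum v I) = (\<Sum>i\<in>I. qf m X (v i)) + of_nat (card I choose 2)"
  by (rule qf_sum) (use I finite_subset[OF I] anticommuting_familyD(2)[OF v] in blast)+

lemma family_sum_words:
  "anticommuting_family n m v \<Longrightarrow> I \<subseteq> {1..n} \<Longrightarrow> sum v I \<in> words m"
  by (rule words_sum) (blast dest: anticommuting_familyD(1))

text \<open>A vanishing sum over $I$ has zero symplectic product with every $v_j$; but that product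
  is the parity of $I - \{j\}$. So all these parities vanish, which forces $I$ to be empty or
  everything.\<close>

lemma family_sum_eq_0:
  assumes v: "anticommuting_family n m v" and I: "I \<subseteq> {1..n}" and 0: "sum v I = 0"
  shows "I = {} \<or> (I = {1..n} \<and> odd n)"
proof -
  have fin: "finite I" using I finite_subset by blast
  have even: "even (card (I - {j}))" if j: "j \<in> {1..n}" for j
  proof -
    have "bet m (v j) (sum v I) = (\<Sum>i\<in>I - {j}. 1)"
      unfolding bet_sum_right
      by (rule sum.mono_neutral_cong_right) (use fin anticommuting_familyD(2)[OF v j] I in auto)
    then have "of_nat (card (I - {j})) = (0::bit)" using 0 by simp
    then show ?thesis by (simp add: of_nat_bit split: if_splits)
  qed
  show ?thesis
  proof (cases "I = {}")
    case False
    then obtain i where i: "i \<in> I" by blast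
    then have "odd (card I)" using even[of i] I fin by (cases "card I") (auto simp: card_Diff_singleton)
    then have "j \<in> I" if "j \<in> {1..n}" for j using even[OF that] by (cases "j \<in> I") auto
    then have "I = {1..n}" using I by blast
    then show ?thesis using \<open>odd (card I)\<close> by simp
  qed simp
qed

lemma sum_symdiff:
  fixes v :: "nat \<Rightarrow> pauli"
  assumes "finite I" and "finite J"
  shows "sum v I + sum v J = sum v ((I - J) \<union> (J - I))"
proof -
  have "sum v I = sum v (I - J) + sum v (I \<inter> J)"
    using sum.Int_Diff[OF assms(1), of v J] by (simp add: add.commute)
  moreover have "sum v J = sum v (J - I) + sum v (I \<inter> J)"
    using sum.Int_Diff[OF assms(2), of v I] by (simp add: add.commute Int_commute)
  moreover have "sum v ((I - J) \<union> (J - I)) = sum v (I - J) + sum v (J - I)"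
    using assms by (intro sum.union_disjoint) auto
  moreover have "a + c + (b + c) = a + b" for a b c :: pauli
  proof -
    have "a + c + (b + c) = a + b + (c + c)" by (simp only: ac_simps)
    then show ?thesis by simp
  qed
  ultimately show ?thesis by simp
qed

lemma family_sum_eq:
  assumes v: "anticommuting_family n m v" and I: "I \<subseteq> {1..n}" "J \<subseteq> {1..n}" and eq: "sum v I = sum v J"
  shows "I = J \<or> (J = {1..n} - I \<and> sum v {1..n} = 0 \<and> odd n)"
proof -
  let ?D = "(I - J) \<union> (J - I)"
  have "sum v ?D = 0" using sum_symdiff[of I J v] I eq by (auto dest: finite_subset)
  moreover from this have "?D = {} \<or> (?D = {1..n} \<and> odd n)"
    using family_sum_eq_0[OF v, of ?D] I by blast
  ultimately show ?thesis using I by auto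
qed

text \<open>Injectivity is linear independence; there are $4^m$ subsets and $4^m$ words.\<close>

lemma family_even_bij:
  assumes v: "anticommuting_family (2 * m) m v"
  shows "bij_betw (sum v) (Pow {1..2 * m}) (words m)"
proof -
  have inj: "inj_on (sum v) (Pow {1..2 * m})"
    using family_sum_eq[OF v] by (intro inj_onI) auto
  have "sum v ` Pow {1..2 * m} \<subseteq> words m" using family_sum_words[OF v] by blast
  moreover have "card (sum v ` Pow {1..2 * m}) = card (words m)"
    using card_image[OF inj] card_words[of m] by (simp add: card_Pow power_mult)
  ultimately have "sum v ` Pow {1..2 * m} = words m"
    using card_words card_subset_eq by blast
  then show ?thesis using inj by (simp add: bij_betw_def)
qed

text \<open>There are more subsets than words, so some two sums agree, and by
  \<open>family_sum_eq\<close> they can do so only for complementary subsets: the total is 0. The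
  first $2m$ members already reach all words.\<close>

lemma family_odd:
  assumes v: "anticommuting_family n m v" and n: "n = 2 * m + 1"
  shows "sum v {1..n} = 0" and "\<And>x. x \<in> words m \<Longrightarrow> \<exists>I. I \<subseteq> {1..n} \<and> sum v I = x"
proof -
  show "sum v {1..n} = 0"
  proof -
    have "card (sum v ` Pow {1..n}) \<le> card (words m)"
      using family_sum_words[OF v] card_words by (intro card_mono) auto
    also have "\<dots> < card (Pow {1..n})" using card_words[of m] by (simp add: card_Pow n power_mult)
    finally have "\<not> inj_on (sum v) (Pow {1..n})" using card_image by fastforce
    then obtain I J where "I \<subseteq> {1..n}" "J \<subseteq> {1..n}" "sum v I = sum v J" "I \<noteq> J"
      by (auto simp: inj_on_def)
    then show ?thesis using family_sum_eq[OF v] by blast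
  qed
  fix x assume "x \<in> words m"
  moreover have "anticommuting_family (2 * m) m v"
    using v unfolding anticommuting_family_def n by auto
  ultimately obtain I where "I \<subseteq> {1..2 * m}" "sum v I = x"
    using bij_betw_imp_surj_on[OF family_even_bij] by (metis (no_types, lifting) PowD imageE)
  then show "\<exists>I. I \<subseteq> {1..n} \<and> sum v I = x" using n by (intro exI[of _ I]) auto
qed

lemma family_compl:
  assumes v: "anticommuting_family n m v" and n: "n = 2 * m + 1" and I: "I \<subseteq> {1..n}"
  shows "sum v ({1..n} - I) = sum v I"
proof -
  have "sum v {1..n} + sum v I = sum v (({1..n} - I) \<union> (I - {1..n}))"
    using I by (intro sum_symdiff) (auto dest: finite_subset)
  also have "({1..n} - I) \<union> (I - {1..n}) = {1..n} - I" using I by blast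
  finally show ?thesis unfolding family_odd(1)[OF v n] add_0 ..
qed

definition lie_indices :: "nat \<Rightarrow> nat set set"
  where "lie_indices n = {I. I \<subseteq> {1..n} \<and> card I mod 4 \<in> {1, 2} \<and> \<not> (n mod 4 = 1 \<and> I = {1..n})}"

lemma bit_Suc_choose_two: "of_nat n + of_nat (n choose 2) = (1::bit) \<longleftrightarrow> n mod 4 \<in> {1, 2}"
proof -
  have "of_nat n + of_nat (n choose 2) = (of_nat (Suc n choose 2) :: bit)"
    by (simp add: numeral_2_eq_2)
  then show ?thesis using odd_Suc_choose_two[of n] by (simp add: of_nat_bit)
qed

lemma family_lie_iff:
  assumes v: "anticommuting_family n m v" and B: "\<And>i. i \<in> {1..n} \<Longrightarrow> qf m B (v i) = 1" and I: "I \<subseteq> {1..n}"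
  shows "qf m B (sum v I) = 1 \<longleftrightarrow> card I mod 4 \<in> {1, 2}"
proof -
  have "(\<Sum>i\<in>I. qf m B (v i)) = (\<Sum>i\<in>I. 1)" by (rule sum.cong) (use B I in auto)
  then show ?thesis using family_qf_sum[OF v I, of B] bit_Suc_choose_two[of "card I"] by simp
qed

text \<open>All words are sums over unique subsets, and \<open>family_lie_iff\<close> translates the
  condition on the size of a subset into the value of the quadratic form.\<close>

lemma lie_indices_even_bij:
  assumes v: "anticommuting_family n m v" and n: "n = 2 * m"
    and B: "\<And>i. i \<in> {1..n} \<Longrightarrow> qf m B (v i) = 1"
  shows "bij_betw (sum v) (lie_indices n) {x \<in> words m. qf m B x = 1}"
proof -
  have bij: "bij_betw (sum v) (Pow {1..n}) (words m)"
    using family_even_bij v n by simp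
  have "even (n mod 4)" using n by (intro dvd_mod) simp_all
  then have "n mod 4 \<noteq> 1" by auto
  then have "lie_indices n = {I \<in> Pow {1..n}. qf m B (sum v I) = 1}"
    using family_lie_iff[OF v B] by (auto simp: lie_indices_def)
  moreover have "bij_betw (sum v) {I \<in> Pow {1..n}. qf m B (sum v I) = 1} {x \<in> words m. qf m B x = 1}"
    using bij by (auto simp: bij_betw_def inj_on_def)
  ultimately show ?thesis by simp
qed

lemma mod4_compl:
  assumes "n mod 4 = 1" and "c \<le> n"
  shows "(n - c) mod 4 \<in> {1, 2} \<longleftrightarrow> c mod 4 \<notin> {1, 2::nat}"
proof -
  obtain a where a: "n = 4 * a + 1" using assms(1) by (metis div_mult_mod_eq mult.commute)
  define q where "q = c div 4"
  have c: "c = 4 * q + c mod 4" unfolding q_def by simp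
  have "c mod 4 < 4" by simp
  then consider "c mod 4 = 0" | "c mod 4 = 1" | "c mod 4 = 2" | "c mod 4 = 3" by linarith
  then show ?thesis
  proof cases
    case 1
    then have "n - c = 4 * (a - q) + 1" using a c assms(2) by simp
    then show ?thesis using 1 by simp
  next
    case 2
    then have "n - c = 4 * (a - q)" using a c assms(2) by simp
    then show ?thesis using 2 by simp
  next
    case 3
    then have "n - c = 4 * (a - q - 1) + 3" using a c assms(2) by simp
    then show ?thesis using 3 by (simp add: mod_Suc)
  next
    case 4
    then have "n - c = 4 * (a - q - 1) + 2" using a c assms(2) by simp
    then show ?thesis using 4 by (simp add: mod_Suc)
  qed
qed

text \<open>Each word is the sum over exactly two subsets, complementary to each other. For $n
  \equiv 1$ modulo 4 exactly one of two complementary sizes is 1 or 2 modulo 4, so the Lie condition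
  selects one representative of every word; the excluded full set is the one representing 0.\<close>

lemma lie_indices_nonzero_bij:
  assumes v: "anticommuting_family n m v" and n: "n = 2 * m + 1" and n4: "n mod 4 = 1"
  shows "bij_betw (sum v) (lie_indices n) (words m - {0})"
proof -
  have compl: "card ({1..n} - I) mod 4 \<in> {1, 2} \<longleftrightarrow> card I mod 4 \<notin> {1, 2}" if "I \<subseteq> {1..n}" for I
    using mod4_compl[OF n4, of "card I"] that card_mono[of "{1..n}" I] finite_subset[OF that]
    by (simp add: card_Diff_subset)
  have "inj_on (sum v) (lie_indices n)"
  proof (rule inj_onI)
    fix I J assume I: "I \<in> lie_indices n" and J: "J \<in> lie_indices n" and eq: "sum v I = sum v J"
    then have "I = J \<or> J = {1..n} - I"
      using family_sum_eq[OF v, of I J] unfolding lie_indices_def by blast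
    then show "I = J" using compl[of I] I J unfolding lie_indices_def by blast
  qed
  moreover have "sum v ` lie_indices n = words m - {0}"
  proof
    show "sum v ` lie_indices n \<subseteq> words m - {0}"
    proof
      fix x assume "x \<in> sum v ` lie_indices n"
      then obtain I where I: "I \<subseteq> {1..n}" "card I mod 4 \<in> {1, 2}" "I \<noteq> {1..n}" and x: "x = sum v I"
        using n4 unfolding lie_indices_def by blast
      have "I \<noteq> {}" using I(2) by auto
      then have "x \<noteq> 0" using family_sum_eq_0[OF v I(1)] I(3) x by auto
      then show "x \<in> words m - {0}" using family_sum_words[OF v I(1)] x by blast
    qed
    show "words m - {0} \<subseteq> sum v ` lie_indices n"
    proof
      fix x assume "x \<in> words m - {0}"
      then obtain I where I: "I \<subseteq> {1..n}" "sum v I = x" and x: "x \<noteq> 0"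
        using family_odd(2)[OF v n, of x] by blast
      have nI: "I \<noteq> {1..n}" "I \<noteq> {}" using I x family_odd(1)[OF v n] by auto
      show "x \<in> sum v ` lie_indices n"
      proof (cases "card I mod 4 \<in> {1, 2}")
        case True
        then show ?thesis using I nI unfolding lie_indices_def by blast
      next
        case False
        then have "{1..n} - I \<in> lie_indices n"
          using compl[OF I(1)] nI I(1) unfolding lie_indices_def by blast
        moreover have "sum v ({1..n} - I) = x" using family_compl[OF v n I(1)] I(2) by simp
        ultimately show ?thesis by blast
      qed
    qed
  qed
  ultimately show ?thesis by (simp add: bij_betw_def)
qed

lemma fst_sum: "fst (sum f I) = (\<Sum>i\<in>I. fst (f i))" and snd_sum: "snd (sum f I) = (\<Sum>i\<in>I. snd (f i))"
  for f :: "'a \<Rightarrow> 'b::comm_monoid_add \<times> 'c::comm_monoid_add"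
  by (induction I rule: infinite_finite_induct) simp_all

text \<open>The extra bit separates the two complementary subsets with the same word sum, because it
  takes the value 1 on the full set. Hence all pairs of a bit and a word are reached exactly once.
  The function \<open>\<kappa> * fst x + qf m B (snd x)\<close> takes the role of the quadratic
  form; $\kappa = 1$ lets it depend on the bit (unitary Lie algebras), $\kappa = 0$ does not
  (complex Lie algebras and direct sums).\<close>

lemma lie_indices_central_bij:
  fixes w :: "nat \<Rightarrow> bit \<times> pauli"
  assumes v: "anticommuting_family n m (\<lambda>i. snd (w i))" and n: "n = 2 * m + 1"
    and t: "\<And>i. i \<in> {1..n} \<Longrightarrow> \<kappa> * fst (w i) + qf m B (snd (w i)) = 1"
    and full: "(\<Sum>i = 1..n. fst (w i)) = 1"
  shows "bij_betw (sum w) (lie_indices n)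
    {x. snd x \<in> words m \<and> \<kappa> * fst x + qf m B (snd x) = 1 \<and> \<not> (n mod 4 = 1 \<and> x = (1, 0))}"
proof -
  let ?v = "\<lambda>i. snd (w i)" and ?t = "\<lambda>x. \<kappa> * fst x + qf m B (snd x)"
  have s: "snd (sum w I) = sum ?v I" for I by (rule snd_sum)
  have W: "sum w {1..n} = (1, 0)"
    using full family_odd(1)[OF v n] by (simp add: prod_eq_iff fst_sum snd_sum)
  have split: "fst (sum w {1..n}) = fst (sum w ({1..n} - I)) + fst (sum w I)" if "I \<subseteq> {1..n}" for I
    unfolding fst_add[symmetric] by (rule arg_cong[OF sum.subset_diff[OF that finite_atLeastAtMost]])
  have inj: "inj_on (sum w) (Pow {1..n})"
  proof (rule inj_onI)
    fix I J assume I: "I \<in> Pow {1..n}" and J: "J \<in> Pow {1..n}" and eq: "sum w I = sum w J"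
    then have "sum ?v I = sum ?v J" unfolding s[symmetric] by simp
    then have "I = J \<or> J = {1..n} - I" using family_sum_eq[OF v, of I J] I J by blast
    moreover have "J \<noteq> {1..n} - I"
    proof
      assume J': "J = {1..n} - I"
      have "fst (sum w {1..n}) = fst (sum w J) + fst (sum w I)"
        using split[of I] I J' by simp
      then show False using W eq by simp
    qed
    ultimately show "I = J" by blast
  qed
  have surj: "x \<in> sum w ` Pow {1..n}" if x: "snd x \<in> words m" for x
  proof -
    obtain I where I: "I \<subseteq> {1..n}" "sum ?v I = snd x" using family_odd(2)[OF v n x] by blast
    show ?thesis
    proof (cases "fst (sum w I) = fst x")
      case True
      then have "sum w I = x" using I(2) s[of I] by (simp add: prod_eq_iff)
      then show ?thesis using I(1) by blast
    next
      case False
      have "fst (sum w ({1..n} - I)) + fst (sum w I) = 1" using split[OF I(1)] W by simp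
      then have "fst (sum w ({1..n} - I)) = fst x"
        using False by (cases "fst x"; cases "fst (sum w I)") auto
      moreover have "snd (sum w ({1..n} - I)) = snd x"
        unfolding s family_compl[OF v n I(1)] by (rule I(2))
      ultimately have "sum w ({1..n} - I) = x" by (simp add: prod_eq_iff)
      then show ?thesis by blast
    qed
  qed
  have lie: "?t (sum w I) = 1 \<longleftrightarrow> card I mod 4 \<in> {1, 2}" if I: "I \<subseteq> {1..n}" for I
  proof -
    have "?t (sum w I) = (\<Sum>i\<in>I. ?t (w i)) + of_nat (card I choose 2)"
      unfolding s family_qf_sum[OF v I] fst_sum by (simp add: sum_distrib_left sum.distrib add.assoc)
    also have "(\<Sum>i\<in>I. ?t (w i)) = (\<Sum>i\<in>I. 1)" by (rule sum.cong) (use t I in auto)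
    finally show ?thesis using bit_Suc_choose_two[of "card I"] by simp
  qed
  have full_iff: "sum w I = (1, 0) \<longleftrightarrow> I = {1..n}" if "I \<subseteq> {1..n}" for I
    using inj_on_eq_iff[OF inj, of I "{1..n}"] W that by simp
  show ?thesis
    unfolding bij_betw_def
  proof (intro conjI)
    show "inj_on (sum w) (lie_indices n)"
      by (rule inj_on_subset[OF inj]) (auto simp: lie_indices_def)
    show "sum w ` lie_indices n
      = {x. snd x \<in> words m \<and> ?t x = 1 \<and> \<not> (n mod 4 = 1 \<and> x = (1, 0))}" (is "?L = ?R")
    proof
      show "?L \<subseteq> ?R"
      proof
        fix x assume "x \<in> ?L"
        then obtain I where I: "I \<in> lie_indices n" "x = sum w I" by blast
        then have I': "I \<subseteq> {1..n}" "card I mod 4 \<in> {1, 2}" "\<not> (n mod 4 = 1 \<and> I = {1..n})"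
          unfolding lie_indices_def by blast+
        have "snd x \<in> words m" unfolding I(2) s by (rule family_sum_words[OF v I'(1)])
        moreover have "?t x = 1" using lie[OF I'(1)] I'(2) I(2) by blast
        moreover have "\<not> (n mod 4 = 1 \<and> x = (1, 0))" using full_iff[OF I'(1)] I'(3) I(2) by auto
        ultimately show "x \<in> ?R" by blast
      qed
      show "?R \<subseteq> ?L"
      proof
        fix x assume x: "x \<in> ?R"
        then obtain I where I: "I \<subseteq> {1..n}" "x = sum w I" using surj[of x] by blast
        then have "I \<in> lie_indices n" using x lie[OF I(1)] full_iff[OF I(1)] unfolding lie_indices_def by blast
        then show "x \<in> ?L" using I by blast
      qed
    qed
  qed
qed

section \<open>Algebras graded up to sign\<close>

definition sgb :: "bit \<Rightarrow> 'a::ring_1"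
  where "sgb a = (if a = 1 then - 1 else 1)"

lemma sgb_simps [simp]: "sgb 0 = 1" "sgb 1 = - 1"
  by (simp_all add: sgb_def)

lemma sgb_add: "sgb (a + b) = sgb a * sgb b"
  by (cases a; cases b) (simp_all add: sgb_def)

lemma sgb_self [simp]: "sgb a * sgb a = 1"
  by (cases a) simp_all

lemma of_real_sgb: "of_real (sgb a) = sgb a"
  by (cases a) simp_all

text \<open>An algebra with a basis indexed by an abelian group in which the product of two basis
  vectors is a basis vector up to a sign with exponent $h$. For Pauli matrices, with or without
  factors $i$, all computations take place in the indices.\<close>

locale graded_alg = real_alg R sc for R (structure) and sc +
  fixes V :: "'v::comm_monoid_add set" and b :: "'v \<Rightarrow> 'a" and h :: "'v \<Rightarrow> 'v \<Rightarrow> bit"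
  assumes V_add: "x \<in> V \<Longrightarrow> y \<in> V \<Longrightarrow> x + y \<in> V"
    and V_zero: "0 \<in> V"
    and b_zero: "b 0 = \<one>"
    and b_mult: "x \<in> V \<Longrightarrow> y \<in> V \<Longrightarrow> b x \<otimes> b y = sc (sgb (h x y)) (b (x + y))"
    and nontrivial: "\<one> \<noteq> \<zero>"
    and b_indep: "indep V b"
    and b_span: "z \<in> carrier R \<Longrightarrow> \<exists>c. z = lin V b c"
begin

lemma b_V: "b \<in> V \<rightarrow> carrier R"
  using b_indep by (simp add: indep_def)

lemma b_closed: "x \<in> V \<Longrightarrow> b x \<in> carrier R"
  using b_V by blast

lemma V_sum: "w \<in> I \<rightarrow> V \<Longrightarrow> sum w I \<in> V"
  by (induction I rule: infinite_finite_induct) (auto intro: V_zero V_add)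

text \<open>The basis vectors with indices $w_i$ form a Clifford system, and the ordered product
  over $I$ is, up to sign, the basis vector with index the sum of $w$ over $I$. So only the map from
  subsets to sums has to be examined.\<close>

lemma graded_lie_iso:
  fixes L :: "'a real_lie_alg"
  assumes w: "\<And>i. i \<in> {1..r + s} \<Longrightarrow> w i \<in> V"
    and sq: "\<And>i. i \<in> {1..r + s} \<Longrightarrow> w i + w i = 0 \<and> h (w i) (w i) = (if i \<le> r then 1 else 0)"
    and anti: "\<And>i j. i \<in> {1..r + s} \<Longrightarrow> j \<in> {1..r + s} \<Longrightarrow> i \<noteq> j \<Longrightarrow> h (w i) (w j) + h (w j) (w i) = 1"
    and S: "S \<subseteq> V" and bij: "bij_betw (sum w) {I. I \<subseteq> {1..r + s} \<and> card I mod 4 \<in> {1, 2} \<and>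
      \<not> ((r + s) mod 4 = 1 \<and> I = {1..r + s})} S"
    and L: "carrier L = range (lin S b)"
      "\<And>x y. x \<in> carrier R \<Longrightarrow> y \<in> carrier R \<Longrightarrow> lie_add L x y = x \<oplus> y"
      "\<And>a x. x \<in> carrier R \<Longrightarrow> lie_scale L a x = sc a x"
      "\<And>x y. x \<in> carrier R \<Longrightarrow> y \<in> carrier R \<Longrightarrow> lie_bracket L x y = x \<otimes> y \<ominus> y \<otimes> x"
  shows "H_lie r s \<cong>\<^sub>L L"
proof -
  define E where "E i = b (w i)" for i
  have E: "clifford_rel r s E"
    unfolding clifford_rel_def
  proof (intro conjI ballI impI)
    show "E \<in> {1..r + s} \<rightarrow> carrier R"
      using w b_closed by (auto simp: E_def)
    fix i assume i: "i \<in> {1..r + s}"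
    show "E i \<otimes> E i = sc (if i \<le> r then -1 else 1) \<one>"
      unfolding E_def b_mult[OF w[OF i] w[OF i]] using sq[OF i] b_zero by (simp add: sgb_def)
    fix j assume j: "j \<in> {1..r + s}" and ij: "i \<noteq> j"
    have c: "b (w j + w i) \<in> carrier R" by (rule b_closed[OF V_add[OF w[OF j] w[OF i]]])
    have "h (w i) (w j) = h (w j) (w i) + 1"
      using anti[OF i j ij] by (cases "h (w i) (w j)"; cases "h (w j) (w i)") simp_all
    then have "sgb (h (w i) (w j)) = - (sgb (h (w j) (w i)) :: real)"
      by (simp add: sgb_add)
    then show "E i \<otimes> E j = \<ominus> (E j \<otimes> E i)"
      unfolding E_def b_mult[OF w[OF i] w[OF j]] b_mult[OF w[OF j] w[OF i]]
      using c by (simp add: add.commute[of "w i"] sc_minus_left)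
  qed
  have prod: "\<exists>a. a * a = 1 \<and> oprod E xs = sc a (b (sum w (set xs)))"
    if "distinct xs" "set xs \<subseteq> {1..r + s}" for xs
    using that
  proof (induction xs)
    case Nil
    then show ?case by (intro exI[of _ 1]) (simp add: b_zero)
  next
    case (Cons i xs)
    then obtain a where a: "a * a = 1" "oprod E xs = sc a (b (sum w (set xs)))" by auto
    have i: "w i \<in> V" and xs: "sum w (set xs) \<in> V"
      using Cons.prems by (auto intro!: w V_sum)
    have "oprod E (i # xs) = sc (a * sgb (h (w i) (sum w (set xs)))) (b (w i + sum w (set xs)))"
      using a b_closed[OF i] b_closed[OF xs] b_closed[OF V_add[OF i xs]]
      by (simp add: E_def sc_mult_right b_mult[OF i xs])
    moreover have "w i + sum w (set xs) = sum w (set (i # xs))"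
      using Cons.prems by simp
    moreover have "(a * sgb (h (w i) (sum w (set xs)))) * (a * sgb (h (w i) (sum w (set xs)))) = 1"
      using a(1) sgb_self[of "h (w i) (sum w (set xs))", where 'a = real] by (simp add: mult.assoc mult.left_commute)
    ultimately show ?case by metis
  qed
  show ?thesis
  proof (rule clifford_lie_iso[OF E nontrivial indep_subset[OF b_indep S]])
    show "bij_betw (sum w) (H_index r s) S"
      unfolding H_index_eq[OF E nontrivial] by (rule bij)
    fix I assume "I \<in> H_index r s"
    then have "I \<subseteq> {1..r + s}" by (simp add: H_index_def)
    then show "\<exists>a. a * a = 1 \<and> oprod E (sorted_list_of_set I) = sc a (b (sum w I))"
      using prod[of "sorted_list_of_set I"] finite_subset[of I] by simp
  qed (fact L)+
qed

lemma lin_restrict: "S \<subseteq> V \<Longrightarrow> range (lin S b) = {lin V b c | c. \<forall>v\<in>V - S. c v = 0}"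
proof (intro equalityI subsetI)
  fix x assume S: "S \<subseteq> V" and "x \<in> range (lin S b)"
  then obtain c where x: "x = lin S b c" by blast
  have fin: "finite V" using b_indep by (simp add: indep_def)
  have "lin V b (\<lambda>v. if v \<in> S then c v else 0) = lin S b (\<lambda>v. if v \<in> S then c v else 0)"
    by (rule lin_mono_neutral[OF fin S b_V]) simp
  also have "\<dots> = lin S b c" using S b_V by (intro lin_cong) auto
  finally show "x \<in> {lin V b c | c. \<forall>v\<in>V - S. c v = 0}"
    unfolding x by (intro CollectI exI[of _ "\<lambda>v. if v \<in> S then c v else 0"]) simp
next
  fix x assume S: "S \<subseteq> V" and "x \<in> {lin V b c | c. \<forall>v\<in>V - S. c v = 0}"
  then obtain c where "x = lin V b c" "\<forall>v\<in>V - S. c v = 0" by blast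
  moreover have fin: "finite V" using b_indep by (simp add: indep_def)
  ultimately have "x = lin S b c" using lin_mono_neutral[OF fin S b_V] by simp
  then show "x \<in> range (lin S b)" by blast
qed

end

section \<open>The product of an algebra with itself\<close>

definition prod_ring :: "('a, 'c) ring_scheme \<Rightarrow> ('a \<times> 'a) ring"
  where "prod_ring R = \<lparr> carrier = carrier R \<times> carrier R,
    mult = (\<lambda>x y. (fst x \<otimes>\<^bsub>R\<^esub> fst y, snd x \<otimes>\<^bsub>R\<^esub> snd y)), one = (\<one>\<^bsub>R\<^esub>, \<one>\<^bsub>R\<^esub>),
    zero = (\<zero>\<^bsub>R\<^esub>, \<zero>\<^bsub>R\<^esub>), add = (\<lambda>x y. (fst x \<oplus>\<^bsub>R\<^esub> fst y, snd x \<oplus>\<^bsub>R\<^esub> snd y)) \<rparr>"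

lemma prod_ring_simps:
  "carrier (prod_ring R) = carrier R \<times> carrier R"
  "x \<otimes>\<^bsub>prod_ring R\<^esub> y = (fst x \<otimes>\<^bsub>R\<^esub> fst y, snd x \<otimes>\<^bsub>R\<^esub> snd y)"
  "\<one>\<^bsub>prod_ring R\<^esub> = (\<one>\<^bsub>R\<^esub>, \<one>\<^bsub>R\<^esub>)" "\<zero>\<^bsub>prod_ring R\<^esub> = (\<zero>\<^bsub>R\<^esub>, \<zero>\<^bsub>R\<^esub>)"
  "x \<oplus>\<^bsub>prod_ring R\<^esub> y = (fst x \<oplus>\<^bsub>R\<^esub> fst y, snd x \<oplus>\<^bsub>R\<^esub> snd y)"
  by (simp_all add: prod_ring_def)

lemma (in ring) prod_ring_ring: "ring (prod_ring R)"
proof (rule ringI)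
  show "abelian_group (prod_ring R)"
  proof (rule abelian_groupI)
    fix x assume "x \<in> carrier (prod_ring R)"
    then show "\<exists>y\<in>carrier (prod_ring R). y \<oplus>\<^bsub>prod_ring R\<^esub> x = \<zero>\<^bsub>prod_ring R\<^esub>"
      by (intro bexI[of _ "(\<ominus> fst x, \<ominus> snd x)"]) (auto simp: prod_ring_simps l_neg)
  qed (auto simp: prod_ring_simps a_ac)
  show "monoid (prod_ring R)"
    by (rule monoidI) (auto simp: prod_ring_simps m_assoc)
qed (auto simp: prod_ring_simps l_distr r_distr)

definition prod_sc :: "(real \<Rightarrow> 'a \<Rightarrow> 'a) \<Rightarrow> real \<Rightarrow> 'a \<times> 'a \<Rightarrow> 'a \<times> 'a"
  where "prod_sc sc a x = (sc a (fst x), sc a (snd x))"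

lemma (in real_alg) prod_real_alg: "real_alg (prod_ring R) (prod_sc sc)"
  by (intro real_alg.intro real_alg_axioms.intro prod_ring_ring)
    (auto simp: prod_ring_simps prod_sc_def sc_add sc_add_right sc_mult_left sc_mult_right)

context real_alg
begin

interpretation P: real_alg "prod_ring R" "prod_sc sc"
  by (rule prod_real_alg)

lemma finsum_prod_ring:
  "f \<in> A \<rightarrow> carrier R \<times> carrier R \<Longrightarrow>
    finsum (prod_ring R) f A = (finsum R (\<lambda>i. fst (f i)) A, finsum R (\<lambda>i. snd (f i)) A)"
proof (induction A rule: infinite_finite_induct)
  case (infinite A)
  then show ?case by (simp add: prod_ring_simps finsum_infinite P.finsum_infinite)
next
  case empty
  then show ?case by (simp add: prod_ring_simps)
next
  case (insert x A)
  then have f: "f x \<in> carrier R \<times> carrier R" "f \<in> A \<rightarrow> carrier R \<times> carrier R" by auto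
  then have "finsum (prod_ring R) f (insert x A) = f x \<oplus>\<^bsub>prod_ring R\<^esub> finsum (prod_ring R) f A"
    using insert by (intro P.finsum_insert) (simp_all add: prod_ring_simps)
  moreover have "finsum R (\<lambda>i. fst (f i)) (insert x A) = fst (f x) \<oplus> finsum R (\<lambda>i. fst (f i)) A"
    "finsum R (\<lambda>i. snd (f i)) (insert x A) = snd (f x) \<oplus> finsum R (\<lambda>i. snd (f i)) A"
    using insert f by (intro finsum_insert; force)+
  ultimately show ?case using insert.IH[OF f(2)] by (simp add: prod_ring_simps)
qed

lemma lin_bit_Times:
  assumes fin: "finite S" and f: "f \<in> UNIV \<times> S \<rightarrow> carrier R"
  shows "lin (UNIV \<times> S) f c = lin S (\<lambda>x. f (0, x)) (\<lambda>x. c (0, x)) \<oplus> lin S (\<lambda>x. f (1::bit, x)) (\<lambda>x. c (1, x))"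
proof -
  have U: "UNIV \<times> S = Pair (0::bit) ` S \<union> Pair 1 ` S"
  proof -
    have "(a, x) \<in> Pair (0::bit) ` S \<union> Pair 1 ` S" if "x \<in> S" for a x using that by (cases a) auto
    then show ?thesis by auto
  qed
  have "lin (UNIV \<times> S) f c = lin (Pair 0 ` S) f c \<oplus> lin (Pair 1 ` S) f c"
    unfolding lin_def U
    by (rule finsum_Un_disjoint) (use fin f in \<open>auto intro!: sc_closed\<close>)
  moreover have "lin (Pair a ` S) f c = lin S (\<lambda>x. f (a, x)) (\<lambda>x. c (a, x))" for a
    using lin_reindex[of "Pair a" S f c] f by (auto simp: inj_on_def comp_def)
  ultimately show ?thesis by simp
qed

text \<open>The extra bit distinguishes $(b,b)$ from $(b,-b)$; in this basis the product of two
  copies of an algebra is again graded up to sign.\<close>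

definition double :: "('v \<Rightarrow> 'a) \<Rightarrow> bit \<times> 'v \<Rightarrow> 'a \<times> 'a"
  where "double b x = (b (snd x), sc (sgb (fst x)) (b (snd x)))"

lemma double_lin:
  assumes fin: "finite S" and b: "b \<in> S \<rightarrow> carrier R"
  shows "P.lin (UNIV \<times> S) (double b) c =
    (lin S b (\<lambda>x. c (0, x) + c (1, x)), lin S b (\<lambda>x. c (0, x) - c (1, x)))"
proof -
  have "(\<lambda>v. prod_sc sc (c v) (double b v)) \<in> UNIV \<times> S \<rightarrow> carrier R \<times> carrier R"
    using b by (auto simp: prod_sc_def double_def intro!: sc_closed)
  then have "P.lin (UNIV \<times> S) (double b) c = (lin (UNIV \<times> S) (\<lambda>x. b (snd x)) c,
      lin (UNIV \<times> S) (\<lambda>x. sc (sgb (fst x)) (b (snd x))) c)"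
    unfolding P.lin_def by (subst finsum_prod_ring) (simp_all add: lin_def prod_sc_def double_def)
  also have "lin (UNIV \<times> S) (\<lambda>x. b (snd x)) c = lin S b (\<lambda>x. c (0, x) + c (1, x))"
    using b by (subst lin_bit_Times[OF fin]) (auto simp: lin_add)
  also have "lin (UNIV \<times> S) (\<lambda>x. sc (sgb (fst x)) (b (snd x))) c
      = lin S b (\<lambda>x. c (0, x)) \<oplus> lin S (\<lambda>x. sc (-1) (b x)) (\<lambda>x. c (1, x))"
  proof -
    have "lin S (\<lambda>x. sc 1 (b x)) (\<lambda>x. c (0, x)) = lin S b (\<lambda>x. c (0, x))"
      using b by (intro lin_cong) (auto simp: funcset_mem[OF b])
    then show ?thesis using b by (subst lin_bit_Times[OF fin]) (auto intro!: sc_closed)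
  qed
  also have "lin S (\<lambda>x. sc (-1) (b x)) (\<lambda>x. c (1, x)) = lin S b (\<lambda>x. (-1) * c (1, x))"
    unfolding lin_def using b by (intro finsum_cong') (auto simp: funcset_mem[OF b])
  also have "lin S b (\<lambda>x. c (0, x)) \<oplus> lin S b (\<lambda>x. (-1) * c (1, x)) = lin S b (\<lambda>x. c (0, x) - c (1, x))"
    using lin_add[OF b, of "\<lambda>x. c (0, x)" "\<lambda>x. (-1) * c (1, x)"] by simp
  finally show ?thesis .
qed

lemma double_range:
  fixes S :: "'v set"
  assumes fin: "finite S" and b: "b \<in> S \<rightarrow> carrier R"
  shows "range (P.lin (UNIV \<times> S) (double b)) = range (lin S b) \<times> range (lin S b)"
proof
  show "range (P.lin (UNIV \<times> S) (double b)) \<subseteq> range (lin S b) \<times> range (lin S b)"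
    unfolding double_lin[OF assms, abs_def] by blast
  show "range (lin S b) \<times> range (lin S b) \<subseteq> range (P.lin (UNIV \<times> S) (double b))"
  proof clarify
    fix p q :: "'v \<Rightarrow> real"
    let ?c = "\<lambda>x :: bit \<times> 'v. (p (snd x) + sgb (fst x) * q (snd x)) / 2"
    have "lin S b (\<lambda>x. ?c (0, x) + ?c (1, x)) = lin S b p" "lin S b (\<lambda>x. ?c (0, x) - ?c (1, x)) = lin S b q"
      by (rule lin_cong[OF b]; simp add: field_simps)+
    then have "(lin S b p, lin S b q) = P.lin (UNIV \<times> S) (double b) ?c"
      unfolding double_lin[OF assms] by simp
    then show "(lin S b p, lin S b q) \<in> range (P.lin (UNIV \<times> S) (double b))"
      by (rule range_eqI[where f = "P.lin (UNIV \<times> S) (double b)" and x = ?c])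
  qed
qed

end

lemma (in graded_alg) double_graded:
  "graded_alg (prod_ring R) (prod_sc sc) (UNIV \<times> V) (double b) (\<lambda>x y. h (snd x) (snd y))"
proof -
  interpret P: real_alg "prod_ring R" "prod_sc sc" by (rule prod_real_alg)
  have fin: "finite V" using b_indep by (simp add: indep_def)
  have finB: "finite (UNIV :: bit set)"
  proof -
    have "(UNIV :: bit set) \<subseteq> {0, 1}" by (auto intro: bit.exhaust)
    then show ?thesis using finite_subset by blast
  qed
  show ?thesis
  proof (intro graded_alg.intro graded_alg_axioms.intro prod_real_alg)
    show "P.indep (UNIV \<times> V) (double b)"
      unfolding P.indep_def
    proof (intro conjI allI impI ballI)
      show "finite ((UNIV :: bit set) \<times> V)" using finB fin by simp
      show "double b \<in> UNIV \<times> V \<rightarrow> carrier (prod_ring R)"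
        using b_closed by (auto simp: double_def prod_ring_simps)
      fix c and x :: "bit \<times> 'v" assume "P.lin (UNIV \<times> V) (double b) c = \<zero>\<^bsub>prod_ring R\<^esub>" and x: "x \<in> UNIV \<times> V"
      then have "lin V b (\<lambda>x. c (0, x) + c (1, x)) = \<zero>" "lin V b (\<lambda>x. c (0, x) - c (1, x)) = \<zero>"
        unfolding double_lin[OF fin b_V] prod_ring_simps by auto
      then have "c (0, snd x) + c (1, snd x) = 0" "c (0, snd x) - c (1, snd x) = 0"
        using b_indep x unfolding indep_def by (metis mem_Times_iff)+
      then have "c (0, snd x) = 0" "c (1, snd x) = 0" by simp_all
      then show "c x = 0" by (cases x; cases "fst x") auto
    qed
    show "\<exists>c. x = P.lin (UNIV \<times> V) (double b) c" if "x \<in> carrier (prod_ring R)" for x :: "'a \<times> 'a"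
    proof -
      have "x \<in> range (lin V b) \<times> range (lin V b)"
        using that b_span by (auto simp: prod_ring_simps mem_Times_iff image_iff)
      then show ?thesis unfolding double_range[OF fin b_V, symmetric] by blast
    qed
    fix x y :: "bit \<times> 'v" assume "x \<in> UNIV \<times> V" "y \<in> UNIV \<times> V"
    then have xy: "snd x \<in> V" "snd y \<in> V" by auto
    show "x + y \<in> UNIV \<times> V" using V_add[OF xy] by (simp add: mem_Times_iff)
    show "double b x \<otimes>\<^bsub>prod_ring R\<^esub> double b y = prod_sc sc (sgb (h (snd x) (snd y))) (double b (x + y))"
      using b_closed[OF xy(1)] b_closed[OF xy(2)] b_closed[OF V_add[OF xy]]
      by (simp add: double_def prod_ring_simps prod_sc_def b_mult[OF xy] sc_mult_left sc_mult_right sgb_add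
          mult.commute mult.left_commute)
  next
    show "0 \<in> (UNIV :: bit set) \<times> V" by (simp add: mem_Times_iff V_zero)
    show "double b 0 = \<one>\<^bsub>prod_ring R\<^esub>" by (simp add: double_def prod_ring_simps b_zero)
    show "\<one>\<^bsub>prod_ring R\<^esub> \<noteq> \<zero>\<^bsub>prod_ring R\<^esub>" by (simp add: prod_ring_simps nontrivial)
  qed
qed

section \<open>Pauli matrices\<close>

definition ptl :: "pauli \<Rightarrow> pauli"
  where "ptl v = Pauli (\<lambda>j. xpart v (Suc j)) (\<lambda>j. zpart v (Suc j))"

lemma ptl_simps [simp]: "xpart (ptl v) j = xpart v (Suc j)" "zpart (ptl v) j = zpart v (Suc j)"
  by (simp_all add: ptl_def)

lemma ptl_add: "ptl (u + v) = ptl u + ptl v" and ptl_zero [simp]: "ptl 0 = 0"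
  by (simp_all add: pauli_eq_iff)

lemma gam_Suc: "gam (Suc m) u v = xpart u 0 * zpart v 0 + gam m (ptl u) (ptl v)"
  unfolding gam_def sum.lessThan_Suc_shift by simp

text \<open>The tensor product of the letters. Recursion from the outermost factor makes the
  standard forms $I_{p,p}$, $J_m$ and $K_{p,p}$, which are block matrices, words in the first one or
  two letters.\<close>

fun pmat :: "nat \<Rightarrow> pauli \<Rightarrow> 'a::comm_ring_1 mat"
  where "pmat 0 v = 1\<^sub>m 1"
  | "pmat (Suc m) v = (let P = pmat m (ptl v); Z = 0\<^sub>m (2 ^ m) (2 ^ m); Q = sgb (zpart v 0) \<cdot>\<^sub>m P in
      if xpart v 0 = 1 then four_block_mat Z P Q Z else four_block_mat P Z Z Q)"

declare pmat.simps(2) [simp del]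

lemma pmat_carrier [simp]: "pmat m v \<in> carrier_mat (2 ^ m) (2 ^ m)"
  by (induction m arbitrary: v) (simp_all add: pmat.simps(2) Let_def mult_2)

lemma pmat_dim [simp]: "dim_row (pmat m v) = 2 ^ m" "dim_col (pmat m v) = 2 ^ m"
  using pmat_carrier[of m v] by blast+

lemma pmat_entry:
  assumes "i < 2 ^ m" and "j < 2 ^ m"
  shows "pmat (Suc m) v $$ (i, j) = (if xpart v 0 = 1 then 0 else pmat m (ptl v) $$ (i, j))"
    and "pmat (Suc m) v $$ (i, j + 2 ^ m) = (if xpart v 0 = 1 then pmat m (ptl v) $$ (i, j) else 0)"
    and "pmat (Suc m) v $$ (i + 2 ^ m, j) = (if xpart v 0 = 1 then sgb (zpart v 0) * pmat m (ptl v) $$ (i, j) else 0)"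
    and "pmat (Suc m) v $$ (i + 2 ^ m, j + 2 ^ m) = (if xpart v 0 = 1 then 0 else sgb (zpart v 0) * pmat m (ptl v) $$ (i, j))"
  using assms by (simp_all add: pmat.simps(2) Let_def)

lemma one_smult_mat [simp]: "1 \<cdot>\<^sub>m A = (A :: 'a::comm_ring_1 mat)"
  by (rule eq_matI) auto

lemma bit_cases: "a = 0 \<or> a = (1::bit)"
  by (cases a) simp_all

lemma pmat_zero: "pmat m 0 = 1\<^sub>m (2 ^ m)"
proof (induction m)
  case (Suc m)
  have "four_block_mat (1\<^sub>m N) (0\<^sub>m N N) (0\<^sub>m N N) (1\<^sub>m N) = (1\<^sub>m (N + N) :: 'a mat)" for N
    by (rule eq_matI) auto
  then show ?case using Suc by (simp add: pmat.simps(2) Let_def mult_2)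
qed simp

lemma smult_four_block:
  assumes "A \<in> carrier_mat N N" "B \<in> carrier_mat N N" "C \<in> carrier_mat N N" "D \<in> carrier_mat N N"
  shows "k \<cdot>\<^sub>m four_block_mat A B C D = four_block_mat (k \<cdot>\<^sub>m A) (k \<cdot>\<^sub>m B) (k \<cdot>\<^sub>m C) (k \<cdot>\<^sub>m D)"
  using assms by (intro eq_matI) auto

lemma pmat_mult: "pmat m u * pmat m v = sgb (gam m u v) \<cdot>\<^sub>m (pmat m (u + v) :: 'a::comm_ring_1 mat)"
proof (induction m arbitrary: u v)
  case 0
  then show ?case by (simp add: gam_def)
next
  case (Suc m)
  let ?N = "2 ^ m :: nat"
  let ?P = "pmat m (ptl u) :: 'a mat" and ?Q = "pmat m (ptl v) :: 'a mat"
  let ?R = "pmat m (ptl u + ptl v) :: 'a mat"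
  have c: "?P \<in> carrier_mat ?N ?N" "?Q \<in> carrier_mat ?N ?N" "?R \<in> carrier_mat ?N ?N" by simp_all
  have PQ: "?P * ?Q = sgb (gam m (ptl u) (ptl v)) \<cdot>\<^sub>m ?R" by (rule Suc)
  have Q1: "(a \<cdot>\<^sub>m ?P) * ?Q = a \<cdot>\<^sub>m (?P * ?Q)" "?P * (a \<cdot>\<^sub>m ?Q) = a \<cdot>\<^sub>m (?P * ?Q)"
    "(a \<cdot>\<^sub>m ?P) * (a' \<cdot>\<^sub>m ?Q) = (a * a') \<cdot>\<^sub>m (?P * ?Q)" for a a'
    using c by (auto simp: mult_smult_distrib mult_smult_assoc_mat)
  have z: "?P * 0\<^sub>m ?N ?N = 0\<^sub>m ?N ?N" "0\<^sub>m ?N ?N * ?Q = 0\<^sub>m ?N ?N"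
    "(a \<cdot>\<^sub>m ?P) * 0\<^sub>m ?N ?N = 0\<^sub>m ?N ?N" "0\<^sub>m ?N ?N * (a \<cdot>\<^sub>m ?Q) = 0\<^sub>m ?N ?N"
    "0\<^sub>m ?N ?N * (0\<^sub>m ?N ?N :: 'a mat) = 0\<^sub>m ?N ?N" for a
    using c by auto
  have zz: "a \<cdot>\<^sub>m (0\<^sub>m ?N ?N :: 'a mat) = 0\<^sub>m ?N ?N" for a by (rule eq_matI) auto
  have ss: "a \<cdot>\<^sub>m (a' \<cdot>\<^sub>m ?R) = (a * a') \<cdot>\<^sub>m ?R" for a a' by (rule eq_matI) (auto simp: mult.assoc)
  have mb: "four_block_mat A1 B1 C1 D1 * four_block_mat A2 B2 C2 D2 =
      four_block_mat (A1 * A2 + B1 * C2) (A1 * B2 + B1 * D2) (C1 * A2 + D1 * C2) (C1 * B2 + D1 * D2)"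
    if "A1 \<in> carrier_mat ?N ?N" "B1 \<in> carrier_mat ?N ?N" "C1 \<in> carrier_mat ?N ?N" "D1 \<in> carrier_mat ?N ?N"
      "A2 \<in> carrier_mat ?N ?N" "B2 \<in> carrier_mat ?N ?N" "C2 \<in> carrier_mat ?N ?N" "D2 \<in> carrier_mat ?N ?N"
    for A1 B1 C1 D1 A2 B2 C2 D2 :: "'a mat"
    by (rule mult_four_block_mat[OF that])
  have xu: "xpart u 0 = 0 \<or> xpart u 0 = 1" and xv: "xpart v 0 = 0 \<or> xpart v 0 = 1" by (rule bit_cases)+
  have zu: "zpart u 0 = 0 \<or> zpart u 0 = 1" and zv: "zpart v 0 = 0 \<or> zpart v 0 = 1" by (rule bit_cases)+
  show ?case
    using xu xv zu zv
    by (elim disjE; simp add: pmat.simps(2) Let_def gam_Suc ptl_add mb smult_four_block[of _ ?N] Q1 z zz ss PQ sgb_add)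
qed

lemma transpose_smult: "transpose_mat (k \<cdot>\<^sub>m A) = k \<cdot>\<^sub>m transpose_mat A"
  by (rule eq_matI) auto

lemma pmat_transpose: "transpose_mat (pmat m v) = sgb (gam m v v) \<cdot>\<^sub>m (pmat m v :: 'a::comm_ring_1 mat)"
proof (induction m arbitrary: v)
  case 0
  then show ?case by (simp add: gam_def transpose_one)
next
  case (Suc m)
  let ?N = "2 ^ m :: nat"
  let ?P = "pmat m (ptl v) :: 'a mat"
  have c: "?P \<in> carrier_mat ?N ?N" "transpose_mat ?P \<in> carrier_mat ?N ?N" by simp_all
  have zz: "a \<cdot>\<^sub>m (0\<^sub>m ?N ?N :: 'a mat) = 0\<^sub>m ?N ?N" for a by (rule eq_matI) auto
  have ss: "a \<cdot>\<^sub>m (a' \<cdot>\<^sub>m ?P) = (a * a') \<cdot>\<^sub>m ?P" for a a' by (rule eq_matI) (auto simp: mult.assoc)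
  have tb: "transpose_mat (four_block_mat A B C D) = four_block_mat (transpose_mat A) (transpose_mat C) (transpose_mat B) (transpose_mat D)"
    if "A \<in> carrier_mat ?N ?N" "B \<in> carrier_mat ?N ?N" "C \<in> carrier_mat ?N ?N" "D \<in> carrier_mat ?N ?N" for A B C D :: "'a mat"
    by (rule transpose_four_block_mat[OF that])
  have xv: "xpart v 0 = 0 \<or> xpart v 0 = 1" and zv: "zpart v 0 = 0 \<or> zpart v 0 = 1" by (rule bit_cases)+
  show ?case
    using xv zv
    by (elim disjE; simp add: pmat.simps(2) Let_def gam_Suc tb smult_four_block[of _ ?N] transpose_smult zz ss Suc sgb_add)
qed

lemma mat_trace_four_block:
  assumes "A \<in> carrier_mat N N" "B \<in> carrier_mat N N" "C \<in> carrier_mat N N" "D \<in> carrier_mat N N"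
  shows "mat_trace (four_block_mat A B C D) = mat_trace A + mat_trace D"
  using assms by (simp add: mat_trace_def sum_lessThan_add)

lemma mat_trace_smult: "A \<in> carrier_mat N N \<Longrightarrow> mat_trace (k \<cdot>\<^sub>m A) = k * (mat_trace A :: 'a::comm_ring_1)"
  by (auto simp: mat_trace_def sum_distrib_left intro!: sum.cong)

lemma mat_trace_zero [simp]: "mat_trace (0\<^sub>m N N) = 0"
  by (simp add: mat_trace_def)

lemma pmat_trace:
  "v \<in> words m \<Longrightarrow> mat_trace (pmat m v :: 'a::comm_ring_1 mat) = (if v = 0 then 2 ^ m else 0)"
proof (induction m arbitrary: v)
  case 0
  then have "v = 0" by (simp add: words_def pauli_eq_iff)
  then show ?case by (simp add: mat_trace_def)
next
  case (Suc m)
  let ?N = "2 ^ m :: nat"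
  let ?P = "pmat m (ptl v) :: 'a mat"
  have p: "ptl v \<in> words m" using Suc.prems by (simp add: words_def)
  have c: "?P \<in> carrier_mat ?N ?N" by simp
  have tr: "mat_trace (pmat (Suc m) v :: 'a mat) = (if xpart v 0 = 1 then 0 else (1 + sgb (zpart v 0)) * mat_trace ?P)"
    by (simp add: pmat.simps(2) Let_def mat_trace_four_block[of _ ?N] mat_trace_smult[OF c] ring_distribs)
  have v0: "v = 0 \<longleftrightarrow> ptl v = 0 \<and> xpart v 0 = 0 \<and> zpart v 0 = 0"
    unfolding pauli_eq_iff ptl_simps part_zero by (metis not0_implies_Suc)
  have xv: "xpart v 0 = 0 \<or> xpart v 0 = 1" and zv: "zpart v 0 = 0 \<or> zpart v 0 = 1" by (rule bit_cases)+
  show ?case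
    unfolding tr Suc.IH[OF p] v0 using xv zv by (elim disjE; simp)
qed

definition pcons :: "bit \<Rightarrow> bit \<Rightarrow> pauli \<Rightarrow> pauli"
  where "pcons a c v = Pauli (case_nat a (xpart v)) (case_nat c (zpart v))"

lemma pcons_simps [simp]: "ptl (pcons a c v) = v" "xpart (pcons a c v) 0 = a" "zpart (pcons a c v) 0 = c"
  by (simp_all add: pcons_def pauli_eq_iff)

lemma pcons_ptl: "pcons (xpart v 0) (zpart v 0) (ptl v) = v"
  by (simp add: pcons_def pauli_eq_iff split: nat.split)

lemma sum_words_Suc:
  "sum f (words (Suc m)) = (\<Sum>v\<in>words m. f (pcons 0 0 v) + f (pcons 0 1 v) + f (pcons 1 0 v) + f (pcons 1 1 v))"
proof -
  let ?L = "{(0, 0), (0, 1), (1, 0), (1, 1 :: bit)} :: (bit \<times> bit) set"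
  have "bij_betw (\<lambda>(l, v). pcons (fst l) (snd l) v) (?L \<times> words m) (words (Suc m))"
  proof (rule bij_betw_byWitness[where f' = "\<lambda>v. ((xpart v 0, zpart v 0), ptl v)"])
    show "(\<lambda>v. ((xpart v 0, zpart v 0), ptl v)) ` words (Suc m) \<subseteq> ?L \<times> words m"
    proof
      fix x assume "x \<in> (\<lambda>v. ((xpart v 0, zpart v 0), ptl v)) ` words (Suc m)"
      then obtain v where v: "v \<in> words (Suc m)" "x = ((xpart v 0, zpart v 0), ptl v)" by blast
      then have "ptl v \<in> words m" by (simp add: words_def)
      then show "x \<in> ?L \<times> words m"
        using v(2) by (cases "xpart v 0"; cases "zpart v 0") auto
    qed
    show "(\<lambda>(l, v). pcons (fst l) (snd l) v) ` (?L \<times> words m) \<subseteq> words (Suc m)"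
      by (auto simp: words_def pcons_def split: nat.split)
  qed (auto simp: pcons_ptl)
  from sum.reindex_bij_betw[OF this, of f, symmetric]
  have "sum f (words (Suc m)) = (\<Sum>(l, v)\<in>?L \<times> words m. f (pcons (fst l) (snd l) v))"
    by (simp add: case_prod_beta)
  also have "\<dots> = (\<Sum>v\<in>words m. \<Sum>l\<in>?L. f (pcons (fst l) (snd l) v))"
    by (subst sum.cartesian_product[symmetric]) (rule sum.swap)
  finally show ?thesis by (simp add: add.assoc)
qed

definition pcomb :: "nat \<Rightarrow> (pauli \<Rightarrow> 'a) \<Rightarrow> nat \<times> nat \<Rightarrow> 'a::comm_ring_1"
  where "pcomb m c ij = (\<Sum>v\<in>words m. c v * pmat m v $$ ij)"

lemma pcomb_Suc:
  assumes "i < 2 ^ m" and "j < 2 ^ m"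
  shows "pcomb (Suc m) c (i, j) = pcomb m (\<lambda>v. c (pcons 0 0 v) + c (pcons 0 1 v)) (i, j)"
    and "pcomb (Suc m) c (i, j + 2 ^ m) = pcomb m (\<lambda>v. c (pcons 1 0 v) + c (pcons 1 1 v)) (i, j)"
    and "pcomb (Suc m) c (i + 2 ^ m, j) = pcomb m (\<lambda>v. c (pcons 1 0 v) - c (pcons 1 1 v)) (i, j)"
    and "pcomb (Suc m) c (i + 2 ^ m, j + 2 ^ m) = pcomb m (\<lambda>v. c (pcons 0 0 v) - c (pcons 0 1 v)) (i, j)"
  unfolding pcomb_def sum_words_Suc pmat_entry[OF assms] by (simp_all add: ring_distribs)

text \<open>The four $2 \times 2$ letters span all $2 \times 2$ matrices: block by block, one takes
  half the sum and half the difference of the diagonal blocks and of the off-diagonal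
  blocks.\<close>

lemma pcomb_span:
  fixes X :: "nat \<times> nat \<Rightarrow> 'a::field_char_0"
  shows "\<exists>c. \<forall>i<2 ^ m. \<forall>j<2 ^ m. X (i, j) = pcomb m c (i, j)"
proof (induction m arbitrary: X)
  case 0
  have "words 0 = {0}" by (auto simp: words_def pauli_eq_iff)
  then show ?case by (intro exI[of _ "\<lambda>_. X (0, 0)"]) (simp add: pcomb_def)
next
  case (Suc m)
  let ?N = "2 ^ m :: nat"
  let ?A = "\<lambda>ij. X ij" and ?B = "\<lambda>ij. X (fst ij, snd ij + ?N)" and ?C = "\<lambda>ij. X (fst ij + ?N, snd ij)"
    and ?D = "\<lambda>ij. X (fst ij + ?N, snd ij + ?N)"
  obtain a where a: "\<forall>i<?N. \<forall>j<?N. (?A (i, j) + ?D (i, j)) / 2 = pcomb m a (i, j)" using Suc[of "\<lambda>ij. (?A ij + ?D ij) / 2"] by blast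
  obtain d where d: "\<forall>i<?N. \<forall>j<?N. (?A (i, j) - ?D (i, j)) / 2 = pcomb m d (i, j)" using Suc[of "\<lambda>ij. (?A ij - ?D ij) / 2"] by blast
  obtain b where b: "\<forall>i<?N. \<forall>j<?N. (?B (i, j) + ?C (i, j)) / 2 = pcomb m b (i, j)" using Suc[of "\<lambda>ij. (?B ij + ?C ij) / 2"] by blast
  obtain e where e: "\<forall>i<?N. \<forall>j<?N. (?B (i, j) - ?C (i, j)) / 2 = pcomb m e (i, j)" using Suc[of "\<lambda>ij. (?B ij - ?C ij) / 2"] by blast
  define c where "c v = (if xpart v 0 = 1 then (if zpart v 0 = 1 then e else b) else (if zpart v 0 = 1 then d else a)) (ptl v)" for v
  have add: "pcomb m (\<lambda>v. f v + g v) ij = pcomb m f ij + pcomb m g ij"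
    and sub: "pcomb m (\<lambda>v. f v - g v) ij = pcomb m f ij - pcomb m g ij" for f g :: "pauli \<Rightarrow> 'a" and ij
    by (simp_all add: pcomb_def ring_distribs sum.distrib sum_subtractf)
  have half: "(x + y) / 2 + (x - y) / 2 = x" "(x + y) / 2 - (x - y) / 2 = y" for x y :: 'a
    by (simp_all add: field_simps)
  have parts: "pcomb (Suc m) c (i, j) = pcomb m a (i, j) + pcomb m d (i, j)"
    "pcomb (Suc m) c (i, j + ?N) = pcomb m b (i, j) + pcomb m e (i, j)"
    "pcomb (Suc m) c (i + ?N, j) = pcomb m b (i, j) - pcomb m e (i, j)"
    "pcomb (Suc m) c (i + ?N, j + ?N) = pcomb m a (i, j) - pcomb m d (i, j)"
    if "i < ?N" "j < ?N" for i j
    by (simp_all add: pcomb_Suc[OF that] c_def add sub)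
  have blocks: "X (i, j) = pcomb (Suc m) c (i, j)" "X (i, j + ?N) = pcomb (Suc m) c (i, j + ?N)"
    "X (i + ?N, j) = pcomb (Suc m) c (i + ?N, j)" "X (i + ?N, j + ?N) = pcomb (Suc m) c (i + ?N, j + ?N)"
    if "i < ?N" "j < ?N" for i j
    unfolding parts[OF that] a[rule_format, OF that, symmetric] b[rule_format, OF that, symmetric]
      d[rule_format, OF that, symmetric] e[rule_format, OF that, symmetric] fst_conv snd_conv half
    by (rule refl)+
  show ?case
  proof (intro exI[of _ c] allI impI)
    fix i j :: nat assume i: "i < 2 ^ Suc m" and j: "j < 2 ^ Suc m"
    have lt: "k - ?N < ?N" "k - ?N + ?N = k" if "\<not> k < ?N" "k < 2 ^ Suc m" for k :: nat using that by simp_all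
    show "X (i, j) = pcomb (Suc m) c (i, j)"
    proof (cases "i < ?N")
      case True
      then show ?thesis
        using blocks(1)[of i j] blocks(2)[of i "j - ?N"] lt[of j] j by (cases "j < ?N") simp_all
    next
      case False
      then show ?thesis
        using blocks(3)[of "i - ?N" j] blocks(4)[of "i - ?N" "j - ?N"] lt[of i] lt[of j] i j
        by (cases "j < ?N") simp_all
    qed
  qed
qed

lemma pcomb_indep:
  fixes c :: "pauli \<Rightarrow> 'a::field_char_0"
  shows "\<forall>i<2 ^ m. \<forall>j<2 ^ m. pcomb m c (i, j) = 0 \<Longrightarrow> v \<in> words m \<Longrightarrow> c v = 0"
proof (induction m arbitrary: c v)
  case 0
  have "words 0 = {0}" by (auto simp: words_def pauli_eq_iff)
  then show ?case using 0 by (simp add: pcomb_def)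
next
  case (Suc m)
  let ?N = "2 ^ m :: nat"
  have z: "pcomb (Suc m) c (i, j) = 0" "pcomb (Suc m) c (i, j + ?N) = 0" "pcomb (Suc m) c (i + ?N, j) = 0"
    "pcomb (Suc m) c (i + ?N, j + ?N) = 0" if "i < ?N" "j < ?N" for i j
    using Suc.prems(1) that by simp_all
  have p: "ptl v \<in> words m" using Suc.prems(2) by (simp add: words_def)
  let ?c = "\<lambda>a b. c (pcons a b (ptl v))"
  have "?c 0 0 + ?c 0 1 = 0"
    by (rule Suc.IH[of "\<lambda>v. c (pcons 0 0 v) + c (pcons 0 1 v)", OF _ p]) (use z(1) pcomb_Suc(1) in metis)
  moreover have "?c 0 0 - ?c 0 1 = 0"
    by (rule Suc.IH[of "\<lambda>v. c (pcons 0 0 v) - c (pcons 0 1 v)", OF _ p]) (use z(4) pcomb_Suc(4) in metis)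
  moreover have "?c 1 0 + ?c 1 1 = 0"
    by (rule Suc.IH[of "\<lambda>v. c (pcons 1 0 v) + c (pcons 1 1 v)", OF _ p]) (use z(2) pcomb_Suc(2) in metis)
  moreover have "?c 1 0 - ?c 1 1 = 0"
    by (rule Suc.IH[of "\<lambda>v. c (pcons 1 0 v) - c (pcons 1 1 v)", OF _ p]) (use z(3) pcomb_Suc(3) in metis)
  ultimately have "?c 0 0 = 0 \<and> ?c 0 1 = 0 \<and> ?c 1 0 = 0 \<and> ?c 1 1 = 0" by auto
  moreover have "v = pcons (xpart v 0) (zpart v 0) (ptl v)" by (simp add: pcons_ptl)
  ultimately show ?case
    by (cases "xpart v 0"; cases "zpart v 0") metis+
qed

section \<open>Matrix algebras as graded algebras\<close>

lemma smult_smult: "a \<cdot>\<^sub>m (b \<cdot>\<^sub>m A) = (a * b :: 'a::comm_ring_1) \<cdot>\<^sub>m A"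
  by (rule eq_matI) (auto simp: mult.assoc)

lemma msc_entry: "i < n \<Longrightarrow> j < n \<Longrightarrow> X \<in> carrier_mat n n \<Longrightarrow> (a \<cdot>\<^sub>m X) $$ (i, j) = a * X $$ (i, j)"
  by auto

lemma mat_real_alg: "real_alg (ring_mat TYPE('a::real_field) n ()) (\<lambda>a X. of_real a \<cdot>\<^sub>m X)"
proof (intro real_alg.intro real_alg_axioms.intro ring_mat, unfold ring_mat_simps)
  fix x y :: "'a mat" and a b :: real
  assume x: "x \<in> carrier_mat n n"
  show "of_real a \<cdot>\<^sub>m x \<in> carrier_mat n n" using x by simp
  show "of_real (a + b) \<cdot>\<^sub>m x = of_real a \<cdot>\<^sub>m x + of_real b \<cdot>\<^sub>m x"
    unfolding of_real_add by (rule add_smult_distrib_right_mat[OF x])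
  show "of_real a \<cdot>\<^sub>m (of_real b \<cdot>\<^sub>m x) = of_real (a * b) \<cdot>\<^sub>m x"
    by (simp add: smult_smult)
  show "of_real 1 \<cdot>\<^sub>m x = x" by simp
  assume y: "y \<in> carrier_mat n n"
  show "of_real a \<cdot>\<^sub>m (x + y) = of_real a \<cdot>\<^sub>m x + of_real a \<cdot>\<^sub>m y"
    by (rule add_smult_distrib_left_mat[OF x y])
  show "of_real a \<cdot>\<^sub>m x * y = of_real a \<cdot>\<^sub>m (x * y)" by (rule mult_smult_assoc_mat[OF x y])
  show "x * (of_real a \<cdot>\<^sub>m y) = of_real a \<cdot>\<^sub>m (x * y)" by (rule mult_smult_distrib[OF x y])
qed

abbreviation msc :: "real \<Rightarrow> 'a::real_field mat \<Rightarrow> 'a mat"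
  where "msc \<equiv> \<lambda>a X. of_real a \<cdot>\<^sub>m X"

lemma ring_mat_minus:
  assumes "X \<in> carrier_mat n n" and "Y \<in> carrier_mat n n"
  shows "X \<ominus>\<^bsub>ring_mat TYPE('a::real_field) n ()\<^esub> Y = X - Y"
proof -
  interpret ring "ring_mat TYPE('a) n ()" by (rule ring_mat)
  have "- Y \<oplus>\<^bsub>ring_mat TYPE('a) n ()\<^esub> Y = \<zero>\<^bsub>ring_mat TYPE('a) n ()\<^esub>"
    using assms by (simp add: ring_mat_simps uminus_l_inv_mat)
  then have "\<ominus>\<^bsub>ring_mat TYPE('a) n ()\<^esub> Y = - Y"
    using assms by (intro minus_equality) (auto simp: ring_mat_simps)
  then show ?thesis using assms by (simp add: a_minus_def ring_mat_simps minus_add_uminus_mat)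
qed

lemma finsum_mat_entry:
  assumes "f \<in> A \<rightarrow> carrier_mat n n" and "i < n" and "j < n"
  shows "finsum (ring_mat TYPE('a::real_field) n ()) f A $$ (i, j) = (\<Sum>x\<in>A. f x $$ (i, j))"
  using assms(1)
proof (induction A rule: infinite_finite_induct)
  interpret ring "ring_mat TYPE('a) n ()" by (rule ring_mat)
  {
    case (infinite A)
    then show ?case using assms by (simp add: finsum_infinite ring_mat_simps)
  next
    case empty
    then show ?case using assms by (simp add: ring_mat_simps)
  next
    case (insert x A)
    then have f: "f x \<in> carrier_mat n n" "f \<in> A \<rightarrow> carrier_mat n n" by auto
    have "finsum (ring_mat TYPE('a) n ()) f A \<in> carrier_mat n n"
      using finsum_closed[of f A] f by (simp add: ring_mat_simps)
    moreover have "finsum (ring_mat TYPE('a) n ()) f (insert x A)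
        = f x + finsum (ring_mat TYPE('a) n ()) f A"
      using finsum_insert[of A x f] insert f by (simp add: ring_mat_simps)
    ultimately show ?case using insert f assms(2,3) by simp
  }
qed

text \<open>The basis over the reals: for complex matrices $\iota$ is the imaginary unit and the bit
  records its presence. For real matrices the bit is always 0.\<close>

definition bmat :: "'a::real_field \<Rightarrow> nat \<Rightarrow> bit \<times> pauli \<Rightarrow> 'a mat"
  where "bmat \<iota> m x = (if fst x = 1 then \<iota> else 1) \<cdot>\<^sub>m pmat m (snd x)"

text \<open>The product of the bits accounts for $i \cdot i = -1$.\<close>

definition hmat :: "nat \<Rightarrow> bit \<times> pauli \<Rightarrow> bit \<times> pauli \<Rightarrow> bit"
  where "hmat m x y = fst x * fst y + gam m (snd x) (snd y)"

lemma bmat_carrier [simp]: "bmat \<iota> m x \<in> carrier_mat (2 ^ m) (2 ^ m)"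
  by (simp add: bmat_def)

lemma smult_pmat_mult: "(a \<cdot>\<^sub>m pmat m u) * (a' \<cdot>\<^sub>m pmat m v) = (a * a' * sgb (gam m u v)) \<cdot>\<^sub>m pmat m (u + v)"
proof -
  have c: "a' \<cdot>\<^sub>m pmat m v \<in> carrier_mat (2 ^ m) (2 ^ m)" by simp
  show ?thesis
    unfolding mult_smult_assoc_mat[OF pmat_carrier c] mult_smult_distrib[OF pmat_carrier pmat_carrier]
      smult_smult pmat_mult by (simp add: mult.assoc)
qed

lemma bmat_mult:
  assumes "\<iota> * \<iota> = - 1 \<or> (fst x = 0 \<and> fst y = 0)"
  shows "bmat \<iota> m x * bmat \<iota> m y = sgb (hmat m x y) \<cdot>\<^sub>m bmat \<iota> m (x + y)"
proof -
  have "fst x = 0 \<or> fst x = 1" "fst y = 0 \<or> fst y = 1" by (rule bit_cases)+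
  then show ?thesis
    using assms unfolding bmat_def smult_pmat_mult hmat_def fst_add snd_add
    by (elim disjE; simp add: smult_smult sgb_add mult.commute)
qed

lemma lin_bmat_entry:
  fixes \<iota> :: "'a::real_field"
  assumes "i < 2 ^ m" and "j < 2 ^ m"
  shows "real_alg.lin (ring_mat TYPE('a) (2 ^ m) ()) msc V (bmat \<iota> m) c $$ (i, j)
    = (\<Sum>x\<in>V. of_real (c x) * bmat \<iota> m x $$ (i, j))"
proof -
  interpret real_alg "ring_mat TYPE('a) (2 ^ m) ()" msc by (rule mat_real_alg)
  show ?thesis
    unfolding lin_def
    by (subst finsum_mat_entry) (use assms in \<open>auto simp: msc_entry[OF _ _ bmat_carrier]\<close>)
qed

lemma lin_bmat_carrier:
  "real_alg.lin (ring_mat TYPE('a::real_field) (2 ^ m) ()) msc V (bmat \<iota> m) c \<in> carrier_mat (2 ^ m) (2 ^ m)"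
proof -
  interpret real_alg "ring_mat TYPE('a) (2 ^ m) ()" msc by (rule mat_real_alg)
  show ?thesis using lin_closed[of "bmat \<iota> m" V c] by (simp add: ring_mat_simps)
qed

lemma one_mat_nonzero: "\<one>\<^bsub>ring_mat TYPE('a::real_field) (2 ^ m) ()\<^esub> \<noteq> \<zero>\<^bsub>ring_mat TYPE('a) (2 ^ m) ()\<^esub>"
proof
  assume "\<one>\<^bsub>ring_mat TYPE('a) (2 ^ m) ()\<^esub> = \<zero>\<^bsub>ring_mat TYPE('a) (2 ^ m) ()\<^esub>"
  then have "(1\<^sub>m (2 ^ m) :: 'a mat) $$ (0, 0) = 0\<^sub>m (2 ^ m) (2 ^ m) $$ (0, 0)"
    by (simp add: ring_mat_simps)
  then show False by simp
qed

lemma graded_mat: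
  fixes \<iota> :: "'a::real_field"
  assumes V: "finite V" "0 \<in> V" "\<And>x y. x \<in> V \<Longrightarrow> y \<in> V \<Longrightarrow> x + y \<in> V"
    and \<iota>: "\<iota> * \<iota> = - 1 \<or> (\<forall>x\<in>V. fst x = 0)"
    and pc: "\<And>c. \<exists>d. (\<forall>i<2 ^ m. \<forall>j<2 ^ m. (\<Sum>x\<in>V. of_real (c x) * bmat \<iota> m x $$ (i, j)) = pcomb m d (i, j))
      \<and> ((\<forall>v\<in>words m. d v = 0) \<longrightarrow> (\<forall>x\<in>V. c x = 0))"
    and sp: "\<And>d :: pauli \<Rightarrow> 'a. \<exists>c. \<forall>i<2 ^ m. \<forall>j<2 ^ m. pcomb m d (i, j) = (\<Sum>x\<in>V. of_real (c x) * bmat \<iota> m x $$ (i, j))"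
  shows "graded_alg (ring_mat TYPE('a) (2 ^ m) ()) msc V (bmat \<iota> m) (hmat m)"
proof -
  interpret real_alg "ring_mat TYPE('a) (2 ^ m) ()" msc by (rule mat_real_alg)
  show ?thesis
  proof (intro graded_alg.intro graded_alg_axioms.intro mat_real_alg one_mat_nonzero V)
    show "bmat \<iota> m 0 = \<one>\<^bsub>ring_mat TYPE('a) (2 ^ m) ()\<^esub>"
      by (simp add: bmat_def pmat_zero ring_mat_simps)
    show "bmat \<iota> m x \<otimes>\<^bsub>ring_mat TYPE('a) (2 ^ m) ()\<^esub> bmat \<iota> m y
        = of_real (sgb (hmat m x y)) \<cdot>\<^sub>m bmat \<iota> m (x + y)" if "x \<in> V" "y \<in> V" for x y
      using bmat_mult[of \<iota> x y m] \<iota> that by (auto simp: ring_mat_simps of_real_sgb)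
    show "indep V (bmat \<iota> m)"
      unfolding indep_def
    proof (intro conjI allI impI ballI)
      show "bmat \<iota> m \<in> V \<rightarrow> carrier (ring_mat TYPE('a) (2 ^ m) ())" by (simp add: ring_mat_simps)
      fix c x assume z: "lin V (bmat \<iota> m) c = \<zero>\<^bsub>ring_mat TYPE('a) (2 ^ m) ()\<^esub>" and x: "x \<in> V"
      obtain d where d: "\<forall>i<2 ^ m. \<forall>j<2 ^ m. (\<Sum>x\<in>V. of_real (c x) * bmat \<iota> m x $$ (i, j)) = pcomb m d (i, j)"
        and d0: "(\<forall>v\<in>words m. d v = 0) \<longrightarrow> (\<forall>x\<in>V. c x = 0)" using pc[of c] by blast
      have "pcomb m d (i, j) = 0" if "i < 2 ^ m" "j < 2 ^ m" for i j
        unfolding d[rule_format, OF that, symmetric] lin_bmat_entry[OF that, symmetric] z using that by (simp add: ring_mat_simps)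
      then have "\<forall>v\<in>words m. d v = 0" using pcomb_indep by blast
      then show "c x = 0" using d0 x by blast
    qed (fact V)
    fix X :: "'a mat" assume "X \<in> carrier (ring_mat TYPE('a) (2 ^ m) ())"
    then have X: "X \<in> carrier_mat (2 ^ m) (2 ^ m)" by (simp add: ring_mat_simps)
    obtain d where d: "\<forall>i<2 ^ m. \<forall>j<2 ^ m. X $$ (i, j) = pcomb m d (i, j)"
      using pcomb_span[of m "\<lambda>ij. X $$ ij"] by blast
    obtain c where c: "\<forall>i<2 ^ m. \<forall>j<2 ^ m. pcomb m d (i, j) = (\<Sum>x\<in>V. of_real (c x) * bmat \<iota> m x $$ (i, j))"
      using sp by blast
    have "X = lin V (bmat \<iota> m) c"
    proof (rule eq_matI)
      show "dim_row X = dim_row (lin V (bmat \<iota> m) c)" "dim_col X = dim_col (lin V (bmat \<iota> m) c)"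
        using X lin_bmat_carrier[of m V \<iota> c] by auto
      fix i j assume "i < dim_row (lin V (bmat \<iota> m) c)" "j < dim_col (lin V (bmat \<iota> m) c)"
      then have "i < 2 ^ m" "j < 2 ^ m" using lin_bmat_carrier[of m V \<iota> c] by auto
      then show "X $$ (i, j) = lin V (bmat \<iota> m) c $$ (i, j)"
        using c d by (simp add: lin_bmat_entry)
    qed
    then show "\<exists>c. X = lin V (bmat \<iota> m) c" by blast
  qed
qed

definition real_grades :: "nat \<Rightarrow> (bit \<times> pauli) set"
  where "real_grades m = {x. fst x = 0 \<and> snd x \<in> words m}"

definition complex_grades :: "nat \<Rightarrow> (bit \<times> pauli) set"
  where "complex_grades m = {x. snd x \<in> words m}"

lemma real_grades_image: "real_grades m = Pair 0 ` words m"
  by (auto simp: real_grades_def image_iff)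

lemma complex_grades_image: "complex_grades m = Pair 0 ` words m \<union> Pair 1 ` words m"
proof -
  have "x \<in> Pair 0 ` words m \<union> Pair 1 ` words m" if "snd x \<in> words m" for x :: "bit \<times> pauli"
    using that bit_cases[of "fst x"] by (cases x) auto
  then show ?thesis by (auto simp: complex_grades_def)
qed

lemma graded_real: "graded_alg (ring_mat TYPE(real) (2 ^ m) ()) msc (real_grades m) (bmat 1 m) (hmat m)"
proof (rule graded_mat)
  have e: "bmat 1 m (0, v) = (pmat m v :: real mat)" for v by (simp add: bmat_def)
  have s: "(\<Sum>x\<in>real_grades m. of_real (c x) * bmat 1 m x $$ ij) = pcomb m (\<lambda>v. c (0, v)) ij"
    for c :: "bit \<times> pauli \<Rightarrow> real" and ij
    unfolding real_grades_image pcomb_def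
    by (subst sum.reindex) (auto simp: inj_on_def e)
  show "\<exists>d :: pauli \<Rightarrow> real. (\<forall>i<2 ^ m. \<forall>j<2 ^ m. (\<Sum>x\<in>real_grades m. of_real (c x) * bmat 1 m x $$ (i, j)) = pcomb m d (i, j))
      \<and> ((\<forall>v\<in>words m. d v = 0) \<longrightarrow> (\<forall>x\<in>real_grades m. c x = 0))" for c :: "bit \<times> pauli \<Rightarrow> real"
    unfolding s by (intro exI[of _ "\<lambda>v. c (0, v)"]) (auto simp: real_grades_def)
  show "\<exists>c. \<forall>i<2 ^ m. \<forall>j<2 ^ m. pcomb m d (i, j) = (\<Sum>x\<in>real_grades m. of_real (c x) * bmat 1 m x $$ (i, j))"
    for d :: "pauli \<Rightarrow> real"
    unfolding s by (intro exI[of _ "\<lambda>x. d (snd x)"]) simp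
  show "finite (real_grades m)" unfolding real_grades_image using card_words by simp
qed (auto simp: real_grades_def)

lemma graded_complex:
  "graded_alg (ring_mat TYPE(complex) (2 ^ m) ()) msc (complex_grades m) (bmat \<i> m) (hmat m)"
proof (rule graded_mat)
  have e: "bmat \<i> m (0, v) = pmat m v" "bmat \<i> m (1, v) = \<i> \<cdot>\<^sub>m pmat m v" for v by (simp_all add: bmat_def)
  have s: "(\<Sum>x\<in>complex_grades m. of_real (c x) * bmat \<i> m x $$ (i, j))
      = pcomb m (\<lambda>v. Complex (c (0, v)) (c (1, v))) (i, j)" if "i < 2 ^ m" "j < 2 ^ m"
    for c :: "bit \<times> pauli \<Rightarrow> real" and i j
  proof -
    have "(\<Sum>x\<in>complex_grades m. of_real (c x) * bmat \<i> m x $$ (i, j))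
        = (\<Sum>x\<in>Pair 0 ` words m. of_real (c x) * bmat \<i> m x $$ (i, j))
        + (\<Sum>x\<in>Pair 1 ` words m. of_real (c x) * bmat \<i> m x $$ (i, j))"
      unfolding complex_grades_image using card_words by (intro sum.union_disjoint) auto
    also have "\<dots> = (\<Sum>v\<in>words m. of_real (c (0, v)) * pmat m v $$ (i, j))
        + (\<Sum>v\<in>words m. of_real (c (1, v)) * (\<i> * pmat m v $$ (i, j)))"
      using that by (simp add: sum.reindex inj_on_def e msc_entry[OF _ _ pmat_carrier])
    finally show ?thesis
      by (simp add: pcomb_def Complex_eq ring_distribs sum.distrib mult_ac)
  qed
  show "\<exists>c. \<forall>i<2 ^ m. \<forall>j<2 ^ m. pcomb m d (i, j) = (\<Sum>x\<in>complex_grades m. of_real (c x) * bmat \<i> m x $$ (i, j))"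
    for d :: "pauli \<Rightarrow> complex"
    by (intro exI[of _ "\<lambda>x. if fst x = 1 then Im (d (snd x)) else Re (d (snd x))"]) (simp add: s)
  show "finite (complex_grades m)" unfolding complex_grades_image using card_words by simp
  show "\<exists>d :: pauli \<Rightarrow> complex. (\<forall>i<2 ^ m. \<forall>j<2 ^ m. (\<Sum>x\<in>complex_grades m. of_real (c x) * bmat \<i> m x $$ (i, j)) = pcomb m d (i, j))
      \<and> ((\<forall>v\<in>words m. d v = 0) \<longrightarrow> (\<forall>x\<in>complex_grades m. c x = 0))" for c :: "bit \<times> pauli \<Rightarrow> real"
  proof (intro exI[of _ "\<lambda>v. Complex (c (0, v)) (c (1, v))"] conjI impI ballI)
    fix x assume "\<forall>v\<in>words m. Complex (c (0, v)) (c (1, v)) = 0" and "x \<in> complex_grades m"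
    then have "c (0, snd x) = 0" "c (1, snd x) = 0" by (auto simp: complex_grades_def complex_eq_iff)
    then show "c x = 0" using bit_cases[of "fst x"] by (cases x) auto
  qed (simp add: s)
qed (auto simp: complex_grades_def)

section \<open>Signed involutions of the matrix algebra\<close>

text \<open>Real-linear operators that are diagonal with entries $\pm 1$ in the basis of Pauli
  matrices. Transposition, complex conjugation and the adjoint are of this kind.\<close>

definition signed_op :: "nat \<Rightarrow> (bit \<times> pauli) set \<Rightarrow> 'a::real_field \<Rightarrow> (bit \<times> pauli \<Rightarrow> bit) \<Rightarrow> ('a mat \<Rightarrow> 'a mat) \<Rightarrow> bool"
  where "signed_op m V \<iota> g \<sigma> \<longleftrightarrow>
    (\<forall>X\<in>carrier_mat (2 ^ m) (2 ^ m). \<sigma> X \<in> carrier_mat (2 ^ m) (2 ^ m)) \<and>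
    (\<forall>X\<in>carrier_mat (2 ^ m) (2 ^ m). \<forall>Y\<in>carrier_mat (2 ^ m) (2 ^ m). \<sigma> (X + Y) = \<sigma> X + \<sigma> Y) \<and>
    (\<forall>a. \<forall>X\<in>carrier_mat (2 ^ m) (2 ^ m). \<sigma> (of_real a \<cdot>\<^sub>m X) = of_real a \<cdot>\<^sub>m \<sigma> X) \<and>
    (\<forall>x\<in>V. \<sigma> (bmat \<iota> m x) = sgb (g x) \<cdot>\<^sub>m bmat \<iota> m x)"

context graded_alg
begin

lemma lin_signed_op:
  assumes closed: "\<And>x. x \<in> carrier R \<Longrightarrow> \<tau> x \<in> carrier R"
    and add: "\<And>x y. x \<in> carrier R \<Longrightarrow> y \<in> carrier R \<Longrightarrow> \<tau> (x \<oplus> y) = \<tau> x \<oplus> \<tau> y"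
    and scale: "\<And>a x. x \<in> carrier R \<Longrightarrow> \<tau> (sc a x) = sc a (\<tau> x)"
    and sign: "\<And>v. v \<in> V \<Longrightarrow> \<tau> (b v) = sc (sgb (t v)) (b v)"
  shows "\<tau> (lin V b c) = lin V b (\<lambda>v. sgb (t v) * c v)"
proof -
  have hom: "\<tau> (finsum R f A) = finsum R (\<lambda>v. \<tau> (f v)) A" if "finite A" "f \<in> A \<rightarrow> carrier R" for f :: "'v \<Rightarrow> 'a" and A
    using that
  proof (induction A)
    case empty
    have "\<tau> (sc 0 \<zero>) = sc 0 (\<tau> \<zero>)" by (rule scale) simp
    then show ?case using closed[of \<zero>] by simp
  next
    case (insert x A)
    then have f: "f x \<in> carrier R" "f \<in> A \<rightarrow> carrier R" by auto
    then have "finsum R f (insert x A) = f x \<oplus> finsum R f A"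
      using insert by (intro finsum_insert) auto
    moreover have "finsum R (\<lambda>v. \<tau> (f v)) (insert x A) = \<tau> (f x) \<oplus> finsum R (\<lambda>v. \<tau> (f v)) A"
      using insert f by (intro finsum_insert) (auto intro!: closed)
    ultimately show ?case using insert.IH[OF f(2)] f by (simp add: add)
  qed
  have fin: "finite V" using b_indep by (simp add: indep_def)
  have "\<tau> (lin V b c) = finsum R (\<lambda>v. \<tau> (sc (c v) (b v))) V"
    unfolding lin_def by (rule hom[OF fin]) (use b_V in \<open>auto intro!: sc_closed\<close>)
  also have "\<dots> = lin V b (\<lambda>v. sgb (t v) * c v)"
    unfolding lin_def using b_closed by (intro finsum_cong') (auto simp: scale sign mult.commute)
  finally show ?thesis .
qed

lemma signed_op_eigen:
  assumes "\<And>c. \<tau> (lin V b c) = lin V b (\<lambda>v. sgb (t v) * c v)"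
  shows "\<tau> (lin V b c) = sc (sgb e) (lin V b c) \<longleftrightarrow> (\<forall>v\<in>V. c v = 0 \<or> t v = e)"
proof -
  have "\<tau> (lin V b c) = sc (sgb e) (lin V b c) \<longleftrightarrow>
      lin V b (\<lambda>v. sgb (t v) * c v) = lin V b (\<lambda>v. sgb e * c v)"
    unfolding assms lin_scale[OF b_V] ..
  also have "\<dots> \<longleftrightarrow> (\<forall>v\<in>V. sgb (t v) * c v = sgb e * c v)"
  proof
    assume eq: "lin V b (\<lambda>v. sgb (t v) * c v) = lin V b (\<lambda>v. sgb e * c v)"
    show "\<forall>v\<in>V. sgb (t v) * c v = sgb e * c v" using lin_eqD[OF b_indep eq] by blast
  next
    assume "\<forall>v\<in>V. sgb (t v) * c v = sgb e * c v"
    then show "lin V b (\<lambda>v. sgb (t v) * c v) = lin V b (\<lambda>v. sgb e * c v)"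
      by (intro lin_cong[OF b_V]) simp_all
  qed
  also have "\<dots> \<longleftrightarrow> (\<forall>v\<in>V. c v = 0 \<or> t v = e)"
  proof (intro ball_cong refl)
    fix v
    show "sgb (t v) * c v = sgb e * c v \<longleftrightarrow> c v = 0 \<or> t v = e"
      using bit_cases[of "t v"] bit_cases[of e] by (elim disjE) auto
  qed
  finally show ?thesis .
qed

text \<open>A condition that is diagonal in the basis defines the span of the basis vectors
  satisfying it.\<close>

lemma carrier_eq_range:
  assumes S: "S \<subseteq> V" and Q: "\<And>c. Q (lin V b c) \<longleftrightarrow> (\<forall>v\<in>V. c v = 0 \<or> v \<in> S)"
  shows "{x \<in> carrier R. Q x} = range (lin S b)"
  unfolding lin_restrict[OF S]
proof (intro equalityI subsetI)
  fix x assume "x \<in> {x \<in> carrier R. Q x}"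
  then obtain c where "x = lin V b c" "Q (lin V b c)" using b_span by blast
  then show "x \<in> {lin V b c | c. \<forall>v\<in>V - S. c v = 0}" using Q by blast
next
  fix x assume "x \<in> {lin V b c | c. \<forall>v\<in>V - S. c v = 0}"
  then obtain c where "x = lin V b c" "\<forall>v\<in>V - S. c v = 0" by blast
  then show "x \<in> {x \<in> carrier R. Q x}" using Q lin_closed[OF b_V] by blast
qed

end

text \<open>Up to sign this is $P_f \, \sigma(X) P_f^{-1}$. Conditions such as $X^T J + J X = 0$ say
  that $X$ is an eigenvector of such an operator, which is again diagonal in the basis.\<close>

definition twist :: "nat \<Rightarrow> pauli \<Rightarrow> ('a::real_field mat \<Rightarrow> 'a mat) \<Rightarrow> 'a mat \<Rightarrow> 'a mat"
  where "twist m f \<sigma> X = sgb (gam m f f) \<cdot>\<^sub>m (pmat m f * \<sigma> X * pmat m f)"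

lemma pmat_sandwich: "pmat m f * (a \<cdot>\<^sub>m pmat m v) * pmat m f
    = (sgb (gam m f f) * sgb (bet m v f) * a) \<cdot>\<^sub>m (pmat m v :: 'a::real_field mat)"
proof -
  have "pmat m f * (a \<cdot>\<^sub>m pmat m v) * pmat m f = ((1 * a * sgb (gam m f v)) * 1 * sgb (gam m (f + v) f)) \<cdot>\<^sub>m (pmat m (f + v + f) :: 'a mat)"
    using smult_pmat_mult[of 1 m f a v] smult_pmat_mult[of "1 * a * sgb (gam m f v)" m "f + v" 1 f] by simp
  moreover have "f + v + f = v"
  proof -
    have "f + v + f = f + (f + v)" by (simp only: ac_simps)
    then show ?thesis by simp
  qed
  ultimately show ?thesis by (simp add: gam_add_left bet_def sgb_add mult_ac)
qed

lemma signed_op_twist: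
  fixes \<iota> :: "'a::real_field"
  assumes \<sigma>: "signed_op m V \<iota> g \<sigma>"
  shows "signed_op m V \<iota> (\<lambda>x. g x + bet m (snd x) f) (twist m f \<sigma>)"
  unfolding signed_op_def
proof (intro conjI ballI allI)
  let ?N = "2 ^ m :: nat" and ?P = "pmat m f :: 'a mat"
  have P: "?P \<in> carrier_mat ?N ?N" by simp
  fix X Y :: "'a mat" and a :: real assume X: "X \<in> carrier_mat ?N ?N"
  have sX: "\<sigma> X \<in> carrier_mat ?N ?N" using \<sigma> X unfolding signed_op_def by blast
  have PX: "?P * \<sigma> X \<in> carrier_mat ?N ?N" using P sX by (rule mult_carrier_mat)
  show "twist m f \<sigma> X \<in> carrier_mat ?N ?N" using PX P by (simp add: twist_def)
  show "twist m f \<sigma> (of_real a \<cdot>\<^sub>m X) = of_real a \<cdot>\<^sub>m twist m f \<sigma> X"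
  proof -
    have "\<sigma> (of_real a \<cdot>\<^sub>m X) = of_real a \<cdot>\<^sub>m \<sigma> X" using \<sigma> X unfolding signed_op_def by blast
    then show ?thesis
      unfolding twist_def using mult_smult_distrib[OF P sX] mult_smult_assoc_mat[OF PX P]
      by (simp add: smult_smult mult.commute)
  qed
  assume Y: "Y \<in> carrier_mat ?N ?N"
  have sY: "\<sigma> Y \<in> carrier_mat ?N ?N" using \<sigma> Y unfolding signed_op_def by blast
  have PY: "?P * \<sigma> Y \<in> carrier_mat ?N ?N" using P sY by (rule mult_carrier_mat)
  have "\<sigma> (X + Y) = \<sigma> X + \<sigma> Y" using \<sigma> X Y unfolding signed_op_def by blast
  then have "?P * \<sigma> (X + Y) * ?P = ?P * \<sigma> X * ?P + ?P * \<sigma> Y * ?P"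
    using mult_add_distrib_mat[OF P sX sY] add_mult_distrib_mat[OF PX PY P] by simp
  then show "twist m f \<sigma> (X + Y) = twist m f \<sigma> X + twist m f \<sigma> Y"
    unfolding twist_def
    by (simp add: add_smult_distrib_left_mat[OF mult_carrier_mat[OF PX P] mult_carrier_mat[OF PY P]])
next
  fix x assume "x \<in> V"
  then have sx: "\<sigma> (bmat \<iota> m x) = sgb (g x) \<cdot>\<^sub>m bmat \<iota> m x" using \<sigma> unfolding signed_op_def by blast
  have sc: "sgb a * (sgb a * sgb d * (sgb e * t)) = sgb (e + d) * t" for a d e and t :: 'a
    using bit_cases[of a] bit_cases[of d] bit_cases[of e] by (elim disjE; simp)
  show "twist m f \<sigma> (bmat \<iota> m x) = sgb (g x + bet m (snd x) f) \<cdot>\<^sub>m bmat \<iota> m x"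
    unfolding twist_def sx unfolding bmat_def smult_smult pmat_sandwich sc ..
qed

lemma twist_iff:
  fixes X :: "'a::real_field mat"
  assumes f: "\<sigma> X \<in> carrier_mat (2 ^ m) (2 ^ m)" and X: "X \<in> carrier_mat (2 ^ m) (2 ^ m)"
  shows "X * pmat m f = pmat m f * \<sigma> X \<longleftrightarrow> twist m f \<sigma> X = X"
    and "\<sigma> X * pmat m f + pmat m f * X = 0\<^sub>m (2 ^ m) (2 ^ m) \<longleftrightarrow> twist m f \<sigma> X = (- 1) \<cdot>\<^sub>m X"
proof -
  let ?N = "2 ^ m :: nat" and ?P = "pmat m f :: 'a mat" and ?s = "sgb (gam m f f) :: 'a"
  have P: "?P \<in> carrier_mat ?N ?N" by simp
  have PP: "?P * ?P = ?s \<cdot>\<^sub>m 1\<^sub>m ?N"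
    unfolding pmat_mult pauli_add_self pmat_zero ..
  note PfX = mult_carrier_mat[OF P f] and fXP = mult_carrier_mat[OF f P]
  note XP = mult_carrier_mat[OF X P] and PX = mult_carrier_mat[OF P X]
  have right: "(A * ?P) * ?P = ?s \<cdot>\<^sub>m A" if A: "A \<in> carrier_mat ?N ?N" for A
  proof -
    have "(A * ?P) * ?P = A * (?P * ?P)" by (rule assoc_mult_mat[OF A P P])
    also have "\<dots> = ?s \<cdot>\<^sub>m (A * 1\<^sub>m ?N)" unfolding PP by (rule mult_smult_distrib[OF A one_carrier_mat])
    finally show ?thesis using A by simp
  qed
  have left: "?P * (?P * A) = ?s \<cdot>\<^sub>m A" if A: "A \<in> carrier_mat ?N ?N" for A
  proof -
    have "?P * (?P * A) = (?P * ?P) * A" by (rule assoc_mult_mat[OF P P A, symmetric])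
    also have "\<dots> = ?s \<cdot>\<^sub>m (1\<^sub>m ?N * A)" unfolding PP by (rule mult_smult_assoc_mat[OF one_carrier_mat A])
    finally show ?thesis using A by simp
  qed
  have ss: "?s \<cdot>\<^sub>m (?s \<cdot>\<^sub>m A) = A" for A :: "'a mat"
    unfolding smult_smult sgb_self by simp
  have cancel: "A = B" if "A * ?P = B * ?P" "A \<in> carrier_mat ?N ?N" "B \<in> carrier_mat ?N ?N"
    for A B :: "'a mat"
  proof -
    have "?s \<cdot>\<^sub>m A = ?s \<cdot>\<^sub>m B" using right[OF that(2)] right[OF that(3)] that(1) by simp
    then have "?s \<cdot>\<^sub>m (?s \<cdot>\<^sub>m A) = ?s \<cdot>\<^sub>m (?s \<cdot>\<^sub>m B)" by simp
    then show ?thesis unfolding ss .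
  qed
  have tw: "twist m f \<sigma> X = ?s \<cdot>\<^sub>m (?P * \<sigma> X * ?P)" by (simp add: twist_def)
  have twP: "twist m f \<sigma> X * ?P = ?P * \<sigma> X"
    unfolding tw mult_smult_assoc_mat[OF mult_carrier_mat[OF PfX P] P] right[OF PfX] ss ..
  have twc: "twist m f \<sigma> X \<in> carrier_mat ?N ?N" unfolding tw using mult_carrier_mat[OF PfX P] by simp
  show "X * ?P = ?P * \<sigma> X \<longleftrightarrow> twist m f \<sigma> X = X"
    using twP cancel[OF _ X twc] by metis
  have Ptw: "?P * twist m f \<sigma> X = \<sigma> X * ?P"
  proof -
    have "?P * twist m f \<sigma> X = ?s \<cdot>\<^sub>m (?P * (?P * (\<sigma> X * ?P)))"
      unfolding tw assoc_mult_mat[OF P f P] by (rule mult_smult_distrib[OF P mult_carrier_mat[OF P fXP]])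
    then show ?thesis unfolding left[OF fXP] ss .
  qed
  have neg: "?P * ((- 1) \<cdot>\<^sub>m X) = (- 1) \<cdot>\<^sub>m (?P * X)" by (rule mult_smult_distrib[OF P X])
  have "\<sigma> X * ?P + ?P * X = 0\<^sub>m ?N ?N \<longleftrightarrow> \<sigma> X * ?P = (- 1) \<cdot>\<^sub>m (?P * X)"
  proof -
    have "A + B = 0\<^sub>m ?N ?N \<longleftrightarrow> A = (- 1) \<cdot>\<^sub>m B" if A: "A \<in> carrier_mat ?N ?N" and B: "B \<in> carrier_mat ?N ?N"
      for A B :: "'a mat"
    proof
      assume eq: "A + B = 0\<^sub>m ?N ?N"
      show "A = (- 1) \<cdot>\<^sub>m B"
      proof (rule eq_matI)
        fix i j assume "i < dim_row ((- 1) \<cdot>\<^sub>m B)" "j < dim_col ((- 1) \<cdot>\<^sub>m B)"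
        then have ij: "i < ?N" "j < ?N" using B by auto
        have "(A + B) $$ (i, j) = 0" unfolding eq using ij by simp
        then have "A $$ (i, j) + B $$ (i, j) = 0" using A B ij by simp
        then show "A $$ (i, j) = ((- 1) \<cdot>\<^sub>m B) $$ (i, j)" using B ij by (simp add: add_eq_0_iff2)
      qed (use A B in auto)
    next
      assume "A = (- 1) \<cdot>\<^sub>m B"
      then show "A + B = 0\<^sub>m ?N ?N" using B by (intro eq_matI) auto
    qed
    from this[OF fXP PX] show ?thesis .
  qed
  also have "\<dots> \<longleftrightarrow> ?P * twist m f \<sigma> X = ?P * ((- 1) \<cdot>\<^sub>m X)" unfolding Ptw neg ..
  also have "\<dots> \<longleftrightarrow> twist m f \<sigma> X = (- 1) \<cdot>\<^sub>m X"
  proof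
    assume eq: "?P * twist m f \<sigma> X = ?P * ((- 1) \<cdot>\<^sub>m X)"
    have nX: "(- 1) \<cdot>\<^sub>m X \<in> carrier_mat ?N ?N" using X by simp
    have "?s \<cdot>\<^sub>m twist m f \<sigma> X = ?s \<cdot>\<^sub>m ((- 1) \<cdot>\<^sub>m X)"
      unfolding left[OF twc, symmetric] left[OF nX, symmetric] eq ..
    then show "twist m f \<sigma> X = (- 1) \<cdot>\<^sub>m X" by (metis ss)
  qed simp
  finally show "\<sigma> X * ?P + ?P * X = 0\<^sub>m ?N ?N \<longleftrightarrow> twist m f \<sigma> X = (- 1) \<cdot>\<^sub>m X" .
qed

lemma signed_op_transpose: "signed_op m V \<iota> (\<lambda>x. gam m (snd x) (snd x)) transpose_mat"
  unfolding signed_op_def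
  by (auto simp: bmat_def transpose_smult pmat_transpose smult_smult mult.commute transpose_add)

lemma map_cnj_pmat: "map_mat cnj (pmat m v) = pmat m v"
proof (induction m arbitrary: v)
  case 0
  show ?case by (rule eq_matI) auto
next
  case (Suc m)
  have e: "cnj (pmat m (ptl v) $$ (i, j)) = pmat m (ptl v) $$ (i, j)" if "i < 2 ^ m" "j < 2 ^ m" for i j
    using arg_cong[OF Suc[of "ptl v"], of "\<lambda>A. A $$ (i, j)"] that by simp
  have s: "cnj (sgb a) = sgb a" for a by (cases a) simp_all
  show ?case
  proof (rule eq_matI)
    fix i j assume "i < dim_row (pmat (Suc m) v :: complex mat)" "j < dim_col (pmat (Suc m) v :: complex mat)"
    then have ij: "i < 2 ^ Suc m" "j < 2 ^ Suc m" by simp_all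
    have lt: "k - 2 ^ m < 2 ^ m" if "\<not> k < 2 ^ m" "k < 2 ^ Suc m" for k :: nat using that by simp
    show "map_mat cnj (pmat (Suc m) v) $$ (i, j) = pmat (Suc m) v $$ (i, j)"
      using ij lt[of i] lt[of j] by (auto simp: pmat.simps(2) Let_def e s)
  qed auto
qed

lemma signed_op_cnj: "signed_op m V \<i> fst (map_mat cnj)"
proof -
  have "map_mat cnj (bmat \<i> m x) = sgb (fst x) \<cdot>\<^sub>m bmat \<i> m x" for x
  proof -
    have "map_mat cnj (a \<cdot>\<^sub>m A) = cnj a \<cdot>\<^sub>m map_mat cnj A" for a A by (rule eq_matI) auto
    then show ?thesis using bit_cases[of "fst x"]
      by (elim disjE; simp add: bmat_def map_cnj_pmat smult_smult)
  qed
  then show ?thesis unfolding signed_op_def by (auto intro!: eq_matI)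
qed

lemma mat_adjoint_eq: "X \<in> carrier_mat n n \<Longrightarrow> mat_adjoint X = transpose_mat (map_mat cnj X)"
  by (rule eq_matI) (auto simp: mat_adjoint_def mat_of_rows_def)

lemma signed_op_adjoint: "signed_op m V \<i> (\<lambda>x. fst x + gam m (snd x) (snd x)) mat_adjoint"
proof -
  have c: "mat_adjoint (bmat \<i> m x) = sgb (fst x + gam m (snd x) (snd x)) \<cdot>\<^sub>m bmat \<i> m x" for x
  proof -
    have "map_mat cnj (bmat \<i> m x) = sgb (fst x) \<cdot>\<^sub>m bmat \<i> m x"
      using signed_op_cnj[of m UNIV] unfolding signed_op_def by blast
    moreover have "transpose_mat (bmat \<i> m x) = sgb (gam m (snd x) (snd x)) \<cdot>\<^sub>m bmat \<i> m x"
      using signed_op_transpose[of m UNIV] unfolding signed_op_def by blast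
    ultimately show ?thesis
      unfolding mat_adjoint_eq[OF bmat_carrier] by (simp add: transpose_smult smult_smult sgb_add)
  qed
  show ?thesis
    unfolding signed_op_def
  proof (intro conjI ballI allI)
    fix X Y :: "complex mat" and a :: real
    assume X: "X \<in> carrier_mat (2 ^ m) (2 ^ m)"
    show "mat_adjoint X \<in> carrier_mat (2 ^ m) (2 ^ m)" using X by (simp add: mat_adjoint_eq)
    show "mat_adjoint (of_real a \<cdot>\<^sub>m X) = of_real a \<cdot>\<^sub>m mat_adjoint X"
      using X by (simp add: mat_adjoint_eq[of _ "2 ^ m"]) (auto intro!: eq_matI)
    assume Y: "Y \<in> carrier_mat (2 ^ m) (2 ^ m)"
    show "mat_adjoint (X + Y) = mat_adjoint X + mat_adjoint Y"
      using X Y by (simp add: mat_adjoint_eq[of _ "2 ^ m"]) (auto intro!: eq_matI)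
  qed (rule c)
qed

section \<open>Lie algebras spanned by Pauli matrices\<close>

locale pauli_alg =
  fixes m :: nat and V :: "(bit \<times> pauli) set" and \<iota> :: "'a::real_field"
  assumes graded: "graded_alg (ring_mat TYPE('a) (2 ^ m) ()) msc V (bmat \<iota> m) (hmat m)"

sublocale pauli_alg \<subseteq> graded_alg "ring_mat TYPE('a) (2 ^ m) ()" msc V "bmat \<iota> m" "hmat m"
  by (rule graded)

context pauli_alg
begin

lemma signed_op_lin:
  assumes "signed_op m V \<iota> g \<sigma>"
  shows "\<sigma> (lin V (bmat \<iota> m) c) = lin V (bmat \<iota> m) (\<lambda>v. sgb (g v) * c v)"
  by (rule lin_signed_op) (use assms in \<open>simp_all add: signed_op_def ring_mat_simps of_real_sgb\<close>)

text \<open>The invariance of a form with Pauli matrix $P_f$ is a condition on the individual basis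
  vectors, since \<open>twist_iff\<close> turns it into an eigenvector equation for an operator that
  is diagonal in the basis.\<close>

lemma form_iff:
  assumes \<sigma>: "signed_op m V \<iota> g \<sigma>"
  shows "lin V (bmat \<iota> m) c * pmat m f = pmat m f * \<sigma> (lin V (bmat \<iota> m) c) \<longleftrightarrow>
      (\<forall>x\<in>V. c x = 0 \<or> g x + bet m (snd x) f = 0)"
    and "\<sigma> (lin V (bmat \<iota> m) c) * pmat m f + pmat m f * lin V (bmat \<iota> m) c = 0\<^sub>m (2 ^ m) (2 ^ m) \<longleftrightarrow>
      (\<forall>x\<in>V. c x = 0 \<or> g x + bet m (snd x) f = 1)"
proof -
  let ?X = "lin V (bmat \<iota> m) c"
  have X: "?X \<in> carrier_mat (2 ^ m) (2 ^ m)" by (rule lin_bmat_carrier)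
  have sX: "\<sigma> ?X \<in> carrier_mat (2 ^ m) (2 ^ m)" using \<sigma> X unfolding signed_op_def by blast
  note eigen = signed_op_eigen[of "twist m f \<sigma>", OF signed_op_lin[OF signed_op_twist[OF \<sigma>]]]
  show "?X * pmat m f = pmat m f * \<sigma> ?X \<longleftrightarrow> (\<forall>x\<in>V. c x = 0 \<or> g x + bet m (snd x) f = 0)"
    unfolding twist_iff(1)[of \<sigma> ?X, OF sX X] eigen[of c 0, symmetric] by simp
  show "\<sigma> ?X * pmat m f + pmat m f * ?X = 0\<^sub>m (2 ^ m) (2 ^ m) \<longleftrightarrow>
      (\<forall>x\<in>V. c x = 0 \<or> g x + bet m (snd x) f = 1)"
    unfolding twist_iff(2)[of \<sigma> ?X, OF sX X] eigen[of c 1, symmetric] by simp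
qed

lemma matrix_set_eq_range:
  assumes "S \<subseteq> V" and "\<And>c. Q (lin V (bmat \<iota> m) c) \<longleftrightarrow> (\<forall>x\<in>V. c x = 0 \<or> x \<in> S)"
  shows "{X \<in> carrier_mat (2 ^ m) (2 ^ m). Q X} = range (lin S (bmat \<iota> m))"
  using carrier_eq_range[OF assms] by (simp add: ring_mat_simps)

lemma matrix_lie_iso:
  fixes w :: "nat \<Rightarrow> bit \<times> pauli"
  assumes w: "\<And>i. i \<in> {1..r + s} \<Longrightarrow> w i \<in> V \<and> fst (w i) + gam m (snd (w i)) (snd (w i)) = (if i \<le> r then 1 else 0)"
    and anti: "anticommuting_family (r + s) m (\<lambda>i. snd (w i))"
    and S: "S \<subseteq> V" and bij: "bij_betw (sum w) (lie_indices (r + s)) S" and C: "C = range (lin S (bmat \<iota> m))"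
  shows "H_lie r s \<cong>\<^sub>L matrix_lie C"
proof (rule graded_lie_iso[where w = w and S = S, OF _ _ _ S])
  show "bij_betw (sum w) {I. I \<subseteq> {1..r + s} \<and> card I mod 4 \<in> {1, 2} \<and>
      \<not> ((r + s) mod 4 = 1 \<and> I = {1..r + s})} S"
    using bij unfolding lie_indices_def .
  have sq: "fst x * fst x = fst x" for x :: "bit \<times> pauli" using bit_cases[of "fst x"] by auto
  show "w i + w i = 0 \<and> hmat m (w i) (w i) = (if i \<le> r then 1 else 0)" if "i \<in> {1..r + s}" for i
    using w[OF that] by (simp add: hmat_def sq prod_eq_iff)
  show "hmat m (w i) (w j) + hmat m (w j) (w i) = 1"
    if "i \<in> {1..r + s}" "j \<in> {1..r + s}" "i \<noteq> j" for i j
  proof -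
    have "hmat m (w i) (w j) + hmat m (w j) (w i)
        = (fst (w i) * fst (w j) + fst (w i) * fst (w j)) + bet m (snd (w i)) (snd (w j))"
      unfolding hmat_def bet_def by (simp only: ac_simps)
    then show ?thesis using anticommuting_familyD(2)[OF anti that] by simp
  qed
qed (use w C in \<open>auto simp: matrix_lie_def ring_mat_simps ring_mat_minus\<close>)

lemma matrix_lie_double_iso:
  fixes w :: "nat \<Rightarrow> bit \<times> bit \<times> pauli"
  assumes w: "\<And>i. i \<in> {1..r + s} \<Longrightarrow> snd (w i) \<in> V \<and>
      fst (snd (w i)) + gam m (snd (snd (w i))) (snd (snd (w i))) = (if i \<le> r then 1 else 0)"
    and anti: "anticommuting_family (r + s) m (\<lambda>i. snd (snd (w i)))"
    and S: "S \<subseteq> V" and bij: "bij_betw (sum w) (lie_indices (r + s)) (UNIV \<times> S)"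
    and C: "C = range (lin S (bmat \<iota> m))"
  shows "H_lie r s \<cong>\<^sub>L matrix_lie C \<oplus>\<^sub>L matrix_lie C"
proof -
  interpret D: graded_alg "prod_ring (ring_mat TYPE('a) (2 ^ m) ())" "prod_sc msc" "UNIV \<times> V" "double (bmat \<iota> m)"
    "\<lambda>x y. hmat m (snd x) (snd y)"
    by (rule double_graded)
  have finS: "finite S" using S b_indep finite_subset unfolding indep_def by blast
  have bS: "bmat \<iota> m \<in> S \<rightarrow> carrier (ring_mat TYPE('a) (2 ^ m) ())" by (simp add: ring_mat_simps)
  have minus: "x \<ominus>\<^bsub>prod_ring (ring_mat TYPE('a) (2 ^ m) ())\<^esub> y = (fst x - fst y, snd x - snd y)"
    if "fst x \<in> carrier_mat (2 ^ m) (2 ^ m)" "snd x \<in> carrier_mat (2 ^ m) (2 ^ m)"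
      "fst y \<in> carrier_mat (2 ^ m) (2 ^ m)" "snd y \<in> carrier_mat (2 ^ m) (2 ^ m)" for x y
  proof -
    have "(- fst y, - snd y) \<oplus>\<^bsub>prod_ring (ring_mat TYPE('a) (2 ^ m) ())\<^esub> y
        = \<zero>\<^bsub>prod_ring (ring_mat TYPE('a) (2 ^ m) ())\<^esub>"
      using that by (simp add: prod_ring_simps ring_mat_simps uminus_l_inv_mat)
    then have "\<ominus>\<^bsub>prod_ring (ring_mat TYPE('a) (2 ^ m) ())\<^esub> y = (- fst y, - snd y)"
      using that by (intro D.minus_equality) (auto simp: prod_ring_simps ring_mat_simps mem_Times_iff)
    then show ?thesis using that by (simp add: a_minus_def prod_ring_simps ring_mat_simps minus_add_uminus_mat)
  qed
  show ?thesis
  proof (rule D.graded_lie_iso[where w = w and S = "UNIV \<times> S"])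
    show "UNIV \<times> S \<subseteq> UNIV \<times> V" using S by blast
    show "bij_betw (sum w) {I. I \<subseteq> {1..r + s} \<and> card I mod 4 \<in> {1, 2} \<and>
        \<not> ((r + s) mod 4 = 1 \<and> I = {1..r + s})} (UNIV \<times> S)"
      using bij unfolding lie_indices_def .
    have sq: "fst x * fst x = fst x" for x :: "bit \<times> pauli" using bit_cases[of "fst x"] by auto
    show "w i + w i = 0 \<and> hmat m (snd (w i)) (snd (w i)) = (if i \<le> r then 1 else 0)" if "i \<in> {1..r + s}" for i
      using w[OF that] by (simp add: hmat_def sq prod_eq_iff)
    show "hmat m (snd (w i)) (snd (w j)) + hmat m (snd (w j)) (snd (w i)) = 1"
      if "i \<in> {1..r + s}" "j \<in> {1..r + s}" "i \<noteq> j" for i j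
    proof -
      have "hmat m (snd (w i)) (snd (w j)) + hmat m (snd (w j)) (snd (w i))
          = (fst (snd (w i)) * fst (snd (w j)) + fst (snd (w i)) * fst (snd (w j))) + bet m (snd (snd (w i))) (snd (snd (w j)))"
        unfolding hmat_def bet_def by (simp only: ac_simps)
      then show ?thesis using anticommuting_familyD(2)[OF anti that] by simp
    qed
    show "carrier (matrix_lie C \<oplus>\<^sub>L matrix_lie C) = range (D.lin (UNIV \<times> S) (double (bmat \<iota> m)))"
      unfolding double_range[OF finS bS] by (simp add: lie_sum_def matrix_lie_def C)
  qed (use w minus in \<open>auto simp: lie_sum_def matrix_lie_def prod_ring_simps ring_mat_simps prod_sc_def mem_Times_iff\<close>)
qed

end

section \<open>The classical Lie algebras as spans of Pauli matrices\<close>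

definition pauli_lie :: "'a::real_field \<Rightarrow> nat \<Rightarrow> (bit \<times> pauli) set \<Rightarrow> 'a mat real_lie_alg"
  where "pauli_lie \<iota> m S = matrix_lie (range (real_alg.lin (ring_mat TYPE('a) (2 ^ m) ()) msc S (bmat \<iota> m)))"

text \<open>The three kinds of index sets that occur. In the first two the bit is a linear function
  of the word, which amounts to choosing a real form of the complex matrix algebra; in the third it
  is free or tied by a single equation.\<close>

definition twisted :: "nat \<Rightarrow> pauli \<Rightarrow> pauli \<Rightarrow> (bit \<times> pauli) set"
  where "twisted m A B = {x. fst x = bet m (snd x) A \<and> snd x \<in> words m \<and> qf m B (snd x) = 1}"

definition twisted_nonzero :: "nat \<Rightarrow> pauli \<Rightarrow> (bit \<times> pauli) set"
  where "twisted_nonzero m A = {x. fst x = bet m (snd x) A \<and> snd x \<in> words m - {0}}"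

definition central_grades :: "nat \<Rightarrow> bit \<Rightarrow> pauli \<Rightarrow> (bit \<times> pauli) set"
  where "central_grades m \<kappa> B = {x. snd x \<in> words m \<and> \<kappa> * fst x + qf m B (snd x) = 1}"

lemma one_letter_simps [simp]:
  "ptl (of_letters (a # xs)) = of_letters xs" "xpart (of_letters (a # xs)) 0 = fst a"
  "zpart (of_letters (a # xs)) 0 = snd a" "of_letters [] = 0"
  by (auto simp: of_letters_def pauli_eq_iff)

lemma uminus_mat_zero [simp]: "- 0\<^sub>m N N' = (0\<^sub>m N N' :: 'a::comm_ring_1 mat)"
  by (rule eq_matI) auto

lemma uminus_one_smult: "(- 1) \<cdot>\<^sub>m A = (- A :: 'a::comm_ring_1 mat)"
  by (rule eq_matI) auto

lemma smult_zero_mat [simp]: "k \<cdot>\<^sub>m (0\<^sub>m N N' :: 'a::comm_ring_1 mat) = 0\<^sub>m N N'"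
  by (rule eq_matI) auto

text \<open>The standard matrices defining the classical Lie algebras are Pauli matrices up to sign.
  The sign does not affect the Lie algebra, by \<open>neg_form_iff\<close>.\<close>

lemma J_mat_pauli: "J_mat (2 ^ m) = (pmat (Suc m) (of_letters [LY]) :: 'a::comm_ring_1 mat)"
  by (simp add: J_mat_def pmat.simps(2) Let_def pmat_zero uminus_one_smult)

lemma I_mat_pauli: "I_mat (2 ^ m) (2 ^ m) = (- 1) \<cdot>\<^sub>m (pmat (Suc m) (of_letters [LZ]) :: 'a::comm_ring_1 mat)"
proof -
  have "pmat (Suc m) (of_letters [LZ]) =
      four_block_mat (1\<^sub>m (2 ^ m)) (0\<^sub>m (2 ^ m) (2 ^ m)) (0\<^sub>m (2 ^ m) (2 ^ m)) (- 1\<^sub>m (2 ^ m) :: 'a mat)"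
    by (simp add: pmat.simps(2) Let_def pmat_zero uminus_one_smult)
  then show ?thesis unfolding I_mat_def by (intro eq_matI) auto
qed

lemma K_mat_pauli: "K_mat (2 ^ m) (2 ^ m) = (- 1) \<cdot>\<^sub>m (pmat (Suc (Suc m)) (of_letters [LI, LZ]) :: 'a::comm_ring_1 mat)"
proof -
  let ?P = "pmat (Suc m) (of_letters [LZ]) :: 'a mat" and ?Z = "0\<^sub>m (2 ^ m + 2 ^ m) (2 ^ m + 2 ^ m) :: 'a mat"
  have c: "?P \<in> carrier_mat (2 ^ m + 2 ^ m) (2 ^ m + 2 ^ m)"
    using pmat_carrier[of "Suc m"] by (simp add: mult_2)
  have p: "pmat (Suc (Suc m)) (of_letters [LI, LZ]) = four_block_mat ?P ?Z ?Z ?P"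
    by (simp add: pmat.simps(2)[of "Suc m"] Let_def mult_2)
  show ?thesis
    unfolding K_mat_def I_mat_pauli p smult_four_block[OF c zero_carrier_mat zero_carrier_mat c] smult_zero_mat ..
qed

lemma neg_form_iff:
  fixes X Y P :: "'a::comm_ring_1 mat"
  assumes "X \<in> carrier_mat N N" "Y \<in> carrier_mat N N" "P \<in> carrier_mat N N"
  shows "Y * ((- 1) \<cdot>\<^sub>m P) + ((- 1) \<cdot>\<^sub>m P) * X = 0\<^sub>m N N \<longleftrightarrow> Y * P + P * X = 0\<^sub>m N N"
proof -
  have c: "Y * P \<in> carrier_mat N N" "P * X \<in> carrier_mat N N" using assms by simp_all
  have "Y * ((- 1) \<cdot>\<^sub>m P) + ((- 1) \<cdot>\<^sub>m P) * X = (- 1) \<cdot>\<^sub>m (Y * P + P * X)"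
    unfolding mult_smult_distrib[OF assms(2,3)] mult_smult_assoc_mat[OF assms(3,1)]
      add_smult_distrib_left_mat[OF c] ..
  moreover have "A = 0\<^sub>m N N" if "(- 1) \<cdot>\<^sub>m A = 0\<^sub>m N N" for A :: "'a mat"
  proof -
    have "(- 1) \<cdot>\<^sub>m ((- 1) \<cdot>\<^sub>m A) = 0\<^sub>m N N" unfolding that by simp
    then show ?thesis by (simp add: smult_smult)
  qed
  ultimately show ?thesis by auto
qed

context pauli_alg
begin

abbreviation comb :: "(bit \<times> pauli \<Rightarrow> real) \<Rightarrow> 'a mat"
  where "comb \<equiv> lin V (bmat \<iota> m)"

lemma neg_form:
  assumes \<sigma>: "signed_op m V \<iota> g \<sigma>"
  shows "\<sigma> (comb c) * ((- 1) \<cdot>\<^sub>m pmat m f) + ((- 1) \<cdot>\<^sub>m pmat m f) * comb c = 0\<^sub>m (2 ^ m) (2 ^ m) \<longleftrightarrow>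
      (\<forall>x\<in>V. c x = 0 \<or> g x + bet m (snd x) f = 1)"
proof -
  have X: "comb c \<in> carrier_mat (2 ^ m) (2 ^ m)" by (rule lin_bmat_carrier)
  have sX: "\<sigma> (comb c) \<in> carrier_mat (2 ^ m) (2 ^ m)" using \<sigma> X unfolding signed_op_def by blast
  show ?thesis
    unfolding neg_form_iff[OF X sX pmat_carrier] by (rule form_iff(2)[OF \<sigma>])
qed

lemma skew_iff:
  assumes \<sigma>: "signed_op m V \<iota> g \<sigma>"
  shows "\<sigma> (comb c) + comb c = 0\<^sub>m (2 ^ m) (2 ^ m) \<longleftrightarrow> (\<forall>x\<in>V. c x = 0 \<or> g x = 1)"
proof -
  have X: "comb c \<in> carrier_mat (2 ^ m) (2 ^ m)" by (rule lin_bmat_carrier)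
  have sX: "\<sigma> (comb c) \<in> carrier_mat (2 ^ m) (2 ^ m)" using \<sigma> X unfolding signed_op_def by blast
  show ?thesis
    using form_iff(2)[OF \<sigma>, of c 0] X sX by (simp add: pmat_zero)
qed

lemma finite_V: "finite V"
  using b_indep by (simp add: indep_def)

lemma mat_trace_lin: "mat_trace (comb c) = (\<Sum>x\<in>V. of_real (c x) * mat_trace (bmat \<iota> m x))"
proof -
  have d: "dim_row (comb c) = 2 ^ m" "dim_row (bmat \<iota> m x) = 2 ^ m" for x
    using lin_bmat_carrier[of m V \<iota> c] bmat_carrier[of \<iota> m x] by blast+
  have "mat_trace (comb c) = (\<Sum>i<2 ^ m. \<Sum>x\<in>V. of_real (c x) * bmat \<iota> m x $$ (i, i))"
    unfolding mat_trace_def d by (intro sum.cong refl lin_bmat_entry) auto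
  also have "\<dots> = (\<Sum>x\<in>V. \<Sum>i<2 ^ m. of_real (c x) * bmat \<iota> m x $$ (i, i))"
    by (rule sum.swap)
  finally show ?thesis by (simp add: mat_trace_def d sum_distrib_left)
qed

lemma mat_trace_bmat: "snd x \<in> words m \<Longrightarrow>
    mat_trace (bmat \<iota> m x) = (if snd x = 0 then (if fst x = 1 then \<iota> else 1) * 2 ^ m else 0)"
  by (simp add: bmat_def mat_trace_smult[OF pmat_carrier] pmat_trace)

lemma pauli_lie_eq:
  assumes "S \<subseteq> V" and "\<And>c. Q (comb c) \<longleftrightarrow> (\<forall>x\<in>V. c x = 0 \<or> x \<in> S)"
  shows "matrix_lie {X \<in> carrier_mat (2 ^ m) (2 ^ m). Q X} = pauli_lie \<iota> m S"
  unfolding pauli_lie_def matrix_set_eq_range[OF assms] ..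

end

lemma real_pauli_alg: "pauli_alg m (real_grades m) (1 :: real)"
  by (rule pauli_alg.intro[OF graded_real])

lemma complex_pauli_alg: "pauli_alg m (complex_grades m) \<i>"
  by (rule pauli_alg.intro[OF graded_complex])

lemma real_trace_iff:
  "mat_trace (real_alg.lin (ring_mat TYPE(real) (2 ^ m) ()) msc (real_grades m) (bmat 1 m) c) = 0
    \<longleftrightarrow> (\<forall>x\<in>real_grades m. c x = 0 \<or> snd x \<noteq> 0)"
proof -
  interpret pauli_alg m "real_grades m" "1 :: real" by (rule real_pauli_alg)
  have z: "0 \<in> real_grades m" by (rule V_zero)
  have x0: "x = 0 \<longleftrightarrow> snd x = 0" if "x \<in> real_grades m" for x
    using that by (auto simp: real_grades_def prod_eq_iff)
  have t: "of_real (c x) * mat_trace (bmat 1 m x) = (if x = 0 then c 0 * 2 ^ m else 0)" if "x \<in> real_grades m" for x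
  proof (cases "x = 0")
    case True
    then show ?thesis using mat_trace_bmat[of 0] that by (simp add: real_grades_def)
  next
    case False
    then show ?thesis using mat_trace_bmat[of x] x0[OF that] that by (simp add: real_grades_def)
  qed
  have "mat_trace (comb c) = (\<Sum>x\<in>real_grades m. if x = 0 then c 0 * 2 ^ m else 0)"
    unfolding mat_trace_lin by (rule sum.cong[OF refl t])
  then have "mat_trace (comb c) = c 0 * 2 ^ m" using finite_V z by (simp add: sum.delta)
  then have "mat_trace (comb c) = 0 \<longleftrightarrow> c 0 = 0" by simp
  then show ?thesis using x0 z by metis
qed

text \<open>Only the basis vectors $1$ and $i$ have a nonzero trace.\<close>

lemma complex_trace_iff:
  "mat_trace (real_alg.lin (ring_mat TYPE(complex) (2 ^ m) ()) msc (complex_grades m) (bmat \<i> m) c) = 0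
    \<longleftrightarrow> (\<forall>x\<in>complex_grades m. c x = 0 \<or> snd x \<noteq> 0)"
proof -
  interpret pauli_alg m "complex_grades m" \<i> by (rule complex_pauli_alg)
  have z: "(e, 0) \<in> complex_grades m" for e using V_zero by (simp add: complex_grades_def)
  have two: "x = (0, 0) \<or> x = (1, 0)" if "snd x = 0" for x :: "bit \<times> pauli"
    using that bit_cases[of "fst x"] by (cases x) simp
  have sub: "{(0, 0), (1, 0)} \<subseteq> complex_grades m" using z by blast
  have "mat_trace (comb c) = (\<Sum>x\<in>{(0, 0), (1, 0)}. of_real (c x) * mat_trace (bmat \<i> m x))"
    unfolding mat_trace_lin
  proof (rule sum.mono_neutral_right[OF finite_V sub], intro ballI)
    fix x assume x: "x \<in> complex_grades m - {(0, 0), (1, 0)}"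
    then have "snd x \<noteq> 0" using two[of x] by blast
    then show "of_real (c x) * mat_trace (bmat \<i> m x) = 0"
      using x mat_trace_bmat[of x] by (simp add: complex_grades_def)
  qed
  also have "\<dots> = Complex (c (0, 0)) (c (1, 0)) * 2 ^ m"
    using mat_trace_bmat[of "(0, 0)"] mat_trace_bmat[of "(1, 0)"] z
    by (simp add: complex_grades_def Complex_eq ring_distribs)
  finally have "mat_trace (comb c) = 0 \<longleftrightarrow> c (0, 0) = 0 \<and> c (1, 0) = 0"
    by (simp add: complex_eq_iff)
  moreover have "(\<forall>x\<in>complex_grades m. c x = 0 \<or> snd x \<noteq> 0) \<longleftrightarrow> c (0, 0) = 0 \<and> c (1, 0) = 0"
  proof
    assume "\<forall>x\<in>complex_grades m. c x = 0 \<or> snd x \<noteq> 0"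
    from this[rule_format, OF z[of 0]] this[rule_format, OF z[of 1]]
    show "c (0, 0) = 0 \<and> c (1, 0) = 0" by simp
  next
    assume "c (0, 0) = 0 \<and> c (1, 0) = 0"
    then show "\<forall>x\<in>complex_grades m. c x = 0 \<or> snd x \<noteq> 0" using two by metis
  qed
  ultimately show ?thesis by simp
qed

lemma bit_sum_one_iff: "a + b = (1::bit) \<longleftrightarrow> a = 1 + b" "a + b = (0::bit) \<longleftrightarrow> a = b"
  using bit_cases[of a] bit_cases[of b] by (elim disjE; simp)+

text \<open>The conditions imposed together by the transpose (with value $g + b$) and by the adjoint
  (with value $e + g + d$) determine the bit $e$ as a linear function of the word.\<close>

lemma adjoint_form_iff: "g + b = 1 \<and> e + g + d = 1 \<longleftrightarrow> e = b + d \<and> g + b = (1 :: bit)"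
  using bit_cases[of g] bit_cases[of b] bit_cases[of d] bit_cases[of e] by (elim disjE; hypsubst; simp)

lemma adjoint_skew_iff: "g = 1 \<and> e + g + d = 1 \<longleftrightarrow> e = d \<and> g = (1 :: bit)"
  using adjoint_form_iff[of g 0 e d] by simp

lemma so_pq_pauli: "so_pq (2 ^ m) (2 ^ m) = pauli_lie 1 (Suc m) (twisted (Suc m) 0 (of_letters [LZ]))"
proof -
  interpret pauli_alg "Suc m" "real_grades (Suc m)" "1 :: real" by (rule real_pauli_alg)
  have d: "2 ^ m + 2 ^ m = (2 ^ Suc m :: nat)" by simp
  show ?thesis
    unfolding so_pq_def d I_mat_pauli
    by (rule pauli_lie_eq, unfold neg_form[OF signed_op_transpose])
      (auto simp: twisted_def real_grades_def qf_def)
qed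

lemma sp_real_pauli: "sp_real (2 ^ m) = pauli_lie 1 (Suc m) (twisted (Suc m) 0 (of_letters [LY]))"
proof -
  interpret pauli_alg "Suc m" "real_grades (Suc m)" "1 :: real" by (rule real_pauli_alg)
  have d: "2 * 2 ^ m = (2 ^ Suc m :: nat)" by simp
  show ?thesis
    unfolding sp_real_def d J_mat_pauli
    by (rule pauli_lie_eq, unfold form_iff(2)[OF signed_op_transpose])
      (auto simp: twisted_def real_grades_def qf_def)
qed

lemma sl_real_pauli: "sl_real (2 ^ m) = pauli_lie 1 m (twisted_nonzero m 0)"
proof -
  interpret pauli_alg m "real_grades m" "1 :: real" by (rule real_pauli_alg)
  show ?thesis
    unfolding sl_real_def
    by (rule pauli_lie_eq, unfold real_trace_iff)
      (auto simp: twisted_nonzero_def real_grades_def)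
qed

lemma so_complex_pauli: "so_complex (2 ^ m) = pauli_lie \<i> m (central_grades m 0 0)"
proof -
  interpret pauli_alg m "complex_grades m" \<i> by (rule complex_pauli_alg)
  show ?thesis
    unfolding so_complex_def
    by (rule pauli_lie_eq, unfold skew_iff[OF signed_op_transpose])
      (auto simp: central_grades_def complex_grades_def qf_def)
qed

lemma sp_complex_pauli: "sp_complex (2 ^ m) = pauli_lie \<i> (Suc m) (central_grades (Suc m) 0 (of_letters [LY]))"
proof -
  interpret pauli_alg "Suc m" "complex_grades (Suc m)" \<i> by (rule complex_pauli_alg)
  have d: "2 * 2 ^ m = (2 ^ Suc m :: nat)" by simp
  show ?thesis
    unfolding sp_complex_def d J_mat_pauli
    by (rule pauli_lie_eq, unfold form_iff(2)[OF signed_op_transpose])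
      (auto simp: central_grades_def complex_grades_def qf_def)
qed

lemma ball_disj_conj: "(\<forall>x\<in>V. P x \<or> Q x) \<and> (\<forall>x\<in>V. P x \<or> R x) \<longleftrightarrow> (\<forall>x\<in>V. P x \<or> (Q x \<and> R x))"
  by blast

lemma su_pq_pauli:
  "su_pq (2 ^ m) (2 ^ m) = pauli_lie \<i> (Suc m) (central_grades (Suc m) 1 (of_letters [LZ]) - {(1, 0)})"
proof -
  interpret pauli_alg "Suc m" "complex_grades (Suc m)" \<i> by (rule complex_pauli_alg)
  have d: "2 ^ m + 2 ^ m = (2 ^ Suc m :: nat)" by simp
  have eq: "fst x + gam (Suc m) (snd x) (snd x) + bet (Suc m) (snd x) (of_letters [LZ]) = 1 \<and> snd x \<noteq> 0 \<longleftrightarrow>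
      x \<in> central_grades (Suc m) 1 (of_letters [LZ]) - {(1, 0)}" if "x \<in> complex_grades (Suc m)" for x
  proof (cases "snd x = 0")
    case True
    then show ?thesis using bit_cases[of "fst x"] by (cases x) (simp add: central_grades_def)
  next
    case False
    then show ?thesis using that
      by (cases x) (simp add: central_grades_def complex_grades_def qf_def add.assoc)
  qed
  have sub: "central_grades (Suc m) 1 (of_letters [LZ]) - {(1, 0)} \<subseteq> complex_grades (Suc m)"
    by (auto simp: central_grades_def complex_grades_def)
  show ?thesis
    unfolding su_pq_def d I_mat_pauli
    by (rule pauli_lie_eq[OF sub], unfold neg_form[OF signed_op_adjoint] complex_trace_iff ball_disj_conj)
      (use eq in blast)
qed

lemma so_star_pauli: "so_star (2 ^ Suc m) = pauli_lie \<i> (Suc m) (twisted (Suc m) (of_letters [LY]) 0)"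
proof -
  interpret pauli_alg "Suc m" "complex_grades (Suc m)" \<i> by (rule complex_pauli_alg)
  have d: "2 ^ Suc m div 2 = (2 ^ m :: nat)" by simp
  have eq: "gam (Suc m) (snd x) (snd x) = 1 \<and> fst x + gam (Suc m) (snd x) (snd x) + bet (Suc m) (snd x) (of_letters [LY]) = 1
      \<longleftrightarrow> x \<in> twisted (Suc m) (of_letters [LY]) 0" if "x \<in> complex_grades (Suc m)" for x
    unfolding adjoint_skew_iff using that by (simp add: twisted_def complex_grades_def qf_def)
  have sub: "twisted (Suc m) (of_letters [LY]) 0 \<subseteq> complex_grades (Suc m)"
    by (auto simp: twisted_def complex_grades_def)
  show ?thesis
    unfolding so_star_def d J_mat_pauli
    by (rule pauli_lie_eq[OF sub], unfold skew_iff[OF signed_op_transpose] form_iff(2)[OF signed_op_adjoint] ball_disj_conj)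
      (use eq in blast)
qed

lemma sp_pq_pauli:
  "sp_pq (2 ^ m) (2 ^ m) = pauli_lie \<i> (Suc (Suc m)) (twisted (Suc (Suc m)) (of_letters [LY, LZ]) (of_letters [LY]))"
proof -
  let ?m = "Suc (Suc m)"
  interpret pauli_alg ?m "complex_grades ?m" \<i> by (rule complex_pauli_alg)
  have d: "2 ^ m + 2 ^ m = (2 ^ Suc m :: nat)" "2 * 2 ^ Suc m = (2 ^ ?m :: nat)" by simp_all
  have yz: "of_letters [LY, LZ] = of_letters [LY] + of_letters [LI, LZ]"
    by (auto simp: of_letters_def pauli_eq_iff nth_Cons split: nat.splits)
  have eq: "gam ?m (snd x) (snd x) + bet ?m (snd x) (of_letters [LY]) = 1 \<and>
      fst x + gam ?m (snd x) (snd x) + bet ?m (snd x) (of_letters [LI, LZ]) = 1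
      \<longleftrightarrow> x \<in> twisted ?m (of_letters [LY, LZ]) (of_letters [LY])" if "x \<in> complex_grades ?m" for x
    unfolding adjoint_form_iff using that by (simp add: twisted_def complex_grades_def qf_def yz bet_add_right)
  have sub: "twisted ?m (of_letters [LY, LZ]) (of_letters [LY]) \<subseteq> complex_grades ?m"
    by (auto simp: twisted_def complex_grades_def)
  show ?thesis
    unfolding sp_pq_def d J_mat_pauli K_mat_pauli
    by (rule pauli_lie_eq[OF sub], unfold form_iff(2)[OF signed_op_transpose] neg_form[OF signed_op_adjoint] ball_disj_conj)
      (use eq in blast)
qed

lemma su_star_pauli: "su_star (2 ^ Suc m) = pauli_lie \<i> (Suc m) (twisted_nonzero (Suc m) (of_letters [LY]))"
proof -
  interpret pauli_alg "Suc m" "complex_grades (Suc m)" \<i> by (rule complex_pauli_alg)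
  have d: "2 ^ Suc m div 2 = (2 ^ m :: nat)" by simp
  have eq: "fst x + bet (Suc m) (snd x) (of_letters [LY]) = 0 \<and> snd x \<noteq> 0
      \<longleftrightarrow> x \<in> twisted_nonzero (Suc m) (of_letters [LY])" if "x \<in> complex_grades (Suc m)" for x
    using that unfolding twisted_nonzero_def complex_grades_def mem_Collect_eq bit_sum_one_iff by blast
  have sub: "twisted_nonzero (Suc m) (of_letters [LY]) \<subseteq> complex_grades (Suc m)"
    by (auto simp: twisted_nonzero_def complex_grades_def)
  show ?thesis
    unfolding su_star_def d J_mat_pauli
    by (rule pauli_lie_eq[OF sub], unfold form_iff(1)[OF signed_op_cnj] complex_trace_iff ball_disj_conj)
      (use eq in blast)
qed

section \<open>Isomorphisms from frames\<close>

lemma twisted_generator: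
  assumes "{x. fst x = bet m (snd x) A \<and> snd x \<in> words m} \<subseteq> V" and "u \<in> words m" and "qf m A u = e"
  shows "(bet m u A, u) \<in> V" and "bet m u A + gam m u u = e"
  using assms(2,3) by (auto intro!: subsetD[OF assms(1)] simp: qf_def add.commute)

context pauli_alg
begin

text \<open>The generator with word $u$ is multiplied by $i$ if \<open>bet m u A\<close> is 1; since
  this exponent is additive in $u$, the index of every product has the same shape.\<close>

lemma even_iso:
  assumes F: "frame A B m r s" and n: "r + s = 2 * m"
    and V: "{x. fst x = bet m (snd x) A \<and> snd x \<in> words m} \<subseteq> V"
  shows "H_lie r s \<cong>\<^sub>L pauli_lie \<iota> m (twisted m A B)"
proof -
  obtain v where v: "anticommuting_family (r + s) m v"
    and qA: "\<And>i. i \<in> {1..r + s} \<Longrightarrow> qf m A (v i) = (if i \<le> r then 1 else 0)"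
    and qB: "\<And>i. i \<in> {1..r + s} \<Longrightarrow> qf m B (v i) = 1"
    using frame_family[OF F] by blast
  let ?t = "\<lambda>u. (bet m u A, u)"
  have w: "?t (v i) \<in> V \<and> fst (?t (v i)) + gam m (snd (?t (v i))) (snd (?t (v i))) = (if i \<le> r then 1 else 0)"
    if "i \<in> {1..r + s}" for i
    using twisted_generator[OF V anticommuting_familyD(1)[OF v that], of "if i \<le> r then 1 else 0"] qA[OF that]
    by simp
  have sum: "sum (\<lambda>i. ?t (v i)) I = ?t (sum v I)" for I
    by (simp add: prod_eq_iff fst_sum snd_sum bet_commute[of m _ A] bet_sum_right)
  have "twisted m A B = ?t ` {u \<in> words m. qf m B u = 1}"
    by (auto simp: twisted_def image_iff prod_eq_iff)
  moreover have "inj_on ?t {u \<in> words m. qf m B u = 1}" by (simp add: inj_on_def)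
  ultimately have "bij_betw ?t {u \<in> words m. qf m B u = 1} (twisted m A B)"
    by (simp add: bij_betw_def)
  from bij_betw_trans[OF lie_indices_even_bij[OF v n qB] this]
  have bij: "bij_betw (sum (\<lambda>i. ?t (v i))) (lie_indices (r + s)) (twisted m A B)"
    unfolding sum comp_def by simp
  show ?thesis
    unfolding pauli_lie_def
    by (rule matrix_lie_iso[where w = "\<lambda>i. ?t (v i)", OF w _ _ bij refl]) (use v V in \<open>auto simp: twisted_def\<close>)
qed

text \<open>Here the product of all generators is a real scalar, and the Clifford algebra is not
  represented faithfully; but by \<open>lie_indices_nonzero_bij\<close> the span of the relevant
  monomials is mapped isomorphically onto the traceless part of a real form of the matrix
  algebra.\<close>

lemma nonzero_iso:
  assumes F: "frame A B m (r - 1) s" and n: "r + s = 2 * m + 1" and pos: "1 \<le> r" "1 \<le> s"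
    and r: "even (r + m)" and m: "even m"
    and V: "{x. fst x = bet m (snd x) A \<and> snd x \<in> words m} \<subseteq> V"
  shows "H_lie r s \<cong>\<^sub>L pauli_lie \<iota> m (twisted_nonzero m A)"
proof -
  have c: "of_nat (r + m) = (0 :: bit)" using r by (simp only: of_nat_bit) simp
  obtain v k where v: "anticommuting_family (r + s) m v" and "k \<in> {1..r + s}"
    and qA: "\<And>i. i \<in> {1..r + s} \<Longrightarrow> qf m A (v i) + (if i = k then 0 else 0) = (if i \<le> r then 1 else 0)"
    and "\<And>i. i \<in> {1..r + s} \<Longrightarrow> qf m B (v i) = (if i = k then of_nat m else 1)"
    using frame_odd_family[OF disjI1[OF F] n pos c] by blast
  let ?t = "\<lambda>u. (bet m u A, u)"
  have w: "?t (v i) \<in> V \<and> fst (?t (v i)) + gam m (snd (?t (v i))) (snd (?t (v i))) = (if i \<le> r then 1 else 0)"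
    if "i \<in> {1..r + s}" for i
    using twisted_generator[OF V anticommuting_familyD(1)[OF v that], of "if i \<le> r then 1 else 0"] qA[OF that]
    by simp
  have sum: "sum (\<lambda>i. ?t (v i)) I = ?t (sum v I)" for I
    by (simp add: prod_eq_iff fst_sum snd_sum bet_commute[of m _ A] bet_sum_right)
  have SV: "twisted_nonzero m A \<subseteq> V" using V unfolding twisted_nonzero_def by blast
  have "twisted_nonzero m A = ?t ` (words m - {0})"
  proof (intro equalityI subsetI)
    fix x assume "x \<in> twisted_nonzero m A"
    then have "x = ?t (snd x)" "snd x \<in> words m - {0}" by (simp_all add: twisted_nonzero_def prod_eq_iff)
    then show "x \<in> ?t ` (words m - {0})" by (rule image_eqI)
  next
    fix x assume "x \<in> ?t ` (words m - {0})"
    then obtain u where "u \<in> words m - {0}" "x = ?t u" by blast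
    then show "x \<in> twisted_nonzero m A" by (simp add: twisted_nonzero_def)
  qed
  moreover have "inj_on ?t (words m - {0})" by (simp add: inj_on_def)
  ultimately have t: "bij_betw ?t (words m - {0}) (twisted_nonzero m A)"
    by (simp add: bij_betw_def)
  obtain j where "m = 2 * j" using m by (rule evenE)
  then have "r + s = 1 + 4 * j" using n by simp
  then have n4: "(r + s) mod 4 = 1" by simp
  from bij_betw_trans[OF lie_indices_nonzero_bij[OF v n n4] t]
  have bij: "bij_betw (sum (\<lambda>i. ?t (v i))) (lie_indices (r + s)) (twisted_nonzero m A)"
    unfolding sum comp_def by simp
  show ?thesis
    unfolding pauli_lie_def
    by (rule matrix_lie_iso[where w = "\<lambda>i. ?t (v i)", OF w _ SV bij refl]) (simp_all add: v)
qed

text \<open>Here the product of all generators is $\pm i$: the words sum up to 0, and the factor $i$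
  at position $k$ remains. So the Clifford algebra is the full complex matrix algebra, and the
  products are told apart by the bit.\<close>

lemma central_iso:
  assumes F: "frame A B m (r - 1) s \<or> frame A B m r (s - 1)"
    and n: "r + s = 2 * m + 1" and pos: "1 \<le> r" "1 \<le> s" and r: "odd (r + m)"
    and B: "\<And>u. \<kappa> * bet m u A + qf m B' u = qf m B u" and m: "of_nat m + \<kappa> = 1"
    and V: "{x. snd x \<in> words m} \<subseteq> V"
  shows "H_lie r s \<cong>\<^sub>L pauli_lie \<iota> m {x \<in> central_grades m \<kappa> B'. \<not> ((r + s) mod 4 = 1 \<and> x = (1, 0))}"
proof -
  have c: "of_nat (r + m) = (1 :: bit)" using r by (simp only: of_nat_bit) simp
  obtain v k where v: "anticommuting_family (r + s) m v" and k: "k \<in> {1..r + s}"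
    and qA: "\<And>i. i \<in> {1..r + s} \<Longrightarrow> qf m A (v i) + (if i = k then 1 else 0) = (if i \<le> r then 1 else 0)"
    and qB: "\<And>i. i \<in> {1..r + s} \<Longrightarrow> qf m B (v i) = (if i = k then of_nat m else 1)"
    using frame_odd_family[OF F n pos c] by blast
  define w where "w = (\<lambda>i. (bet m (v i) A + (if i = k then 1 else 0), v i))"
  have sw: "snd (w i) = v i" for i by (simp add: w_def)
  have wV: "w i \<in> V \<and> fst (w i) + gam m (snd (w i)) (snd (w i)) = (if i \<le> r then 1 else 0)"
    if i: "i \<in> {1..r + s}" for i
  proof
    show "w i \<in> V" using V anticommuting_familyD(1)[OF v i] sw by auto
    show "fst (w i) + gam m (snd (w i)) (snd (w i)) = (if i \<le> r then 1 else 0)"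
      unfolding qA[OF i, symmetric] qf_def w_def fst_conv snd_conv by (simp only: ac_simps)
  qed
  have t: "\<kappa> * fst (w i) + qf m B' (snd (w i)) = 1" if i: "i \<in> {1..r + s}" for i
  proof -
    have "\<kappa> * fst (w i) + qf m B' (snd (w i)) = qf m B (v i) + \<kappa> * (if i = k then 1 else 0)"
      unfolding B[symmetric] w_def fst_conv snd_conv distrib_left by (simp only: ac_simps)
    then show ?thesis using qB[OF i] m by simp
  qed
  have "(\<Sum>i = 1..r + s. fst (w i)) = bet m (sum v {1..r + s}) A + (\<Sum>i = 1..r + s. if i = k then 1 else 0)"
    unfolding w_def by (simp add: sum.distrib bet_commute[of m _ A] bet_sum_right)
  then have full: "(\<Sum>i = 1..r + s. fst (w i)) = 1"
    unfolding family_odd(1)[OF v n] using k by (simp add: sum.delta)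
  have v': "anticommuting_family (r + s) m (\<lambda>i. snd (w i))" using v by (simp add: sw)
  have S: "{x. snd x \<in> words m \<and> \<kappa> * fst x + qf m B' (snd x) = 1 \<and> \<not> ((r + s) mod 4 = 1 \<and> x = (1, 0))}
      = {x \<in> central_grades m \<kappa> B'. \<not> ((r + s) mod 4 = 1 \<and> x = (1, 0))}"
    by (auto simp: central_grades_def)
  note bij = lie_indices_central_bij[OF v' n t full, unfolded S]
  show ?thesis
    unfolding pauli_lie_def
    by (rule matrix_lie_iso[where w = w, OF wV v' _ bij refl]) (use V in \<open>auto simp: central_grades_def\<close>)
qed

text \<open>Here the product of all generators is a real scalar in either of two inequivalent
  representations, which differ in the sign of the generator at position $k$. Together they give a
  map into the product of two copies, whose extra bit is carried by that generator.\<close>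

lemma double_iso:
  assumes F: "frame A B m (r - 1) s"
    and n: "r + s = 2 * m + 1" and pos: "1 \<le> r" "1 \<le> s" and r: "even (r + m)" and m: "odd m"
    and V: "{x. fst x = bet m (snd x) A \<and> snd x \<in> words m} \<subseteq> V"
  shows "H_lie r s \<cong>\<^sub>L pauli_lie \<iota> m (twisted m A B) \<oplus>\<^sub>L pauli_lie \<iota> m (twisted m A B)"
proof -
  have c: "of_nat (r + m) = (0 :: bit)" using r by (simp only: of_nat_bit) simp
  have m1: "of_nat m = (1 :: bit)" using m by (simp only: of_nat_bit) simp
  obtain v k where v: "anticommuting_family (r + s) m v" and k: "k \<in> {1..r + s}"
    and qA: "\<And>i. i \<in> {1..r + s} \<Longrightarrow> qf m A (v i) + (if i = k then 0 else 0) = (if i \<le> r then 1 else 0)"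
    and qB: "\<And>i. i \<in> {1..r + s} \<Longrightarrow> qf m B (v i) = (if i = k then of_nat m else 1)"
    using frame_odd_family[OF disjI1[OF F] n pos c] by blast
  let ?d = "\<lambda>i. if i = k then 1 else 0 :: bit"
  let ?w = "\<lambda>i. (?d i, v i)" and ?t = "\<lambda>x :: bit \<times> pauli. (fst x, bet m (snd x) A, snd x)"
  have full: "(\<Sum>i = 1..r + s. fst (?w i)) = 1" using k by (simp add: sum.delta)
  obtain j where "m = 2 * j + 1" using m by (rule oddE)
  then have "r + s = 3 + 4 * j" using n by simp
  then have n4: "(r + s) mod 4 \<noteq> 1" by simp
  have "bij_betw (sum ?w) (lie_indices (r + s)) {x. snd x \<in> words m \<and> 0 * fst x + qf m B (snd x) = 1 \<and>
      \<not> ((r + s) mod 4 = 1 \<and> x = (1, 0))}"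
  proof (rule lie_indices_central_bij[OF _ n _ full])
    show "anticommuting_family (r + s) m (\<lambda>i. snd (?w i))" using v by simp
    show "0 * fst (?w i) + qf m B (snd (?w i)) = 1" if "i \<in> {1..r + s}" for i
      using qB[OF that] by (simp add: m1)
  qed
  moreover have "{x. snd x \<in> words m \<and> 0 * fst x + qf m B (snd x) = 1 \<and> \<not> ((r + s) mod 4 = 1 \<and> x = (1, 0))}
      = {x :: bit \<times> pauli. snd x \<in> words m \<and> qf m B (snd x) = 1}"
    using n4 by simp
  ultimately have b1: "bij_betw (sum ?w) (lie_indices (r + s)) {x. snd x \<in> words m \<and> qf m B (snd x) = 1}"
    by simp
  have SV: "twisted m A B \<subseteq> V" using V unfolding twisted_def by blast
  have "UNIV \<times> twisted m A B = ?t ` {x. snd x \<in> words m \<and> qf m B (snd x) = 1}"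
  proof (intro equalityI subsetI)
    fix x :: "bit \<times> bit \<times> pauli" assume "x \<in> UNIV \<times> twisted m A B"
    then have "x = ?t (fst x, snd (snd x))" "(fst x, snd (snd x)) \<in> {x. snd x \<in> words m \<and> qf m B (snd x) = 1}"
      by (simp_all add: twisted_def prod_eq_iff mem_Times_iff)
    then show "x \<in> ?t ` {x. snd x \<in> words m \<and> qf m B (snd x) = 1}" by (rule image_eqI)
  next
    fix x :: "bit \<times> bit \<times> pauli" assume "x \<in> ?t ` {x. snd x \<in> words m \<and> qf m B (snd x) = 1}"
    then obtain y where "snd y \<in> words m" "qf m B (snd y) = 1" "x = ?t y" by blast
    then show "x \<in> UNIV \<times> twisted m A B" by (simp add: twisted_def)
  qed
  moreover have "inj_on ?t {x. snd x \<in> words m \<and> qf m B (snd x) = 1}"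
    by (rule inj_onI) (simp add: prod_eq_iff)
  ultimately have "bij_betw ?t {x. snd x \<in> words m \<and> qf m B (snd x) = 1} (UNIV \<times> twisted m A B)"
    by (simp add: bij_betw_def)
  note b2 = bij_betw_trans[OF b1 this]
  have sum: "sum (\<lambda>i. ?t (?w i)) I = ?t (sum ?w I)" for I
    by (simp add: prod_eq_iff fst_sum snd_sum bet_commute[of m _ A] bet_sum_right)
  have bij: "bij_betw (sum (\<lambda>i. ?t (?w i))) (lie_indices (r + s)) (UNIV \<times> twisted m A B)"
    using b2 unfolding sum comp_def .
  have w: "snd (?t (?w i)) \<in> V \<and>
      fst (snd (?t (?w i))) + gam m (snd (snd (?t (?w i)))) (snd (snd (?t (?w i)))) = (if i \<le> r then 1 else 0)"
    if "i \<in> {1..r + s}" for i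
    using twisted_generator[OF V anticommuting_familyD(1)[OF v that], of "if i \<le> r then 1 else 0"] qA[OF that]
    by simp
  show ?thesis
    unfolding pauli_lie_def
  proof (rule matrix_lie_double_iso[where w = "\<lambda>i. ?t (?w i)", OF w _ SV bij refl])
    show "anticommuting_family (r + s) m (\<lambda>i. snd (snd (?t (?w i))))" using v by simp
  qed
qed

end

section \<open>Frames for each classical type\<close>

lemma frame_list_frame:
  assumes "frame_list a b m ws" and "length (filter (\<lambda>w. lqf a w = 1) ws) = r"
    and "length (filter (\<lambda>w. lqf a w = 0) ws) = s"
  shows "frame (of_letters a) (of_letters b) m r s"
  using frame_list_frame_set[OF assms(1)] assms(2,3) unfolding frame_def by blast

text \<open>A single seed of length at most 5 yields all frames of the lengths congruent to its own
  modulo 4, for two residues of $s$ modulo 4.\<close>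

lemma frame_class:
  assumes base: "frame (of_letters a) (of_letters b) m\<^sub>0 r\<^sub>0 s\<^sub>0" and "length a \<le> m\<^sub>0" "length b \<le> m\<^sub>0"
    and "1 \<le> r\<^sub>0" "1 \<le> s\<^sub>0" "r\<^sub>0 + s\<^sub>0 = 2 * m\<^sub>0"
    and n: "r + s = 2 * m" "3 \<le> m" "1 \<le> r" "1 \<le> s" and m: "m mod 4 = m\<^sub>0 mod 4" "m\<^sub>0 \<le> 5"
    and s: "s mod 4 \<in> {s\<^sub>0 mod 4, (2 * m\<^sub>0 + 1 + 3 * s\<^sub>0) mod 4}"
  shows "frame (of_letters a) (of_letters b) m r s"
proof -
  have le: "m\<^sub>0 \<le> m"
  proof (rule ccontr)
    assume "\<not> m\<^sub>0 \<le> m"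
    then have "(m = 3 \<or> m = 4) \<and> (m\<^sub>0 = 4 \<or> m\<^sub>0 = 5) \<and> m < m\<^sub>0" using n(2) m(2) by auto
    then show False using m(1) by auto
  qed
  obtain k where k: "m = m\<^sub>0 + 4 * k" using mod_eq_nat1E[OF m(1) le] by blast
  have "(r + s + 1) mod 4 = (2 * m\<^sub>0 + 1) mod 4"
  proof -
    have "r + s + 1 = (2 * m\<^sub>0 + 1) + 4 * (2 * k)" using n(1) k by simp
    then show ?thesis by (simp only: mod_mult_self2)
  qed
  then have "s mod 4 = s\<^sub>0 mod 4 \<or> (s + s\<^sub>0) mod 4 = (r + s + 1) mod 4"
  proof -
    have "(s + s\<^sub>0) mod 4 = (2 * m\<^sub>0 + 1) mod 4" if "s mod 4 = (2 * m\<^sub>0 + 1 + 3 * s\<^sub>0) mod 4"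
    proof -
      have "(s + s\<^sub>0) mod 4 = (2 * m\<^sub>0 + 1 + 3 * s\<^sub>0 + s\<^sub>0) mod 4"
        using that by (rule mod_add_cong) (rule refl)
      also have "2 * m\<^sub>0 + 1 + 3 * s\<^sub>0 + s\<^sub>0 = (2 * m\<^sub>0 + 1) + 4 * s\<^sub>0" by simp
      finally show ?thesis by (simp only: mod_mult_self2)
    qed
    moreover note s \<open>(r + s + 1) mod 4 = (2 * m\<^sub>0 + 1) mod 4\<close>
    ultimately show ?thesis by (metis insertE singletonD)
  qed
  moreover have "6 \<le> r + s" using n by simp
  ultimately show ?thesis
    using frame_series[OF base of_letters_words[OF assms(2)] of_letters_words[OF assms(3)] assms(4,5) n(3,4)
      _ assms(6) k n(1)] by blast
qed

text \<open>The parameters are dictated by the descriptions of the classical Lie algebras above; for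
  each of them explicit seeds are listed, one for every length modulo 4 that is needed. Their
  entries are verified by computation.\<close>

lemma frame_so_pq:
  assumes "r + s = 2 * m" "3 \<le> m" "1 \<le> r" "1 \<le> s"
    and "(m mod 4 = 0 \<and> s mod 4 \<in> {0, 1}) \<or> (m mod 4 = 3 \<and> s mod 4 \<in> {0, 3})"
  shows "frame (of_letters []) (of_letters [LZ]) m r s"
proof -
  have f8: "frame (of_letters []) (of_letters [LZ]) 4 4 4"
    by (rule frame_list_frame[where ws = "[[LI,LI,LI,LY], [LI,LI,LY,LX], [LI,LX,LY,LZ], [LI,LZ,LY,LZ],
      [LX,LY,LY,LZ], [LY,LY,LI,LZ], [LY,LY,LX,LX], [LY,LY,LZ,LX]]"]) (simp_all add: frame_list_simps)
  have f6: "frame (of_letters []) (of_letters [LZ]) 3 3 3"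
    by (rule frame_list_frame[where ws = "[[LI,LI,LY], [LI,LY,LX], [LZ,LY,LZ], [LX,LI,LZ], [LX,LX,LX], [LX,LZ,LX]]"])
      (simp_all add: frame_list_simps)
  show ?thesis
    using assms(5)
  proof (elim disjE conjE)
    assume "m mod 4 = 0" "s mod 4 \<in> {0, 1}"
    then show ?thesis by (intro frame_class[OF f8 _ _ _ _ _ assms(1-4)]) simp_all
  next
    assume "m mod 4 = 3" "s mod 4 \<in> {0, 3}"
    then show ?thesis by (intro frame_class[OF f6 _ _ _ _ _ assms(1-4)]) (simp_all add: disj_commute)
  qed
qed

lemma frame_so_star:
  assumes "r + s = 2 * m" "3 \<le> m" "1 \<le> r" "1 \<le> s"
    and "(m mod 4 = 0 \<and> s mod 4 \<in> {2, 3}) \<or> (m mod 4 = 3 \<and> s mod 4 \<in> {1, 2})"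
  shows "frame (of_letters [LY]) (of_letters []) m r s"
proof -
  have f8: "frame (of_letters [LY]) (of_letters []) 4 6 2"
    by (rule frame_list_frame[where ws = "[[LI,LI,LI,LY], [LI,LI,LY,LX], [LI,LX,LY,LZ], [LI,LZ,LY,LZ],
      [LI,LY,LI,LZ], [LI,LY,LX,LX], [LX,LY,LZ,LX], [LZ,LY,LZ,LX]]"]) (simp_all add: frame_list_simps)
  have f6: "frame (of_letters [LY]) (of_letters []) 3 4 2"
    by (rule frame_list_frame[where ws = "[[LI,LI,LY], [LI,LY,LX], [LY,LI,LZ], [LY,LX,LX], [LX,LY,LZ], [LZ,LY,LZ]]"])
      (simp_all add: frame_list_simps)
  show ?thesis
    using assms(5)
  proof (elim disjE conjE)
    assume "m mod 4 = 0" "s mod 4 \<in> {2, 3}"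
    then show ?thesis by (intro frame_class[OF f8 _ _ _ _ _ assms(1-4)]) simp_all
  next
    assume "m mod 4 = 3" "s mod 4 \<in> {1, 2}"
    then show ?thesis by (intro frame_class[OF f6 _ _ _ _ _ assms(1-4)]) (simp_all add: disj_commute)
  qed
qed

lemma frame_sp_real:
  assumes "r + s = 2 * m" "3 \<le> m" "1 \<le> r" "1 \<le> s"
    and "(m mod 4 = 1 \<and> s mod 4 \<in> {1, 2}) \<or> (m mod 4 = 2 \<and> s mod 4 \<in> {2, 3})"
  shows "frame (of_letters []) (of_letters [LY]) m r s"
proof -
  have f2: "frame (of_letters []) (of_letters [LY]) 1 1 1"
    by (rule frame_list_frame[where ws = "[[LY], [LX]]"]) (simp_all add: frame_list_simps)
  have f4: "frame (of_letters []) (of_letters [LY]) 2 2 2"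
    by (rule frame_list_frame[where ws = "[[LI,LY], [LY,LX], [LX,LX], [LZ,LX]]"]) (simp_all add: frame_list_simps)
  show ?thesis
    using assms(5)
  proof (elim disjE conjE)
    assume "m mod 4 = 1" "s mod 4 \<in> {1, 2}"
    then show ?thesis by (intro frame_class[OF f2 _ _ _ _ _ assms(1-4)]) simp_all
  next
    assume "m mod 4 = 2" "s mod 4 \<in> {2, 3}"
    then show ?thesis by (intro frame_class[OF f4 _ _ _ _ _ assms(1-4)]) (simp_all add: disj_commute)
  qed
qed

lemma frame_sp_pq:
  assumes "r + s = 2 * m" "3 \<le> m" "1 \<le> r" "1 \<le> s"
    and "(m mod 4 = 1 \<and> s mod 4 \<in> {0, 3}) \<or> (m mod 4 = 2 \<and> s mod 4 \<in> {0, 1})"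
  shows "frame (of_letters [LY, LZ]) (of_letters [LY]) m r s"
proof -
  have f10: "frame (of_letters [LY, LZ]) (of_letters [LY]) 5 6 4"
    by (rule frame_list_frame[where ws = "[[LI,LI,LI,LI,LY], [LI,LI,LI,LY,LX], [LI,LI,LX,LY,LZ], [LI,LI,LZ,LY,LZ],
      [LI,LI,LY,LI,LZ], [LI,LI,LY,LX,LX], [LI,LX,LY,LZ,LX], [LX,LY,LY,LZ,LX], [LZ,LY,LY,LZ,LX], [LY,LY,LY,LZ,LX]]"])
      (simp_all add: frame_list_simps)
  have f4: "frame (of_letters [LY, LZ]) (of_letters [LY]) 2 3 1"
    by (rule frame_list_frame[where ws = "[[LX,LI], [LZ,LI], [LY,LZ], [LY,LX]]"]) (simp_all add: frame_list_simps)
  show ?thesis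
    using assms(5)
  proof (elim disjE conjE)
    assume "m mod 4 = 1" "s mod 4 \<in> {0, 3}"
    then show ?thesis by (intro frame_class[OF f10 _ _ _ _ _ assms(1-4)]) simp_all
  next
    assume "m mod 4 = 2" "s mod 4 \<in> {0, 1}"
    then show ?thesis by (intro frame_class[OF f4 _ _ _ _ _ assms(1-4)]) (simp_all add: disj_commute)
  qed
qed

text \<open>For these lengths the unitary case requires a seed of its own: with $A = X$ and $B = Y =
  X + Z$, the form belonging to $A + B = Z$, which defines $I_{p,p}$, is the one obtained after the
  bit has been taken into account.\<close>

lemma frame_su_pq:
  assumes "r + s = 2 * m" "3 \<le> m" "1 \<le> r" "1 \<le> s" and "m mod 4 = 2 \<and> s mod 4 \<in> {2, 3}"
  shows "frame (of_letters [LX]) (of_letters [LY]) m r s"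
proof -
  have f4: "frame (of_letters [LX]) (of_letters [LY]) 2 2 2"
    by (rule frame_list_frame[where ws = "[[LI,LY], [LZ,LX], [LX,LX], [LY,LX]]"]) (simp_all add: frame_list_simps)
  show ?thesis
    using assms(5) frame_class[OF f4 _ _ _ _ _ assms(1-4)] by auto
qed

lemma frame_su_star:
  assumes "r + s = 2 * m" "3 \<le> m" "1 \<le> r" "1 \<le> s" and "m mod 4 = 2 \<and> s mod 4 \<in> {0, 1}"
  shows "frame (of_letters [LY]) (of_letters [LY, LZ]) m r s"
proof -
  have f4: "frame (of_letters [LY]) (of_letters [LY, LZ]) 2 3 1"
    by (rule frame_list_frame[where ws = "[[LX,LI], [LZ,LI], [LY,LZ], [LY,LY]]"]) (simp_all add: frame_list_simps)
  show ?thesis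
    using assms(5) frame_class[OF f4 _ _ _ _ _ assms(1-4)] by auto
qed

section \<open>The classification\<close>

lemma even_mod_four_iff: "even (x mod 4) \<longleftrightarrow> even x" for x :: nat
  by (simp add: dvd_mod_iff)

lemma mod_four_pred: "1 \<le> s \<Longrightarrow> (s - 1) mod 4 = (s mod 4 + 3) mod 4" for s :: nat
proof -
  assume "1 \<le> s"
  then have "s + 3 = (s - 1) + 4" by simp
  then show ?thesis by (metis mod_add_left_eq mod_add_self2)
qed

lemma odd_parity:
  fixes r s M :: nat
  assumes "r + s = 2 * M + 1"
  shows "even (r + M) \<longleftrightarrow> even M \<noteq> even (s mod 4)"
proof -
  have "odd (r + s)" unfolding assms by simp
  then show ?thesis unfolding even_mod_four_iff even_add by blast
qed

lemma real_twisted: "{x. fst x = bet m (snd x) (of_letters []) \<and> snd x \<in> words m} \<subseteq> real_grades m"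
  by (auto simp: real_grades_def)

lemma complex_twisted: "{x. fst x = bet m (snd x) A \<and> snd x \<in> words m} \<subseteq> complex_grades m"
  by (auto simp: complex_grades_def)

lemma complex_words: "{x. snd x \<in> words m} \<subseteq> complex_grades m"
  by (simp add: complex_grades_def)

lemma so_pq_iso:
  assumes "3 \<le> r" "3 \<le> s" and n: "r + s = 2 * M" and c: "(M mod 4 = 0 \<and> s mod 4 \<in> {0, 1}) \<or> (M mod 4 = 3 \<and> s mod 4 \<in> {0, 3})"
  shows "H_lie r s \<cong>\<^sub>L so_pq (2 ^ (M - 1)) (2 ^ (M - 1))"
proof -
  have M: "Suc (M - 1) = M" using n assms(1,2) by simp
  have "3 \<le> M" "1 \<le> r" "1 \<le> s" using n assms(1,2) by simp_all
  from pauli_alg.even_iso[OF real_pauli_alg frame_so_pq[OF n this c] n real_twisted]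
  show ?thesis unfolding so_pq_pauli[of "M - 1"] M by simp
qed

lemma so_pq_double_iso:
  assumes "3 \<le> r" "3 \<le> s" and n: "r + s = 2 * M + 1" and c: "M mod 4 = 3 \<and> s mod 4 = 0"
  shows "H_lie r s \<cong>\<^sub>L so_pq (2 ^ (M - 1)) (2 ^ (M - 1)) \<oplus>\<^sub>L so_pq (2 ^ (M - 1)) (2 ^ (M - 1))"
proof -
  have M: "Suc (M - 1) = M" using n assms(1,2) by simp
  have p: "(r - 1) + s = 2 * M" "3 \<le> M" "1 \<le> r - 1" "1 \<le> s" "1 \<le> r" using n assms(1,2) by simp_all
  have "odd M" "even (r + M)" using even_mod_four_iff[of M] odd_parity[OF n] c by simp_all
  moreover have F: "frame (of_letters []) (of_letters [LZ]) M (r - 1) s"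
    by (rule frame_so_pq[OF p(1-4)]) (use c in simp)
  ultimately show ?thesis
    using pauli_alg.double_iso[OF real_pauli_alg F n p(5,4) _ _ real_twisted]
    unfolding so_pq_pauli[of "M - 1"] M by simp
qed

lemma so_star_iso:
  assumes "3 \<le> r" "3 \<le> s" and n: "r + s = 2 * M" and c: "(M mod 4 = 0 \<and> s mod 4 \<in> {2, 3}) \<or> (M mod 4 = 3 \<and> s mod 4 \<in> {1, 2})"
  shows "H_lie r s \<cong>\<^sub>L so_star (2 ^ M)"
proof -
  have M: "Suc (M - 1) = M" using n assms(1,2) by simp
  have "3 \<le> M" "1 \<le> r" "1 \<le> s" using n assms(1,2) by simp_all
  from pauli_alg.even_iso[OF complex_pauli_alg frame_so_star[OF n this c] n complex_twisted]
  show ?thesis unfolding so_star_pauli[of "M - 1", unfolded M] M by simp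
qed

lemma so_star_double_iso:
  assumes "3 \<le> r" "3 \<le> s" and n: "r + s = 2 * M + 1" and c: "M mod 4 = 3 \<and> s mod 4 = 2"
  shows "H_lie r s \<cong>\<^sub>L so_star (2 ^ M) \<oplus>\<^sub>L so_star (2 ^ M)"
proof -
  have M: "Suc (M - 1) = M" using n assms(1,2) by simp
  have p: "(r - 1) + s = 2 * M" "3 \<le> M" "1 \<le> r - 1" "1 \<le> s" "1 \<le> r" using n assms(1,2) by simp_all
  have "odd M" "even (r + M)" using even_mod_four_iff[of M] odd_parity[OF n] c by simp_all
  moreover have F: "frame (of_letters [LY]) (of_letters []) M (r - 1) s"
    by (rule frame_so_star[OF p(1-4)]) (use c in simp)
  ultimately show ?thesis
    using pauli_alg.double_iso[OF complex_pauli_alg F n p(5,4) _ _ complex_twisted]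
    unfolding so_star_pauli[of "M - 1", unfolded M] M by simp
qed

lemma sp_real_iso:
  assumes "3 \<le> r" "3 \<le> s" and n: "r + s = 2 * M" and c: "(M mod 4 = 1 \<and> s mod 4 \<in> {1, 2}) \<or> (M mod 4 = 2 \<and> s mod 4 \<in> {2, 3})"
  shows "H_lie r s \<cong>\<^sub>L sp_real (2 ^ (M - 1))"
proof -
  have M: "Suc (M - 1) = M" using n assms(1,2) by simp
  have "3 \<le> M" "1 \<le> r" "1 \<le> s" using n assms(1,2) by simp_all
  from pauli_alg.even_iso[OF real_pauli_alg frame_sp_real[OF n this c] n real_twisted]
  show ?thesis unfolding sp_real_pauli[of "M - 1"] M by simp
qed

lemma sp_real_double_iso:
  assumes "3 \<le> r" "3 \<le> s" and n: "r + s = 2 * M + 1" and c: "M mod 4 = 1 \<and> s mod 4 = 2"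
  shows "H_lie r s \<cong>\<^sub>L sp_real (2 ^ (M - 1)) \<oplus>\<^sub>L sp_real (2 ^ (M - 1))"
proof -
  have M: "Suc (M - 1) = M" using n assms(1,2) by simp
  have p: "(r - 1) + s = 2 * M" "3 \<le> M" "1 \<le> r - 1" "1 \<le> s" "1 \<le> r" using n assms(1,2) by simp_all
  have "odd M" "even (r + M)" using even_mod_four_iff[of M] odd_parity[OF n] c by simp_all
  moreover have F: "frame (of_letters []) (of_letters [LY]) M (r - 1) s"
    by (rule frame_sp_real[OF p(1-4)]) (use c in simp)
  ultimately show ?thesis
    using pauli_alg.double_iso[OF real_pauli_alg F n p(5,4) _ _ real_twisted]
    unfolding sp_real_pauli[of "M - 1"] M by simp
qed

lemma sp_pq_iso:
  assumes "3 \<le> r" "3 \<le> s" and n: "r + s = 2 * M" and c: "(M mod 4 = 1 \<and> s mod 4 \<in> {0, 3}) \<or> (M mod 4 = 2 \<and> s mod 4 \<in> {0, 1})"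
  shows "H_lie r s \<cong>\<^sub>L sp_pq (2 ^ (M - 2)) (2 ^ (M - 2))"
proof -
  have M: "Suc (Suc (M - 2)) = M" using n assms(1,2) by simp
  have "3 \<le> M" "1 \<le> r" "1 \<le> s" using n assms(1,2) by simp_all
  from pauli_alg.even_iso[OF complex_pauli_alg frame_sp_pq[OF n this c] n complex_twisted]
  show ?thesis unfolding sp_pq_pauli[of "M - 2"] M by simp
qed

lemma sp_pq_double_iso:
  assumes "3 \<le> r" "3 \<le> s" and n: "r + s = 2 * M + 1" and c: "M mod 4 = 1 \<and> s mod 4 = 0"
  shows "H_lie r s \<cong>\<^sub>L sp_pq (2 ^ (M - 2)) (2 ^ (M - 2)) \<oplus>\<^sub>L sp_pq (2 ^ (M - 2)) (2 ^ (M - 2))"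
proof -
  have M: "Suc (Suc (M - 2)) = M" using n assms(1,2) by simp
  have p: "(r - 1) + s = 2 * M" "3 \<le> M" "1 \<le> r - 1" "1 \<le> s" "1 \<le> r" using n assms(1,2) by simp_all
  have "odd M" "even (r + M)" using even_mod_four_iff[of M] odd_parity[OF n] c by simp_all
  moreover have F: "frame (of_letters [LY, LZ]) (of_letters [LY]) M (r - 1) s"
    by (rule frame_sp_pq[OF p(1-4)]) (use c in simp)
  ultimately show ?thesis
    using pauli_alg.double_iso[OF complex_pauli_alg F n p(5,4) _ _ complex_twisted]
    unfolding sp_pq_pauli[of "M - 2"] M by simp
qed

lemma sl_real_iso:
  assumes "3 \<le> r" "3 \<le> s" and n: "r + s = 2 * M + 1" and c: "(M mod 4 = 0 \<and> s mod 4 = 1) \<or> (M mod 4 = 2 \<and> s mod 4 = 3)"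
  shows "H_lie r s \<cong>\<^sub>L sl_real (2 ^ M)"
proof -
  have M: "Suc (M - 1) = M" using n assms(1,2) by simp
  have p: "(r - 1) + s = 2 * M" "3 \<le> M" "1 \<le> r - 1" "1 \<le> s" "1 \<le> r" using n assms(1,2) by simp_all
  have e: "even M" "even (r + M)" using even_mod_four_iff[of M] odd_parity[OF n] c by auto
  show ?thesis
    using c
  proof (elim disjE conjE)
    assume "M mod 4 = 0" "s mod 4 = 1"
    then have F: "frame (of_letters []) (of_letters [LZ]) M (r - 1) s" by (intro frame_so_pq[OF p(1-4)]) simp
    show ?thesis
      using pauli_alg.nonzero_iso[OF real_pauli_alg F n p(5,4) e(2,1) real_twisted]
      unfolding sl_real_pauli[of M] M by simp
  next
    assume "M mod 4 = 2" "s mod 4 = 3"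
    then have F: "frame (of_letters []) (of_letters [LY]) M (r - 1) s" by (intro frame_sp_real[OF p(1-4)]) simp
    show ?thesis
      using pauli_alg.nonzero_iso[OF real_pauli_alg F n p(5,4) e(2,1) real_twisted]
      unfolding sl_real_pauli[of M] M by simp
  qed
qed

lemma su_star_iso:
  assumes "3 \<le> r" "3 \<le> s" and n: "r + s = 2 * M + 1" and c: "(M mod 4 = 0 \<and> s mod 4 = 3) \<or> (M mod 4 = 2 \<and> s mod 4 = 1)"
  shows "H_lie r s \<cong>\<^sub>L su_star (2 ^ M)"
proof -
  have M: "Suc (M - 1) = M" using n assms(1,2) by simp
  have p: "(r - 1) + s = 2 * M" "3 \<le> M" "1 \<le> r - 1" "1 \<le> s" "1 \<le> r" using n assms(1,2) by simp_all
  have e: "even M" "even (r + M)" using even_mod_four_iff[of M] odd_parity[OF n] c by auto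
  show ?thesis
    using c
  proof (elim disjE conjE)
    assume "M mod 4 = 0" "s mod 4 = 3"
    then have F: "frame (of_letters [LY]) (of_letters []) M (r - 1) s" by (intro frame_so_star[OF p(1-4)]) simp
    show ?thesis
      using pauli_alg.nonzero_iso[OF complex_pauli_alg F n p(5,4) e(2,1) complex_twisted]
      unfolding su_star_pauli[of "M - 1", unfolded M] M by simp
  next
    assume "M mod 4 = 2" "s mod 4 = 1"
    then have F: "frame (of_letters [LY]) (of_letters [LY, LZ]) M (r - 1) s" by (intro frame_su_star[OF p(1-4)]) simp
    show ?thesis
      using pauli_alg.nonzero_iso[OF complex_pauli_alg F n p(5,4) e(2,1) complex_twisted]
      unfolding su_star_pauli[of "M - 1", unfolded M] M by simp
  qed
qed

lemma so_complex_iso: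
  assumes "3 \<le> r" "3 \<le> s" and n: "r + s = 2 * M + 1" and c: "M mod 4 = 3 \<and> s mod 4 \<in> {1, 3}"
  shows "H_lie r s \<cong>\<^sub>L so_complex (2 ^ M)"
proof -
  have M: "Suc (M - 1) = M" using n assms(1,2) by simp
  have p: "(r - 1) + s = 2 * M" "r + (s - 1) = 2 * M" "3 \<le> M" "1 \<le> r - 1" "1 \<le> s - 1" "1 \<le> r" "1 \<le> s"
    using n assms(1,2) by simp_all
  have s: "(s - 1) mod 4 = (s mod 4 + 3) mod 4" by (rule mod_four_pred[OF p(7)])
  have F: "frame (of_letters [LY]) (of_letters []) M (r - 1) s \<or> frame (of_letters [LY]) (of_letters []) M r (s - 1)"
    using c
  proof (elim conjE insertE emptyE)
    assume "M mod 4 = 3" "s mod 4 = 1"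
    then have "frame (of_letters [LY]) (of_letters []) M (r - 1) s" by (intro frame_so_star[OF p(1,3,4,7)]) simp
    then show ?thesis ..
  next
    assume "M mod 4 = 3" "s mod 4 = 3"
    moreover from this have "(s - 1) mod 4 = 2" unfolding s by simp
    ultimately have "frame (of_letters [LY]) (of_letters []) M r (s - 1)" by (intro frame_so_star[OF p(2,3,6,5)]) simp
    then show ?thesis ..
  qed
  have e: "odd M" "odd (r + M)" using even_mod_four_iff[of M] odd_parity[OF n] c by auto
  obtain j where "M = 2 * j + 1" using e(1) by (rule oddE)
  then have "r + s = 3 + 4 * j" using n by simp
  then have n4: "(r + s) mod 4 \<noteq> 1" by simp
  have "of_nat M + 0 = (1 :: bit)" using e(1) by (simp add: of_nat_bit)
  from pauli_alg.central_iso[OF complex_pauli_alg F n p(6,7) e(2) _ this complex_words, of "of_letters []"]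
  show ?thesis
    unfolding so_complex_pauli[of M] M using n4 by simp
qed

lemma sp_complex_iso:
  assumes "3 \<le> r" "3 \<le> s" and n: "r + s = 2 * M + 1" and c: "M mod 4 = 1 \<and> s mod 4 \<in> {1, 3}"
  shows "H_lie r s \<cong>\<^sub>L sp_complex (2 ^ (M - 1))"
proof -
  have M: "Suc (M - 1) = M" using n assms(1,2) by simp
  have p: "(r - 1) + s = 2 * M" "r + (s - 1) = 2 * M" "3 \<le> M" "1 \<le> r - 1" "1 \<le> s - 1" "1 \<le> r" "1 \<le> s"
    using n assms(1,2) by simp_all
  have s: "(s - 1) mod 4 = (s mod 4 + 3) mod 4" by (rule mod_four_pred[OF p(7)])
  have F: "frame (of_letters []) (of_letters [LY]) M (r - 1) s \<or> frame (of_letters []) (of_letters [LY]) M r (s - 1)"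
    using c
  proof (elim conjE insertE emptyE)
    assume "M mod 4 = 1" "s mod 4 = 1"
    then have "frame (of_letters []) (of_letters [LY]) M (r - 1) s" by (intro frame_sp_real[OF p(1,3,4,7)]) simp
    then show ?thesis ..
  next
    assume "M mod 4 = 1" "s mod 4 = 3"
    moreover from this have "(s - 1) mod 4 = 2" unfolding s by simp
    ultimately have "frame (of_letters []) (of_letters [LY]) M r (s - 1)" by (intro frame_sp_real[OF p(2,3,6,5)]) simp
    then show ?thesis ..
  qed
  have e: "odd M" "odd (r + M)" using even_mod_four_iff[of M] odd_parity[OF n] c by auto
  obtain j where "M = 2 * j + 1" using e(1) by (rule oddE)
  then have "r + s = 3 + 4 * j" using n by simp
  then have n4: "(r + s) mod 4 \<noteq> 1" by simp
  have "of_nat M + 0 = (1 :: bit)" using e(1) by (simp add: of_nat_bit)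
  from pauli_alg.central_iso[OF complex_pauli_alg F n p(6,7) e(2) _ this complex_words, of "of_letters [LY]"]
  show ?thesis
    unfolding sp_complex_pauli[of "M - 1"] M using n4 by simp
qed

text \<open>The two residues of $s$ differ in whether the additional generator, the product of the
  others, counts towards $r$ or towards $s$.\<close>

lemma su_pq_zero_iso:
  assumes "3 \<le> r" "3 \<le> s" and n: "r + s = 2 * M + 1" and c: "M mod 4 = 0 \<and> s mod 4 \<in> {0, 2}"
  shows "H_lie r s \<cong>\<^sub>L su_pq (2 ^ (M - 1)) (2 ^ (M - 1))"
proof -
  have M: "Suc (M - 1) = M" using n assms(1,2) by simp
  have p: "(r - 1) + s = 2 * M" "r + (s - 1) = 2 * M" "3 \<le> M" "1 \<le> r - 1" "1 \<le> s - 1" "1 \<le> r" "1 \<le> s"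
    using n assms(1,2) by simp_all
  have s: "(s - 1) mod 4 = (s mod 4 + 3) mod 4" by (rule mod_four_pred[OF p(7)])
  have F: "frame (of_letters []) (of_letters [LZ]) M (r - 1) s \<or> frame (of_letters []) (of_letters [LZ]) M r (s - 1)"
    using c
  proof (elim conjE insertE emptyE)
    assume "M mod 4 = 0" "s mod 4 = 0"
    then have "frame (of_letters []) (of_letters [LZ]) M (r - 1) s" by (intro frame_so_pq[OF p(1,3,4,7)]) simp
    then show ?thesis ..
  next
    assume "M mod 4 = 0" "s mod 4 = 2"
    moreover from this have "(s - 1) mod 4 = 1" unfolding s by simp
    ultimately have "frame (of_letters []) (of_letters [LZ]) M r (s - 1)" by (intro frame_so_pq[OF p(2,3,6,5)]) simp
    then show ?thesis ..
  qed
  have e: "even M" "odd (r + M)" using even_mod_four_iff[of M] odd_parity[OF n] c by auto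
  obtain j where "M = 2 * j" using e(1) by (rule evenE)
  then have "r + s = 1 + 4 * j" using n by simp
  then have n4: "(r + s) mod 4 = 1" by simp
  have m: "of_nat M + 1 = (1 :: bit)" using e(1) by (simp add: of_nat_bit)
  have B: "1 * bet M u (of_letters []) + qf M (of_letters [LZ]) u = qf M (of_letters [LZ]) u" for u
    by simp
  have "{x \<in> S. \<not> x = (1, 0)} = S - {(1, 0)}" for S :: "(bit \<times> pauli) set" by blast
  then show ?thesis
    using pauli_alg.central_iso[OF complex_pauli_alg F n p(6,7) e(2) B m complex_words]
    unfolding su_pq_pauli[of "M - 1"] M using n4 by simp
qed

lemma su_pq_two_iso:
  assumes "3 \<le> r" "3 \<le> s" and n: "r + s = 2 * M + 1" and c: "M mod 4 = 2 \<and> s mod 4 \<in> {0, 2}"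
  shows "H_lie r s \<cong>\<^sub>L su_pq (2 ^ (M - 1)) (2 ^ (M - 1))"
proof -
  have M: "Suc (M - 1) = M" using n assms(1,2) by simp
  have p: "(r - 1) + s = 2 * M" "r + (s - 1) = 2 * M" "3 \<le> M" "1 \<le> r - 1" "1 \<le> s - 1" "1 \<le> r" "1 \<le> s"
    using n assms(1,2) by simp_all
  have s: "(s - 1) mod 4 = (s mod 4 + 3) mod 4" by (rule mod_four_pred[OF p(7)])
  have F: "frame (of_letters [LX]) (of_letters [LY]) M (r - 1) s \<or> frame (of_letters [LX]) (of_letters [LY]) M r (s - 1)"
    using c
  proof (elim conjE insertE emptyE)
    assume "M mod 4 = 2" "s mod 4 = 2"
    then have "frame (of_letters [LX]) (of_letters [LY]) M (r - 1) s" by (intro frame_su_pq[OF p(1,3,4,7)]) simp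
    then show ?thesis ..
  next
    assume "M mod 4 = 2" "s mod 4 = 0"
    moreover from this have "(s - 1) mod 4 = 3" unfolding s by simp
    ultimately have "frame (of_letters [LX]) (of_letters [LY]) M r (s - 1)" by (intro frame_su_pq[OF p(2,3,6,5)]) simp
    then show ?thesis ..
  qed
  have Y: "of_letters [LY] = of_letters [LX] + of_letters [LZ]"
    by (auto simp: of_letters_def pauli_eq_iff)
  have e: "even M" "odd (r + M)" using even_mod_four_iff[of M] odd_parity[OF n] c by auto
  obtain j where "M = 2 * j" using e(1) by (rule evenE)
  then have "r + s = 1 + 4 * j" using n by simp
  then have n4: "(r + s) mod 4 = 1" by simp
  have m: "of_nat M + 1 = (1 :: bit)" using e(1) by (simp add: of_nat_bit)
  have B: "1 * bet M u (of_letters [LX]) + qf M (of_letters [LZ]) u = qf M (of_letters [LY]) u" for u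
    by (simp add: qf_def Y bet_add_right add.left_commute)
  have "{x \<in> S. \<not> x = (1, 0)} = S - {(1, 0)}" for S :: "(bit \<times> pauli) set" by blast
  then show ?thesis
    using pauli_alg.central_iso[OF complex_pauli_alg F n p(6,7) e(2) B m complex_words]
    unfolding su_pq_pauli[of "M - 1"] M using n4 by simp
qed

lemma odd_mod_four: "odd s \<Longrightarrow> s mod 4 = 1 \<or> s mod 4 = 3" for s :: nat
proof -
  assume "odd s"
  then have "odd (s mod 4)" "s mod 4 < 4" by (simp_all add: even_mod_four_iff)
  moreover have "x = 1 \<or> x = 3" if "odd x" "x < 4" for x :: nat
  proof -
    have "x \<in> {0, 1, 2, 3}" using that(2) by auto
    then show ?thesis using that(1) by auto
  qed
  ultimately show ?thesis by blast
qed

theorem mainTheorem1: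
  fixes r s k :: nat
  assumes "r \<ge> 3" and "s \<ge> 3"
  shows
   "(r + s = 8 * k \<longrightarrow>
       (s mod 4 \<in> {0, 1} \<longrightarrow> H_lie r s \<cong>\<^sub>L so_pq (2 ^ (4 * k - 1)) (2 ^ (4 * k - 1))) \<and>
       (s mod 4 \<in> {2, 3} \<longrightarrow> H_lie r s \<cong>\<^sub>L so_star (2 ^ (4 * k)))) \<and>
    (r + s = 8 * k + 1 \<longrightarrow>
       (s mod 4 \<in> {0, 2} \<longrightarrow> H_lie r s \<cong>\<^sub>L su_pq (2 ^ (4 * k - 1)) (2 ^ (4 * k - 1))) \<and>
       (s mod 4 = 1 \<longrightarrow> H_lie r s \<cong>\<^sub>L sl_real (2 ^ (4 * k))) \<and>
       (s mod 4 = 3 \<longrightarrow> H_lie r s \<cong>\<^sub>L su_star (2 ^ (4 * k)))) \<and>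
    (r + s = 8 * k + 2 \<longrightarrow>
       (s mod 4 \<in> {0, 3} \<longrightarrow> H_lie r s \<cong>\<^sub>L sp_pq (2 ^ (4 * k - 1)) (2 ^ (4 * k - 1))) \<and>
       (s mod 4 \<in> {1, 2} \<longrightarrow> H_lie r s \<cong>\<^sub>L sp_real (2 ^ (4 * k)))) \<and>
    (r + s = 8 * k + 3 \<longrightarrow>
       (odd s \<longrightarrow> H_lie r s \<cong>\<^sub>L sp_complex (2 ^ (4 * k))) \<and>
       (s mod 4 = 0 \<longrightarrow> H_lie r s \<cong>\<^sub>L
          sp_pq (2 ^ (4 * k - 1)) (2 ^ (4 * k - 1)) \<oplus>\<^sub>L sp_pq (2 ^ (4 * k - 1)) (2 ^ (4 * k - 1))) \<and>
       (s mod 4 = 2 \<longrightarrow> H_lie r s \<cong>\<^sub>L sp_real (2 ^ (4 * k)) \<oplus>\<^sub>L sp_real (2 ^ (4 * k)))) \<and>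
    (r + s = 8 * k + 4 \<longrightarrow>
       (s mod 4 \<in> {0, 1} \<longrightarrow> H_lie r s \<cong>\<^sub>L sp_pq (2 ^ (4 * k)) (2 ^ (4 * k))) \<and>
       (s mod 4 \<in> {2, 3} \<longrightarrow> H_lie r s \<cong>\<^sub>L sp_real (2 ^ (4 * k + 1)))) \<and>
    (r + s = 8 * k + 5 \<longrightarrow>
       (s mod 4 \<in> {0, 2} \<longrightarrow> H_lie r s \<cong>\<^sub>L su_pq (2 ^ (4 * k + 1)) (2 ^ (4 * k + 1))) \<and>
       (s mod 4 = 1 \<longrightarrow> H_lie r s \<cong>\<^sub>L su_star (2 ^ (4 * k + 2))) \<and>
       (s mod 4 = 3 \<longrightarrow> H_lie r s \<cong>\<^sub>L sl_real (2 ^ (4 * k + 2)))) \<and>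
    (r + s = 8 * k + 6 \<longrightarrow>
       (s mod 4 \<in> {0, 3} \<longrightarrow> H_lie r s \<cong>\<^sub>L so_pq (2 ^ (4 * k + 2)) (2 ^ (4 * k + 2))) \<and>
       (s mod 4 \<in> {1, 2} \<longrightarrow> H_lie r s \<cong>\<^sub>L so_star (2 ^ (4 * k + 3)))) \<and>
    (r + s = 8 * k + 7 \<longrightarrow>
       (odd s \<longrightarrow> H_lie r s \<cong>\<^sub>L so_complex (2 ^ (4 * k + 3))) \<and>
       (s mod 4 = 0 \<longrightarrow> H_lie r s \<cong>\<^sub>L
          so_pq (2 ^ (4 * k + 2)) (2 ^ (4 * k + 2)) \<oplus>\<^sub>L so_pq (2 ^ (4 * k + 2)) (2 ^ (4 * k + 2))) \<and>
       (s mod 4 = 2 \<longrightarrow> H_lie r s \<cong>\<^sub>L so_star (2 ^ (4 * k + 3)) \<oplus>\<^sub>L so_star (2 ^ (4 * k + 3))))"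
proof (intro conjI impI)
  \<comment> \<open>The normal form of $4k + 2$ in terms of successors hides its residue.\<close>
  have two: "Suc (Suc (4 * k)) mod 4 = 2"
    using mod_mult_self2[of 2 4 k] by (simp only: add_2_eq_Suc) simp
  show "H_lie r s \<cong>\<^sub>L so_pq (2 ^ (4 * k - 1)) (2 ^ (4 * k - 1))" if "r + s = 8 * k" "s mod 4 \<in> {0, 1}"
    using so_pq_iso[OF assms, of "4 * k"] that by simp
  show "H_lie r s \<cong>\<^sub>L so_star (2 ^ (4 * k))" if "r + s = 8 * k" "s mod 4 \<in> {2, 3}"
    using so_star_iso[OF assms, of "4 * k"] that by simp
  show "H_lie r s \<cong>\<^sub>L su_pq (2 ^ (4 * k - 1)) (2 ^ (4 * k - 1))" if "r + s = 8 * k + 1" "s mod 4 \<in> {0, 2}"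
    using su_pq_zero_iso[OF assms, of "4 * k"] that by simp
  show "H_lie r s \<cong>\<^sub>L sl_real (2 ^ (4 * k))" if "r + s = 8 * k + 1" "s mod 4 = 1"
    using sl_real_iso[OF assms, of "4 * k"] that by simp
  show "H_lie r s \<cong>\<^sub>L su_star (2 ^ (4 * k))" if "r + s = 8 * k + 1" "s mod 4 = 3"
    using su_star_iso[OF assms, of "4 * k"] that by simp
  show "H_lie r s \<cong>\<^sub>L sp_pq (2 ^ (4 * k - 1)) (2 ^ (4 * k - 1))" if "r + s = 8 * k + 2" "s mod 4 \<in> {0, 3}"
    using sp_pq_iso[OF assms, of "4 * k + 1"] that by simp
  show "H_lie r s \<cong>\<^sub>L sp_real (2 ^ (4 * k))" if "r + s = 8 * k + 2" "s mod 4 \<in> {1, 2}"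
    using sp_real_iso[OF assms, of "4 * k + 1"] that by simp
  show "H_lie r s \<cong>\<^sub>L sp_complex (2 ^ (4 * k))" if "r + s = 8 * k + 3" "odd s"
    using sp_complex_iso[OF assms, of "4 * k + 1"] that odd_mod_four[of s] by simp
  show "H_lie r s \<cong>\<^sub>L sp_pq (2 ^ (4 * k - 1)) (2 ^ (4 * k - 1)) \<oplus>\<^sub>L sp_pq (2 ^ (4 * k - 1)) (2 ^ (4 * k - 1))" if "r + s = 8 * k + 3" "s mod 4 = 0"
    using sp_pq_double_iso[OF assms, of "4 * k + 1"] that by simp
  show "H_lie r s \<cong>\<^sub>L sp_real (2 ^ (4 * k)) \<oplus>\<^sub>L sp_real (2 ^ (4 * k))" if "r + s = 8 * k + 3" "s mod 4 = 2"
    using sp_real_double_iso[OF assms, of "4 * k + 1"] that by simp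
  show "H_lie r s \<cong>\<^sub>L sp_pq (2 ^ (4 * k)) (2 ^ (4 * k))" if "r + s = 8 * k + 4" "s mod 4 \<in> {0, 1}"
    using sp_pq_iso[OF assms, of "4 * k + 2"] that by (simp add: two)
  show "H_lie r s \<cong>\<^sub>L sp_real (2 ^ (4 * k + 1))" if "r + s = 8 * k + 4" "s mod 4 \<in> {2, 3}"
    using sp_real_iso[OF assms, of "4 * k + 2"] that by (simp add: two)
  show "H_lie r s \<cong>\<^sub>L su_pq (2 ^ (4 * k + 1)) (2 ^ (4 * k + 1))" if "r + s = 8 * k + 5" "s mod 4 \<in> {0, 2}"
    using su_pq_two_iso[OF assms, of "4 * k + 2"] that by (simp add: two)
  show "H_lie r s \<cong>\<^sub>L su_star (2 ^ (4 * k + 2))" if "r + s = 8 * k + 5" "s mod 4 = 1"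
    using su_star_iso[OF assms, of "4 * k + 2"] that by (simp add: two)
  show "H_lie r s \<cong>\<^sub>L sl_real (2 ^ (4 * k + 2))" if "r + s = 8 * k + 5" "s mod 4 = 3"
    using sl_real_iso[OF assms, of "4 * k + 2"] that by (simp add: two)
  show "H_lie r s \<cong>\<^sub>L so_pq (2 ^ (4 * k + 2)) (2 ^ (4 * k + 2))" if "r + s = 8 * k + 6" "s mod 4 \<in> {0, 3}"
    using so_pq_iso[OF assms, of "4 * k + 3"] that by simp
  show "H_lie r s \<cong>\<^sub>L so_star (2 ^ (4 * k + 3))" if "r + s = 8 * k + 6" "s mod 4 \<in> {1, 2}"
    using so_star_iso[OF assms, of "4 * k + 3"] that by simp
  show "H_lie r s \<cong>\<^sub>L so_complex (2 ^ (4 * k + 3))" if "r + s = 8 * k + 7" "odd s"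
    using so_complex_iso[OF assms, of "4 * k + 3"] that odd_mod_four[of s] by simp
  show "H_lie r s \<cong>\<^sub>L so_pq (2 ^ (4 * k + 2)) (2 ^ (4 * k + 2)) \<oplus>\<^sub>L so_pq (2 ^ (4 * k + 2)) (2 ^ (4 * k + 2))" if "r + s = 8 * k + 7" "s mod 4 = 0"
    using so_pq_double_iso[OF assms, of "4 * k + 3"] that by simp
  show "H_lie r s \<cong>\<^sub>L so_star (2 ^ (4 * k + 3)) \<oplus>\<^sub>L so_star (2 ^ (4 * k + 3))" if "r + s = 8 * k + 7" "s mod 4 = 2"
    using so_star_double_iso[OF assms, of "4 * k + 3"] that by simp
qed

end
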